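(* Let $k\in\mathbb{N}$, let $\mathcal{E}^{(k)}\colon H^k(0,1)\hookrightarrow L^2(0,1)$ be the natural embedding, and let $B^{(H)}\colon L^2(0,1)\to\ell^2$, $[B^{(H)}z]_j=\int_0^1t^{j-1}z(t)\,dt$ $(j=1,2,\dots)$, be the Hausdorff moment operator. Then there exist positive constants $C_k$, $\underline{C}$ and $\overline{C}$ such that $$\exp(-\underline{C}\,i)\le\exp\left(-\left(\frac{C_k}{\sigma_i(\mathcal{E}^{(k)})}\right)^{\frac1k}\right)\le\sigma_i\left(B^{(H)}\circ\mathcal{E}^{(k)}\right)\le\sqrt{\pi}\,\sigma_i\left(\mathcal{E}^{(k)}\right)\le\frac{\overline{C}}{i^k}$$ is valid for all sufficiently large indices $i\in\mathbb{N}$.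
   Context: All function spaces are real. For a compact linear operator $T$ between Hilbert spaces, $\sigma_1(T)\ge\sigma_2(T)\ge\dots$ denote its singular values, listed in non-increasing order with multiplicity. $H^k(0,1)$ is the $L^2$-based Sobolev space of integer order $k$ on $(0,1)$ with its usual Hilbert space norm; $\mathbb{N}=\{1,2,\dots\}$. The embedding $\mathcal{E}^{(k)}$ is compact. *)

theory Defs
  imports "HOL-Analysis.Analysis"
begin

section \<open>Singular values\<close>

text \<open>
  The domain of an operator is a Hilbert space given by a carrier \<open>V\<close> (a linear subspace of a
  real vector space) together with an inner product \<open>ip\<close> on it.  This is needed because a
  Sobolev space \<open>H\<^sup>k\<close> depends on the natural number \<open>k\<close>, and because its inner product is not the
  one of the ambient space.
\<close>

definition hilbert_adjoint ::
    "'a set \<Rightarrow> ('a \<Rightarrow> 'a \<Rightarrow> real) \<Rightarrow> ('a \<Rightarrow> 'b::real_inner) \<Rightarrow> 'b \<Rightarrow> 'a"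
  where "hilbert_adjoint V ip T y = (THE z. z \<in> V \<and> (\<forall>x\<in>V. ip x z = inner (T x) y))"

definition gram_eigenspace ::
    "'a::real_vector set \<Rightarrow> ('a \<Rightarrow> 'a \<Rightarrow> real) \<Rightarrow> ('a \<Rightarrow> 'b::real_inner) \<Rightarrow> real \<Rightarrow> 'a set"
  where "gram_eigenspace V ip T \<mu> = {u \<in> V. hilbert_adjoint V ip T (T u) = \<mu> *\<^sub>R u}"

text \<open>
  \<open>s 1 \<ge> s 2 \<ge> \<dots> \<ge> 0\<close> lists the singular values of \<open>T\<close>: every \<open>r > 0\<close> occurs as often as the
  multiplicity of \<open>r\<^sup>2\<close> as an eigenvalue of \<open>T\<^sup>* T\<close>, i.e. not at all if \<open>r\<^sup>2\<close> is not an
  eigenvalue.  If there are only finitely many singular values, the list is continued by zeros.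
  The entry \<open>s 0\<close> is irrelevant.
\<close>

definition singular_value_sequence ::
    "'a::real_vector set \<Rightarrow> ('a \<Rightarrow> 'a \<Rightarrow> real) \<Rightarrow> ('a \<Rightarrow> 'b::real_inner) \<Rightarrow> (nat \<Rightarrow> real) \<Rightarrow> bool"
  where "singular_value_sequence V ip T s \<longleftrightarrow>
    (\<forall>i\<ge>1. 0 \<le> s i) \<and>
    (\<forall>i\<ge>1. s (Suc i) \<le> s i) \<and>
    (\<forall>r>0. finite {i. 1 \<le> i \<and> s i = r} \<and>
           card {i. 1 \<le> i \<and> s i = r} = dim (gram_eigenspace V ip T (r\<^sup>2)))"

text \<open>For a compact operator such a list exists and its entries with index \<open>i \<ge> 1\<close> are unique.\<close>

definition singular_value ::
    "'a::real_vector set \<Rightarrow> ('a \<Rightarrow> 'a \<Rightarrow> real) \<Rightarrow> ('a \<Rightarrow> 'b::real_inner) \<Rightarrow> nat \<Rightarrow> real"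
  where "singular_value V ip T i = (SOME s. singular_value_sequence V ip T s) i"


section \<open>The space \<open>L\<^sup>2(0,1)\<close>\<close>

abbreviation lebesgue01 :: "real measure"
  where "lebesgue01 \<equiv> lebesgue_on {0<..<1}"

definition square_integrable01 :: "(real \<Rightarrow> real) \<Rightarrow> bool"
  where "square_integrable01 f \<longleftrightarrow>
    f \<in> borel_measurable lebesgue01 \<and> integrable lebesgue01 (\<lambda>t. (f t)\<^sup>2)"

lemma square_integrable01_mult:
  assumes "square_integrable01 f" "square_integrable01 g"
  shows "integrable lebesgue01 (\<lambda>t. f t * g t)"
proof (rule Bochner_Integration.integrable_bound)
  show "integrable lebesgue01 (\<lambda>t. (f t)\<^sup>2 + (g t)\<^sup>2)"
    using assms by (auto simp: square_integrable01_def)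
  show "(\<lambda>t. f t * g t) \<in> borel_measurable lebesgue01"
    using assms by (auto simp: square_integrable01_def)
  have "\<bar>a * b\<bar> \<le> a\<^sup>2 + b\<^sup>2" for a b :: real
  proof -
    have "0 \<le> (\<bar>a\<bar> - \<bar>b\<bar>)\<^sup>2" by simp
    moreover have "(\<bar>a\<bar> - \<bar>b\<bar>)\<^sup>2 = a\<^sup>2 + b\<^sup>2 - 2 * \<bar>a * b\<bar>"
      by (simp add: power2_diff abs_mult)
    ultimately show ?thesis
      using abs_ge_zero [of "a * b"] by linarith
  qed
  then show "AE t in lebesgue01. norm (f t * g t) \<le> norm ((f t)\<^sup>2 + (g t)\<^sup>2)"
    by simp
qed

lemma square_integrable01_add:
  assumes "square_integrable01 f" "square_integrable01 g"
  shows "square_integrable01 (\<lambda>t. f t + g t)"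
  using assms square_integrable01_mult [OF assms]
  by (auto simp: square_integrable01_def power2_sum mult.assoc)

lemma square_integrable01_scale:
  "square_integrable01 f \<Longrightarrow> square_integrable01 (\<lambda>t. c * f t)"
  by (auto simp: square_integrable01_def power_mult_distrib)

lemma square_integrable01_zero: "square_integrable01 (\<lambda>t. 0)"
  by (simp add: square_integrable01_def)

definition L2_rel :: "(real \<Rightarrow> real) \<Rightarrow> (real \<Rightarrow> real) \<Rightarrow> bool"
  where "L2_rel f g \<longleftrightarrow>
    square_integrable01 f \<and> square_integrable01 g \<and> (AE t in lebesgue01. f t = g t)"

lemma L2_rel_part_equivp: "part_equivp L2_rel"
proof (rule part_equivpI)
  show "\<exists>f. L2_rel f f"
    using square_integrable01_zero by (auto simp: L2_rel_def)
  show "symp L2_rel"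
    by (auto simp: symp_def L2_rel_def eq_commute)
  show "transp L2_rel"
    by (auto simp: transp_def L2_rel_def)
qed

quotient_type L2 = "real \<Rightarrow> real" / partial: L2_rel
  by (rule L2_rel_part_equivp)

lemma L2_rel_integral_mult:
  assumes "L2_rel f f'" "L2_rel g g'"
  shows "(LINT t|lebesgue01. f t * g t) = (LINT t|lebesgue01. f' t * g' t)"
  by (rule integral_cong_AE)
     (use assms in \<open>auto simp: L2_rel_def square_integrable01_def\<close>)

instantiation L2 :: real_inner
begin

lift_definition zero_L2 :: L2 is "\<lambda>t. 0"
  by (simp add: L2_rel_def square_integrable01_zero)

lift_definition plus_L2 :: "L2 \<Rightarrow> L2 \<Rightarrow> L2" is "\<lambda>f g t. f t + g t"
  by (auto simp: L2_rel_def intro: square_integrable01_add)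

lift_definition scaleR_L2 :: "real \<Rightarrow> L2 \<Rightarrow> L2" is "\<lambda>c f t. c * f t"
  by (auto simp: L2_rel_def intro: square_integrable01_scale)

definition uminus_L2 :: "L2 \<Rightarrow> L2" where "uminus_L2 f = (-1) *\<^sub>R f"

definition minus_L2 :: "L2 \<Rightarrow> L2 \<Rightarrow> L2" where "minus_L2 f g = f + (-1) *\<^sub>R g"

lift_definition inner_L2 :: "L2 \<Rightarrow> L2 \<Rightarrow> real" is "\<lambda>f g. LINT t|lebesgue01. f t * g t"
  by (rule L2_rel_integral_mult)

definition norm_L2 :: "L2 \<Rightarrow> real" where "norm_L2 f = sqrt (inner f f)"

definition sgn_L2 :: "L2 \<Rightarrow> L2" where "sgn_L2 f = inverse (norm f) *\<^sub>R f"

definition dist_L2 :: "L2 \<Rightarrow> L2 \<Rightarrow> real" where "dist_L2 f g = norm (f - g)"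

definition uniformity_L2 :: "(L2 \<times> L2) filter"
  where "uniformity_L2 = (INF e\<in>{0 <..}. principal {(x, y). dist x y < e})"

definition open_L2 :: "L2 set \<Rightarrow> bool"
  where "open_L2 U \<longleftrightarrow> (\<forall>x\<in>U. eventually (\<lambda>(x', y). x' = x \<longrightarrow> y \<in> U) uniformity)"

instance
proof
  fix f g h :: L2 and a b :: real
  show "f + g + h = f + (g + h)"
    by transfer (auto simp: L2_rel_def add.assoc intro!: square_integrable01_add)
  show "f + g = g + f"
    by transfer (auto simp: L2_rel_def add.commute intro!: square_integrable01_add)
  show "0 + f = f"
    by transfer (auto simp: L2_rel_def)
  show "- f + f = 0"
    unfolding uminus_L2_def
    by transfer (auto simp: L2_rel_def square_integrable01_zero)
  show "f - g = f + - g"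
    by (simp add: uminus_L2_def minus_L2_def)
  show "a *\<^sub>R (f + g) = a *\<^sub>R f + a *\<^sub>R g"
    by transfer (auto simp: L2_rel_def distrib_left
        intro!: square_integrable01_add square_integrable01_scale)
  show "(a + b) *\<^sub>R f = a *\<^sub>R f + b *\<^sub>R f"
    by transfer (auto simp: L2_rel_def distrib_right
        intro!: square_integrable01_add square_integrable01_scale)
  show "a *\<^sub>R b *\<^sub>R f = (a * b) *\<^sub>R f"
    by transfer (auto simp: L2_rel_def mult.assoc intro!: square_integrable01_scale)
  show "1 *\<^sub>R f = f"
    by transfer (auto simp: L2_rel_def)
  show "dist f g = norm (f - g)"
    by (rule dist_L2_def)
  show "sgn f = inverse (norm f) *\<^sub>R f"
    by (rule sgn_L2_def)
  show "uniformity = (INF e\<in>{0 <..}. principal {(x::L2, y). dist x y < e})"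
    by (rule uniformity_L2_def)
  show "open U \<longleftrightarrow> (\<forall>x\<in>U. eventually (\<lambda>(x', y). x' = x \<longrightarrow> y \<in> U) uniformity)"
    for U :: "L2 set"
    by (rule open_L2_def)
  show "inner f g = inner g f"
    by transfer (simp add: mult.commute)
  show "inner (f + g) h = inner f h + inner g h"
    by transfer (simp add: L2_rel_def distrib_right square_integrable01_mult)
  show "inner (a *\<^sub>R f) g = a * inner f g"
    by transfer (simp add: L2_rel_def mult.assoc)
  show "0 \<le> inner f f"
    by transfer simp
  show "inner f f = 0 \<longleftrightarrow> f = 0"
  proof transfer
    fix f assume f: "L2_rel f f"
    then have "integrable lebesgue01 (\<lambda>t. f t * f t)"
      by (simp add: L2_rel_def square_integrable01_mult)
    then have "(LINT t|lebesgue01. f t * f t) = 0 \<longleftrightarrow> (AE t in lebesgue01. f t * f t = 0)"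
      by (intro integral_nonneg_eq_0_iff_AE) auto
    also have "\<dots> \<longleftrightarrow> L2_rel f (\<lambda>t. 0)"
      using f by (simp add: L2_rel_def square_integrable01_zero)
    finally show "(LINT t|lebesgue01. f t * f t) = 0 \<longleftrightarrow> L2_rel f (\<lambda>t. 0)" .
  qed
  show "norm f = sqrt (inner f f)"
    by (rule norm_L2_def)
qed

end


section \<open>The Sobolev spaces \<open>H\<^sup>k(0,1)\<close>\<close>

text \<open>The space \<open>C\<^sub>c\<^sup>\<infinity>(0,1)\<close>, its elements being extended by zero to the real line.\<close>

definition test_function01 :: "(real \<Rightarrow> real) \<Rightarrow> bool"
  where "test_function01 \<phi> \<longleftrightarrow>
    (\<forall>n t. (deriv ^^ n) \<phi> field_differentiable (at t)) \<and>
    (\<exists>a b. 0 < a \<and> b < 1 \<and> (\<forall>t. t \<notin> {a..b} \<longrightarrow> \<phi> t = 0))"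

lemma test_function01_deriv_measurable:
  assumes "test_function01 \<phi>"
  shows "(deriv ^^ n) \<phi> \<in> borel_measurable lebesgue01"
proof -
  have "continuous_on UNIV ((deriv ^^ n) \<phi>)"
    using assms
    by (auto simp: test_function01_def continuous_on_eq_continuous_at
        intro: field_differentiable_imp_continuous_at)
  then have "(deriv ^^ n) \<phi> \<in> borel_measurable borel"
    by (rule borel_measurable_continuous_onI)
  then show ?thesis
    by (intro measurable_restrict_space1 measurable_completion) simp
qed

lift_definition has_weak_deriv01 :: "nat \<Rightarrow> L2 \<Rightarrow> L2 \<Rightarrow> bool" is
  "\<lambda>j u v. \<forall>\<phi>. test_function01 \<phi> \<longrightarrow>
     (LINT t|lebesgue01. u t * (deriv ^^ j) \<phi> t) = (-1) ^ j * (LINT t|lebesgue01. v t * \<phi> t)"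
proof -
  have *: "(LINT t|lebesgue01. f t * (deriv ^^ j) \<phi> t) = (LINT t|lebesgue01. g t * (deriv ^^ j) \<phi> t)"
    if "L2_rel f g" "test_function01 \<phi>" for f g \<phi> j
    by (rule integral_cong_AE)
       (use that test_function01_deriv_measurable [OF that(2), of j]
         in \<open>auto simp: L2_rel_def square_integrable01_def\<close>)
  fix j :: nat and f g f' g' :: "real \<Rightarrow> real"
  assume "L2_rel f g" "L2_rel f' g'"
  then show "(\<forall>\<phi>. test_function01 \<phi> \<longrightarrow>
      (LINT t|lebesgue01. f t * (deriv ^^ j) \<phi> t) = (-1) ^ j * (LINT t|lebesgue01. f' t * \<phi> t)) =
    (\<forall>\<phi>. test_function01 \<phi> \<longrightarrow>
      (LINT t|lebesgue01. g t * (deriv ^^ j) \<phi> t) = (-1) ^ j * (LINT t|lebesgue01. g' t * \<phi> t))"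
    using * [of f g _ j] * [of f' g' _ 0] by simp
qed

definition weak_deriv01 :: "nat \<Rightarrow> L2 \<Rightarrow> L2"
  where "weak_deriv01 j u = (THE v. has_weak_deriv01 j u v)"

definition sobolev01 :: "nat \<Rightarrow> L2 set"
  where "sobolev01 k = {u. \<forall>j\<le>k. \<exists>v. has_weak_deriv01 j u v}"

definition sobolev01_inner :: "nat \<Rightarrow> L2 \<Rightarrow> L2 \<Rightarrow> real"
  where "sobolev01_inner k u v = (\<Sum>j\<le>k. inner (weak_deriv01 j u) (weak_deriv01 j v))"

definition sobolev01_embedding :: "nat \<Rightarrow> L2 \<Rightarrow> L2"
  where "sobolev01_embedding k = restrict id (sobolev01 k)"


section \<open>The space \<open>\<ell>\<^sup>2\<close>\<close>

typedef ell2 = "{x :: nat \<Rightarrow> real. summable (\<lambda>n. (x n)\<^sup>2)}"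
  by (rule exI [of _ "\<lambda>n. 0"]) simp

setup_lifting type_definition_ell2

lemma ell2_summable_mult:
  fixes x y :: "nat \<Rightarrow> real"
  assumes "summable (\<lambda>n. (x n)\<^sup>2)" "summable (\<lambda>n. (y n)\<^sup>2)"
  shows "summable (\<lambda>n. x n * y n)"
proof (rule summable_comparison_test')
  show "summable (\<lambda>n. (x n)\<^sup>2 + (y n)\<^sup>2)"
    using assms by (rule summable_add)
  fix n
  have "0 \<le> (\<bar>x n\<bar> - \<bar>y n\<bar>)\<^sup>2" by simp
  moreover have "(\<bar>x n\<bar> - \<bar>y n\<bar>)\<^sup>2 = (x n)\<^sup>2 + (y n)\<^sup>2 - 2 * \<bar>x n * y n\<bar>"
    by (simp add: power2_diff abs_mult)
  ultimately show "norm (x n * y n) \<le> (x n)\<^sup>2 + (y n)\<^sup>2"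
    using abs_ge_zero [of "x n * y n"] unfolding real_norm_def by linarith
qed

lemma ell2_summable_add:
  fixes x y :: "nat \<Rightarrow> real"
  assumes "summable (\<lambda>n. (x n)\<^sup>2)" "summable (\<lambda>n. (y n)\<^sup>2)"
  shows "summable (\<lambda>n. (x n + y n)\<^sup>2)"
proof -
  have "summable (\<lambda>n. (x n)\<^sup>2 + (y n)\<^sup>2 + 2 * (x n * y n))"
    by (intro summable_add summable_mult assms ell2_summable_mult)
  then show ?thesis
    by (simp add: power2_sum mult.assoc)
qed

instantiation ell2 :: real_inner
begin

lift_definition zero_ell2 :: ell2 is "\<lambda>n. 0"
  by simp

lift_definition plus_ell2 :: "ell2 \<Rightarrow> ell2 \<Rightarrow> ell2" is "\<lambda>x y n. x n + y n"
  by (rule ell2_summable_add)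

lift_definition scaleR_ell2 :: "real \<Rightarrow> ell2 \<Rightarrow> ell2" is "\<lambda>c x n. c * x n"
  by (simp add: power_mult_distrib summable_mult)

definition uminus_ell2 :: "ell2 \<Rightarrow> ell2" where "uminus_ell2 x = (-1) *\<^sub>R x"

definition minus_ell2 :: "ell2 \<Rightarrow> ell2 \<Rightarrow> ell2" where "minus_ell2 x y = x + (-1) *\<^sub>R y"

lift_definition inner_ell2 :: "ell2 \<Rightarrow> ell2 \<Rightarrow> real" is "\<lambda>x y. \<Sum>n. x n * y n" .

definition norm_ell2 :: "ell2 \<Rightarrow> real" where "norm_ell2 x = sqrt (inner x x)"

definition sgn_ell2 :: "ell2 \<Rightarrow> ell2" where "sgn_ell2 x = inverse (norm x) *\<^sub>R x"

definition dist_ell2 :: "ell2 \<Rightarrow> ell2 \<Rightarrow> real" where "dist_ell2 x y = norm (x - y)"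

definition uniformity_ell2 :: "(ell2 \<times> ell2) filter"
  where "uniformity_ell2 = (INF e\<in>{0 <..}. principal {(x, y). dist x y < e})"

definition open_ell2 :: "ell2 set \<Rightarrow> bool"
  where "open_ell2 U \<longleftrightarrow> (\<forall>x\<in>U. eventually (\<lambda>(x', y). x' = x \<longrightarrow> y \<in> U) uniformity)"

instance
proof
  fix x y z :: ell2 and a b :: real
  show "x + y + z = x + (y + z)"
    by transfer (simp add: add.assoc)
  show "x + y = y + x"
    by transfer (simp add: add.commute)
  show "0 + x = x"
    by transfer simp
  show "- x + x = 0"
    unfolding uminus_ell2_def by transfer simp
  show "x - y = x + - y"
    by (simp add: uminus_ell2_def minus_ell2_def)
  show "a *\<^sub>R (x + y) = a *\<^sub>R x + a *\<^sub>R y"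
    by transfer (simp add: distrib_left)
  show "(a + b) *\<^sub>R x = a *\<^sub>R x + b *\<^sub>R x"
    by transfer (simp add: distrib_right)
  show "a *\<^sub>R b *\<^sub>R x = (a * b) *\<^sub>R x"
    by transfer (simp add: mult.assoc)
  show "1 *\<^sub>R x = x"
    by transfer simp
  show "dist x y = norm (x - y)"
    by (rule dist_ell2_def)
  show "sgn x = inverse (norm x) *\<^sub>R x"
    by (rule sgn_ell2_def)
  show "uniformity = (INF e\<in>{0 <..}. principal {(x::ell2, y). dist x y < e})"
    by (rule uniformity_ell2_def)
  show "open U \<longleftrightarrow> (\<forall>x\<in>U. eventually (\<lambda>(x', y). x' = x \<longrightarrow> y \<in> U) uniformity)"
    for U :: "ell2 set"
    by (rule open_ell2_def)
  show "inner x y = inner y x"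
    by transfer (simp add: mult.commute)
  show "inner (x + y) z = inner x z + inner y z"
    by transfer (simp add: distrib_right suminf_add ell2_summable_mult)
  show "inner (a *\<^sub>R x) y = a * inner x y"
    by transfer (simp add: mult.assoc suminf_mult ell2_summable_mult)
  show "0 \<le> inner x x"
    by transfer (simp add: suminf_nonneg ell2_summable_mult)
  show "inner x x = 0 \<longleftrightarrow> x = 0"
    by transfer (auto simp: suminf_eq_zero_iff ell2_summable_mult)
  show "norm x = sqrt (inner x x)"
    by (rule norm_ell2_def)
qed

end


section \<open>The Hausdorff moment operator\<close>

lemma hilbert_row_sum:
  "(\<Sum>j<N. 1 / ((real i + real j + 1) * sqrt (real j + 1/2))) \<le> 2 * pi / sqrt (real i + 1/2)"
proof -
  define a where "a = real i + 1/2"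
  have a: "a > 0" by (simp add: a_def)
  define b where "b = sqrt a"
  have b: "b > 0" "b\<^sup>2 = a" using a by (auto simp: b_def)
  define f where "f x = 2 / b * arctan (sqrt x / b)" for x
  have mono: "f x \<le> f y" if "x \<le> y" for x y
    unfolding f_def using that b
    by (intro mult_left_mono arctan_monotone' divide_right_mono) auto
  have step: "1 / ((real i + real j + 1) * sqrt (real j + 1/2)) \<le> 2 * (f (real (Suc j)) - f (real j))" for j
  proof -
    have der: "(f has_real_derivative 1 / ((x + a) * sqrt x)) (at x)" if "x > 0" for x
    proof -
      have "(f has_real_derivative
          2 / b * (1 / (1 + (sqrt x / b)\<^sup>2) * (1 / (2 * sqrt x * b)))) (at x)"
        unfolding f_def using that b(1)
        by (auto intro!: derivative_eq_intros simp: inverse_eq_divide)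
      moreover have "2 / b * (1 / (1 + (sqrt x / b)\<^sup>2) * (1 / (2 * sqrt x * b)))
          = 1 / ((b\<^sup>2 * (1 + (sqrt x / b)\<^sup>2)) * sqrt x)"
        by (simp add: power2_eq_square)
      moreover have "b\<^sup>2 * (1 + (sqrt x / b)\<^sup>2) = x + a"
        using that a b by (simp add: power_divide distrib_left)
      ultimately show ?thesis by (simp only:)
    qed
    have cont: "continuous_on {real j..real j + 1/2} f"
      unfolding f_def using b by (intro continuous_intros) auto
    have "\<exists>l z. real j < z \<and> z < real j + 1/2 \<and> DERIV f z :> l \<and>
        f (real j + 1/2) - f (real j) = (real j + 1/2 - real j) * l"
    proof (rule MVT [OF _ cont])
      fix x assume "real j < x"
      then have "x > 0" by simp
      then show "f differentiable (at x)"
        using der real_differentiable_def by blast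
    qed simp
    then obtain l z where z: "real j < z" "z < real j + 1/2" "DERIV f z :> l"
      and l: "f (real j + 1/2) - f (real j) = l / 2" by auto
    have "l = 1 / ((z + a) * sqrt z)"
      using z by (intro DERIV_unique [OF z(3) der]) auto
    moreover have "(z + a) * sqrt z \<le> (real i + real j + 1) * sqrt (real j + 1/2)"
      using z by (intro mult_mono) (auto simp: a_def)
    moreover have "0 < (z + a) * sqrt z"
      using z a by simp
    ultimately have "1 / ((real i + real j + 1) * sqrt (real j + 1/2)) \<le> l"
      by (simp add: frac_le)
    moreover have "f (real j + 1/2) \<le> f (real (Suc j))"
      by (rule mono) simp
    with l have "l \<le> 2 * (f (real (Suc j)) - f (real j))"
      by (simp add: field_simps)
    ultimately show ?thesis
      by (rule order_trans)
  qed
  have "(\<Sum>j<N. 1 / ((real i + real j + 1) * sqrt (real j + 1/2)))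
      \<le> (\<Sum>j<N. 2 * (f (real (Suc j)) - f (real j)))"
    by (intro sum_mono step)
  also have "\<dots> = 2 * (f (real N) - f 0)"
    using sum_lessThan_telescope [of "\<lambda>j. f (real j)" N]
    by (simp only: sum_distrib_left [symmetric] of_nat_0)
  also have "\<dots> = 4 / b * arctan (sqrt (real N) / b)"
    by (simp add: f_def)
  also have "\<dots> \<le> 4 / b * (pi / 2)"
    using b by (intro mult_left_mono less_imp_le [OF arctan_ubound]) auto
  finally show ?thesis
    by (simp add: a_def b_def)
qed

lemma hilbert_inequality_aux:
  "(\<Sum>i<N. \<Sum>j<N. x i * x j / (real i + real j + 1)) \<le> 2 * pi * (\<Sum>i<N. (x i)\<^sup>2)"
proof -
  define w where "w i = sqrt (real i + 1/2)" for i :: nat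
  define K where "K i j = (x i)\<^sup>2 * w i / ((real i + real j + 1) * w j)" for i j
  have w: "w i > 0" for i by (simp add: w_def)
  have "x i * x j / (real i + real j + 1) \<le> (K i j + K j i) / 2" for i j
  proof -
    define r where "r = sqrt (w i / w j)"
    have r: "r > 0" "r\<^sup>2 = w i / w j" using w [of i] w [of j] by (auto simp: r_def)
    have "0 \<le> (x i * r - x j / r)\<^sup>2" by simp
    also have "\<dots> = (x i)\<^sup>2 * r\<^sup>2 + (x j)\<^sup>2 / r\<^sup>2 - 2 * (x i * x j)"
      using r(1) by (simp add: power2_diff power_mult_distrib power_divide)
    finally have "x i * x j \<le> ((x i)\<^sup>2 * (w i / w j) + (x j)\<^sup>2 * (w j / w i)) / 2"
      unfolding r(2) by simp
    then have "x i * x j / (real i + real j + 1)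
        \<le> ((x i)\<^sup>2 * (w i / w j) + (x j)\<^sup>2 * (w j / w i)) / 2 / (real i + real j + 1)"
      by (intro divide_right_mono) auto
    also have "\<dots> = (K i j + K j i) / 2"
      by (simp add: K_def add_divide_distrib add_ac mult_ac)
    finally show ?thesis .
  qed
  then have "(\<Sum>i<N. \<Sum>j<N. x i * x j / (real i + real j + 1)) \<le> (\<Sum>i<N. \<Sum>j<N. (K i j + K j i) / 2)"
    by (intro sum_mono)
  also have "\<dots> = ((\<Sum>i<N. \<Sum>j<N. K i j) + (\<Sum>i<N. \<Sum>j<N. K j i)) / 2"
    by (simp add: sum.distrib flip: sum_divide_distrib)
  also have "(\<Sum>i<N. \<Sum>j<N. K j i) = (\<Sum>i<N. \<Sum>j<N. K i j)"
    by (rule sum.swap)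
  also have "((\<Sum>i<N. \<Sum>j<N. K i j) + (\<Sum>i<N. \<Sum>j<N. K i j)) / 2 = (\<Sum>i<N. \<Sum>j<N. K i j)"
    by simp
  also have "(\<Sum>i<N. \<Sum>j<N. K i j)
      = (\<Sum>i<N. (x i)\<^sup>2 * w i * (\<Sum>j<N. 1 / ((real i + real j + 1) * w j)))"
    by (simp add: K_def sum_distrib_left)
  also have "\<dots> \<le> (\<Sum>i<N. (x i)\<^sup>2 * w i * (2 * pi / w i))"
    using w less_imp_le by (intro sum_mono mult_left_mono) (auto simp: w_def hilbert_row_sum)
  also have "\<dots> = 2 * pi * (\<Sum>i<N. (x i)\<^sup>2)"
    using w by (simp add: sum_distrib_left less_imp_neq [symmetric] mult_ac)
  finally show ?thesis .
qed

lemma square_integrable01_power: "square_integrable01 (\<lambda>t. t ^ n)"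
proof -
  have m: "(\<lambda>t::real. t ^ n) \<in> borel_measurable lebesgue01"
    by (intro measurable_restrict_space1 measurable_completion) simp
  have "integrable lebesgue01 (\<lambda>t. (t ^ n)\<^sup>2)"
  proof (rule finite_measure.integrable_const_bound [where B = 1])
    show "finite_measure lebesgue01"
      by (rule finite_measure_lebesgue_on) simp
    show "AE t in lebesgue01. norm ((t ^ n)\<^sup>2) \<le> 1"
      by (rule AE_I2) (simp add: space_restrict_space power_le_one flip: power_mult)
  qed (use m in simp)
  with m show ?thesis by (simp add: square_integrable01_def)
qed

lemma integral01_power: "(LINT t|lebesgue01. t ^ n) = 1 / (real n + 1)"
proof -
  have "((\<lambda>x. x ^ Suc n / (real n + 1)) has_real_derivative x ^ n) (at x within {0..1})" for x :: real
    by (rule DERIV_cdivide [OF DERIV_power [OF DERIV_ident], THEN DERIV_cong])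
       (simp add: add.commute [of 1])
  then have "((\<lambda>t::real. t ^ n) has_integral 1 ^ Suc n / (real n + 1) - 0 ^ Suc n / (real n + 1)) {0..1}"
    by (intro fundamental_theorem_of_calculus)
       (auto simp: has_real_derivative_iff_has_vector_derivative [symmetric])
  then have "integral {0<..<1} (\<lambda>t::real. t ^ n) = 1 / (real n + 1)"
    by (simp add: integral_unique flip: integral_open_interval_real)
  moreover have "integrable lebesgue01 (\<lambda>t. t ^ n)"
    using square_integrable01_mult [OF square_integrable01_power [of 0] square_integrable01_power [of n]]
    by simp
  ultimately show ?thesis
    by (simp add: lebesgue_integral_eq_integral)
qed

lemma hausdorff_moments_summable:
  assumes z: "square_integrable01 z"
  shows "summable (\<lambda>n. (LINT t|lebesgue01. t ^ n * z t)\<^sup>2)"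
proof -
  define m where "m n = (LINT t|lebesgue01. t ^ n * z t)" for n
  define Z where "Z = (LINT t|lebesgue01. z t * z t)"
  have sq: "integrable lebesgue01 (\<lambda>t. t ^ i * z t)" "integrable lebesgue01 (\<lambda>t::real. t ^ i * t ^ j)"
      "integrable lebesgue01 (\<lambda>t. z t * z t)" for i j
    using z square_integrable01_power square_integrable01_mult by blast+
  have bound: "(\<Sum>n<N. (m n)\<^sup>2) \<le> 2 * pi * Z" for N
  proof -
    define S where "S = (\<Sum>n<N. (m n)\<^sup>2)"
    define c where "c = 1 / (2 * pi)"
    define p where "p t = (\<Sum>n<N. m n * t ^ n)" for t
    have pz: "(LINT t|lebesgue01. p t * z t) = S" and ipz: "integrable lebesgue01 (\<lambda>t. p t * z t)"
    proof -
      have e: "p t * z t = (\<Sum>n<N. m n * (t ^ n * z t))" for t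
        by (simp add: p_def sum_distrib_right mult.assoc)
      show "integrable lebesgue01 (\<lambda>t. p t * z t)"
        unfolding e by (intro Bochner_Integration.integrable_sum integrable_mult_right sq)
      show "(LINT t|lebesgue01. p t * z t) = S"
        unfolding e
        by (subst Bochner_Integration.integral_sum)
           (auto simp: S_def power2_eq_square sq simp flip: m_def)
    qed
    have pp: "(LINT t|lebesgue01. p t * p t) \<le> 2 * pi * S" and ipp: "integrable lebesgue01 (\<lambda>t. p t * p t)"
    proof -
      have e: "p t * p t = (\<Sum>i<N. \<Sum>j<N. m i * m j * (t ^ i * t ^ j))" for t
        by (simp add: p_def sum_product mult_ac)
      show "integrable lebesgue01 (\<lambda>t. p t * p t)"
        unfolding e by (intro Bochner_Integration.integrable_sum integrable_mult_right sq)
      have "(LINT t|lebesgue01. p t * p t) = (\<Sum>i<N. \<Sum>j<N. m i * m j * (LINT t|lebesgue01. t ^ i * t ^ j))"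
        unfolding e
        by (simp add: Bochner_Integration.integral_sum Bochner_Integration.integrable_sum sq)
      also have "\<dots> = (\<Sum>i<N. \<Sum>j<N. m i * m j / (real i + real j + 1))"
        by (simp add: integral01_power flip: power_add)
      also have "\<dots> \<le> 2 * pi * S"
        unfolding S_def by (rule hilbert_inequality_aux)
      finally show "(LINT t|lebesgue01. p t * p t) \<le> 2 * pi * S" .
    qed
    have "0 \<le> (LINT t|lebesgue01. (c * p t - z t)\<^sup>2)"
      by simp
    also have "(\<lambda>t. (c * p t - z t)\<^sup>2) = (\<lambda>t. c\<^sup>2 * (p t * p t) - 2 * c * (p t * z t) + z t * z t)"
      by (simp add: power2_eq_square algebra_simps)
    also have "(LINT t|lebesgue01. \<dots> t)
        = c\<^sup>2 * (LINT t|lebesgue01. p t * p t) - 2 * c * S + Z"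
      using ipp ipz sq(3) by (simp add: pz Z_def)
    also have "\<dots> \<le> c\<^sup>2 * (2 * pi * S) - 2 * c * S + Z"
      using pp by (simp add: mult_left_mono)
    also have "\<dots> = Z - S / (2 * pi)"
      by (simp add: c_def power2_eq_square)
    finally show ?thesis
      by (simp add: S_def field_simps)
  qed
  have "summable (\<lambda>n. (m n)\<^sup>2)"
    by (rule summableI_nonneg_bounded [OF _ bound]) simp
  then show ?thesis
    by (simp add: m_def)
qed

text \<open>Entries are indexed from \<open>0\<close>: entry \<open>n\<close> is the one usually numbered \<open>j = n + 1\<close>.\<close>

lift_definition hausdorff_moment :: "L2 \<Rightarrow> ell2" is
  "\<lambda>z n. LINT t|lebesgue01. t ^ n * z t"
  using hausdorff_moments_summable L2_rel_integral_mult square_integrable01_power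
  by (auto simp: L2_rel_def eq_onp_def intro!: ext)

end

theory Submission
  imports Defs "HOL-Computational_Algebra.Polynomial"
begin

text \<open>
  The eigenvalues of \<open>T\<^sup>* T\<close> are produced by successively maximizing \<open>\<langle>T x, T x\<rangle>\<close> over unit vectors, so the
  \<open>i\<close>-th singular value is bounded below by test spaces of dimension \<open>i\<close> and above by subspaces of codimension
  \<open>i - 1\<close>.

  The bound \<open>\<sigma>\<^sub>i(B E) \<le> sqrt \<pi> \<sigma>\<^sub>i(E)\<close> is Hilbert's inequality with its sharp constant.  For the embedding, the
  codimension \<open>k N\<close> subspace on which the first \<open>k\<close> derivatives have mean zero on each of \<open>N\<close> equal cells gives
  \<open>\<sigma>\<^sub>i(E) = O(i\<^sup>-\<^sup>k)\<close> by the Poincare inequality, and the cosines give a lower bound of the same order.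
  For polynomials \<open>p\<close> of degree less than \<open>i\<close>, \<open>\<parallel>p\<parallel>\<^sup>2\<close> is the pairing of the coefficients of \<open>p\<close> with its moments,
  and expansion in Chebyshev polynomials bounds the coefficients by \<open>e\<^sup>O\<^sup>(\<^sup>i\<^sup>) \<parallel>p\<parallel>\<close>; hence \<open>\<sigma>\<^sub>i(B E) \<ge> e\<^sup>-\<^sup>D\<^sup>i\<close>
  for some \<open>D\<close>.  Since \<open>\<sigma>\<^sub>i(E)\<close> is of exact order \<open>i\<^sup>-\<^sup>k\<close>, the exponent \<open>D i\<close> may be replaced by
  \<open>(C\<^sub>k / \<sigma>\<^sub>i(E))\<^sup>1\<^sup>/\<^sup>k\<close>.
\<close>

section \<open>Positive semidefinite forms\<close>

text \<open>The space \<open>sobolev01 k\<close> is a subset of the type \<open>L2\<close> with an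
  inner product of its own, so the spectral theory is done for pairs of bilinear forms on a carrier
  set, and one development serves both operators. \<open>hilbert_adjoint\<close> is a
  \<open>THE\<close> and \<open>singular_value\<close> a \<open>SOME\<close>; hence representers,
  the full eigenspaces for positive eigenvalues and the uniqueness of the ordered list have to be
  established before any estimate reaches the statement. Both operators have infinite rank, so all
  entries of both lists are positive and \<open>C_k / \<sigma>\<close> is a genuine quotient. The
  middle exponent is matched from both sides: an upper bound \<open>A / i ^ k\<close> for \<sigma>
  makes \<open>(A * D ^ k / \<sigma>) powr (1 / k)\<close> at least \<open>D * i\<close>, and a
  lower bound of the same order makes it at most \<open>L * i\<close>. The rate \<open>D\<close> may
  therefore be wasteful, and the polynomial estimates need not be sharp. The constant that must be
  sharp is \<open>pi\<close> in Hilbert's inequality: the version behind the definition of the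
  moment operator has \<open>2 * pi\<close>, so it is proved again with a midpoint argument.\<close>

text \<open>Gaussian elimination on the last equation: its pivot unknown is removed from the others,
  which leaves one equation and one unknown fewer. This dimension count drives both min-max
  bounds.\<close>

lemma nontrivial_solution_of_linear_equations:
  fixes M :: "nat \<Rightarrow> 'b \<Rightarrow> real"
  assumes "finite J" "n < card J"
  shows "\<exists>c. (\<exists>j\<in>J. c j \<noteq> 0) \<and> (\<forall>i<n. (\<Sum>j\<in>J. M i j * c j) = 0)"
  using assms
proof (induction n arbitrary: M J)
  case 0
  then have "J \<noteq> {}" by auto
  then show ?case by (intro exI [of _ "\<lambda>j. 1"]) auto
next
  case (Suc n)
  show ?case
  proof (cases "\<forall>j\<in>J. M n j = 0")
    case True
    from Suc.prems have "n < card J" by simp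
    with Suc.IH [of J M] Suc.prems obtain c where c: "\<exists>j\<in>J. c j \<noteq> 0" "\<forall>i<n. (\<Sum>j\<in>J. M i j * c j) = 0"
      by blast
    then show ?thesis using True by (intro exI [of _ c]) (auto simp: less_Suc_eq)
  next
    case False
    then obtain p where p: "p \<in> J" "M n p \<noteq> 0" by blast
    define M' where "M' i j = M i j - M i p * M n j / M n p" for i j
    have "n < card (J - {p})" using Suc.prems p by simp
    with Suc.IH [of "J - {p}" M'] Suc.prems obtain c
      where c: "\<exists>j\<in>J - {p}. c j \<noteq> 0" "\<forall>i<n. (\<Sum>j\<in>J - {p}. M' i j * c j) = 0"
      by blast
    define S where "S = (\<Sum>j\<in>J - {p}. M n j * c j)"
    \<comment> \<open>Back substitution: the value at \<open>p\<close> makes equation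
      \<open>n\<close> hold, and \<open>M'\<close> was chosen so that the other equations
      survive.\<close>
    define c' where "c' = c(p := - S / M n p)"
    have split: "(\<Sum>j\<in>J. M i j * c' j) = M i p * (- S / M n p) + (\<Sum>j\<in>J - {p}. M i j * c j)" for i
      using Suc.prems p by (subst sum.remove [of _ p]) (auto simp: c'_def intro!: sum.cong)
    have "(\<Sum>j\<in>J. M i j * c' j) = 0" if "i < n" for i
    proof -
      have "0 = (\<Sum>j\<in>J - {p}. M i j * c j - M i p / M n p * (M n j * c j))"
        using c that by (simp add: M'_def algebra_simps)
      also have "\<dots> = (\<Sum>j\<in>J - {p}. M i j * c j) - M i p / M n p * S"
        by (simp only: S_def sum_subtractf sum_distrib_left)
      finally show ?thesis by (simp add: split)
    qed
    moreover have "(\<Sum>j\<in>J. M n j * c' j) = 0"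
      unfolding split S_def [symmetric] using p by simp
    ultimately have "\<forall>i<Suc n. (\<Sum>j\<in>J. M i j * c' j) = 0" by (simp add: less_Suc_eq)
    moreover have "\<exists>j\<in>J. c' j \<noteq> 0" using c by (auto simp: c'_def)
    ultimately show ?thesis by blast
  qed
qed

text \<open>Bolzano-Weierstrass one coordinate at a time: each refinement keeps the convergence
  already obtained. It takes the place of weak sequential compactness in
  \<open>maximizer\<close>.\<close>

lemma bounded_real_families_convergent_subseq:
  fixes g :: "nat \<Rightarrow> nat \<Rightarrow> real"
  assumes "\<And>j. j < m \<Longrightarrow> bounded (range (\<lambda>n. g n j))"
  shows "\<exists>r. strict_mono r \<and> (\<forall>j<m. convergent (\<lambda>n. g (r n) j))"
  using assms
proof (induction m)
  case 0
  show ?case by (intro exI [of _ id]) (auto simp: strict_mono_def)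
next
  case (Suc m)
  then obtain r where r: "strict_mono r" "\<forall>j<m. convergent (\<lambda>n. g (r n) j)" by force
  have "bounded (range (\<lambda>n. g (r n) m))"
    by (rule bounded_subset [OF Suc.prems [of m]]) auto
  then obtain l s where s: "strict_mono s" "((\<lambda>n. g (r n) m) \<circ> s) \<longlonglongrightarrow> l"
    using bounded_imp_convergent_subsequence by blast
  have "convergent (\<lambda>n. g ((r \<circ> s) n) j)" if "j < Suc m" for j
  proof (cases "j = m")
    case True
    with s show ?thesis by (auto simp: convergent_def o_def)
  next
    case False
    with that r have "convergent (\<lambda>n. g (r n) j)" by simp
    from convergent_subseq_convergent [OF this s(1)] show ?thesis by (simp add: o_def)
  qed
  with strict_mono_o [OF r(1) s(1)] show ?case by blast
qed

text \<open>Semidefinite instead of definite, because the locale is instantiated by the inner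
  product, by the form of an operator that may have a kernel, and by the difference
  \<open>M * ip - a\<close>.\<close>

locale psd_form =
  fixes V :: "'a::real_vector set" and a :: "'a \<Rightarrow> 'a \<Rightarrow> real"
  assumes subspace_V: "subspace V"
    and sym: "x \<in> V \<Longrightarrow> y \<in> V \<Longrightarrow> a x y = a y x"
    and add_left: "x \<in> V \<Longrightarrow> y \<in> V \<Longrightarrow> z \<in> V \<Longrightarrow> a (x + y) z = a x z + a y z"
    and scale_left: "x \<in> V \<Longrightarrow> z \<in> V \<Longrightarrow> a (c *\<^sub>R x) z = c * a x z"
    and nonneg: "x \<in> V \<Longrightarrow> 0 \<le> a x x"
begin

lemmas V_closed = subspace_add [OF subspace_V] subspace_scale [OF subspace_V]
  subspace_diff [OF subspace_V] subspace_0 [OF subspace_V]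

lemma V_sum: "(\<And>i. i \<in> I \<Longrightarrow> v i \<in> V) \<Longrightarrow> (\<Sum>i\<in>I. c i *\<^sub>R v i) \<in> V"
  by (intro subspace_sum subspace_V V_closed) auto

lemma add_right: "x \<in> V \<Longrightarrow> y \<in> V \<Longrightarrow> z \<in> V \<Longrightarrow> a z (x + y) = a z x + a z y"
  using add_left sym V_closed by metis

lemma scale_right: "x \<in> V \<Longrightarrow> z \<in> V \<Longrightarrow> a z (c *\<^sub>R x) = c * a z x"
  using scale_left sym V_closed by metis

lemma diff_left: "x \<in> V \<Longrightarrow> y \<in> V \<Longrightarrow> z \<in> V \<Longrightarrow> a (x - y) z = a x z - a y z"
  using add_left [of x "(-1) *\<^sub>R y" z] scale_left [of y z "-1"] subspace_neg [OF subspace_V, of y]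
  by simp

lemma diff_right: "x \<in> V \<Longrightarrow> y \<in> V \<Longrightarrow> z \<in> V \<Longrightarrow> a z (x - y) = a z x - a z y"
  using diff_left sym V_closed by metis

lemma zero_left: "z \<in> V \<Longrightarrow> a 0 z = 0"
  using scale_left [of 0 z 0] V_closed by simp

lemma sum_left:
  assumes "\<And>i. i \<in> I \<Longrightarrow> v i \<in> V" "z \<in> V"
  shows "a (\<Sum>i\<in>I. c i *\<^sub>R v i) z = (\<Sum>i\<in>I. c i * a (v i) z)"
  using assms(1)
proof (induction I rule: infinite_finite_induct)
  case (insert i I)
  then have "(\<Sum>i\<in>I. c i *\<^sub>R v i) \<in> V" by (intro V_sum) auto
  with insert assms(2) V_closed show ?case by (simp add: add_left scale_left)
qed (use zero_left assms in auto)

lemma sum_right: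
  assumes "\<And>i. i \<in> I \<Longrightarrow> v i \<in> V" "z \<in> V"
  shows "a z (\<Sum>i\<in>I. c i *\<^sub>R v i) = (\<Sum>i\<in>I. c i * a z (v i))"
proof -
  have "a z (\<Sum>i\<in>I. c i *\<^sub>R v i) = a (\<Sum>i\<in>I. c i *\<^sub>R v i) z"
    using assms V_sum sym by blast
  also have "\<dots> = (\<Sum>i\<in>I. c i * a z (v i))"
    using assms by (simp add: sum_left sym [of z])
  finally show ?thesis .
qed

lemma quadratic: "x \<in> V \<Longrightarrow> y \<in> V \<Longrightarrow> a (x + t *\<^sub>R y) (x + t *\<^sub>R y) = a x x + 2 * t * a x y + t\<^sup>2 * a y y"
  using sym [of x y] V_closed
  by (simp add: add_left add_right scale_left scale_right power2_eq_square algebra_simps)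

lemma Cauchy_Schwarz:
  assumes "x \<in> V" "y \<in> V"
  shows "(a x y)\<^sup>2 \<le> a x x * a y y"
proof -
  have q: "0 \<le> a x x + 2 * t * a x y + t\<^sup>2 * a y y" for t
    using quadratic [OF assms, of t] nonneg V_closed assms by metis
  show ?thesis
  proof (cases "a y y = 0")
    case True
    have "a x y = 0"
    proof (rule ccontr)
      assume "a x y \<noteq> 0"
      \<comment> \<open>At this \<open>t\<close> the affine function in \<open>q\<close> takes the
        value -1.\<close>
      then have "2 * (- (a x x + 1) / (2 * a x y)) * a x y = - (a x x + 1)" by simp
      with q [of "- (a x x + 1) / (2 * a x y)"] True show False by simp
    qed
    with True show ?thesis by simp
  next
    case False
    then have y: "a y y > 0" using nonneg [OF assms(2)] by simp
    have "0 \<le> a x x - (a x y)\<^sup>2 / a y y"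
      using q [of "- a x y / a y y"] y by (simp add: power2_eq_square field_simps)
    with y show ?thesis by (simp add: field_simps)
  qed
qed

text \<open>Parallelogram law with the nonnegative term \<open>a (x + y) (x + y)\<close>
  dropped.\<close>

lemma diff_le:
  assumes "x \<in> V" "y \<in> V"
  shows "a (x - y) (x - y) \<le> 2 * a x x + 2 * a y y"
  using quadratic [OF assms, of 1] quadratic [OF assms, of "-1"] nonneg [of "x + y"] V_closed assms
  by simp

end

section \<open>The eigenvalues of a compact form\<close>

text \<open>The form \<open>a\<close> is \<open>\<langle>T x, T y\<rangle>\<close> for an operator \<open>T\<close> on the Hilbert space \<open>(V, ip)\<close>.  Compactness of \<open>T\<close>
  is expressed without weak limits: up to \<open>e * ip\<close>, finitely many bounded functionals dominate \<open>a\<close>.\<close>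
locale compact_form = ip: psd_form V ip + a: psd_form V a
  for V :: "'a::real_vector set" and ip a +
  assumes definite: "x \<in> V \<Longrightarrow> ip x x = 0 \<Longrightarrow> x = 0"
    and complete: "(\<And>n. X n \<in> V) \<Longrightarrow>
      (\<And>e. e > 0 \<Longrightarrow> \<exists>N. \<forall>m\<ge>N. \<forall>n\<ge>N. ip (X m - X n) (X m - X n) < e) \<Longrightarrow>
      \<exists>x\<in>V. (\<lambda>n. ip (X n - x) (X n - x)) \<longlonglongrightarrow> 0"
    and compact: "e > 0 \<Longrightarrow> \<exists>(m::nat) f C. (\<forall>j<m. \<forall>x\<in>V. \<forall>y\<in>V. f j (x + y) = f j x + f j y) \<and>
      (\<forall>j<m. \<forall>x\<in>V. \<forall>c. f j (c *\<^sub>R x) = c * f j x) \<and>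
      (\<forall>j<m. \<forall>x\<in>V. (f j x)\<^sup>2 \<le> C * ip x x) \<and>
      (\<forall>x\<in>V. a x x \<le> e * ip x x + (\<Sum>j<m. (f j x)\<^sup>2))"
    and infinite_rank: "\<exists>v. (\<forall>j<n::nat. v j \<in> V) \<and>
      (\<forall>c. (\<exists>j<n. c j \<noteq> 0) \<longrightarrow> a (\<Sum>j<n. c j *\<^sub>R v j) (\<Sum>j<n. c j *\<^sub>R v j) > 0)"
begin

lemmas V_closed = ip.V_closed

text \<open>The instance \<open>e = 1\<close> of \<open>compact\<close>, each functional
  contributing at most the absolute value of \<open>C\<close>.\<close>

lemma bounded: "\<exists>K\<ge>0. \<forall>x\<in>V. a x x \<le> K * ip x x"
proof -
  obtain m :: nat and f C where b: "\<forall>j<m. \<forall>x\<in>V. (f j x)\<^sup>2 \<le> C * ip x x"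
    "\<forall>x\<in>V. a x x \<le> 1 * ip x x + (\<Sum>j<m. (f j x)\<^sup>2)"
    using compact [of 1] by auto
  have "a x x \<le> (1 + real m * \<bar>C\<bar>) * ip x x" if x: "x \<in> V" for x
  proof -
    have "(\<Sum>j<m. (f j x)\<^sup>2) \<le> (\<Sum>j<m. \<bar>C\<bar> * ip x x)"
    proof (rule sum_mono)
      fix j assume "j \<in> {..<m}"
      then have "(f j x)\<^sup>2 \<le> C * ip x x" using b x by simp
      also have "\<dots> \<le> \<bar>C\<bar> * ip x x" using ip.nonneg x by (intro mult_right_mono) auto
      finally show "(f j x)\<^sup>2 \<le> \<bar>C\<bar> * ip x x" .
    qed
    with b x show ?thesis by (fastforce simp: algebra_simps)
  qed
  then show ?thesis by (intro exI [of _ "1 + real m * \<bar>C\<bar>"]) auto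
qed

text \<open>For a maximizing sequence of the quotient of the two forms, \<open>M * ip - a\<close> is small along it, and
  the parallelogram law together with \<open>compact\<close> for the single value \<open>M / 2\<close> makes a subsequence Cauchy.\<close>
lemma maximizer:
  assumes W: "W = {x \<in> V. \<forall>j<n. ip x (d j) = 0}" and d: "\<And>j. j < n \<Longrightarrow> d j \<in> V"
    and pos: "x0 \<in> W" "a x0 x0 > 0"
  shows "\<exists>x\<in>W. ip x x = 1 \<and> a x x > 0 \<and> (\<forall>y\<in>W. a y y \<le> a x x * ip y y) \<and>
    (\<forall>y\<in>W. a x y = a x x * ip x y)"
proof -
  have subW: "subspace W"
    unfolding W subspace_def using V_closed d
    by (auto simp: ip.add_left ip.scale_left ip.zero_left)
  interpret wip: psd_form W ip
    by standard (use subW in \<open>auto simp: W ip.sym ip.add_left ip.scale_left ip.nonneg\<close>)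
  interpret wa: psd_form W a
    by standard (use subW in \<open>auto simp: W a.sym a.add_left a.scale_left a.nonneg\<close>)
  have WV: "x \<in> V" if "x \<in> W" for x using that W by simp
  obtain K where K: "\<forall>x\<in>V. a x x \<le> K * ip x x" using bounded by blast
  define R where "R = {a x x | x. x \<in> W \<and> ip x x = 1}"
  have normalize: "(1 / sqrt (ip x x)) *\<^sub>R x \<in> W \<and> ip ((1 / sqrt (ip x x)) *\<^sub>R x) ((1 / sqrt (ip x x)) *\<^sub>R x) = 1 \<and>
      a ((1 / sqrt (ip x x)) *\<^sub>R x) ((1 / sqrt (ip x x)) *\<^sub>R x) = a x x / ip x x"
    if "x \<in> W" "ip x x > 0" for x
    using that wip.V_closed
    by (simp add: wip.scale_left wip.scale_right wa.scale_left wa.scale_right field_simps)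
  have pos0: "ip x0 x0 > 0"
  proof (rule ccontr)
    assume "\<not> ip x0 x0 > 0"
    then have "ip x0 x0 = 0" using ip.nonneg [OF WV [OF pos(1)]] by simp
    then have "a x0 x0 \<le> 0" using K WV [OF pos(1)] by fastforce
    with pos(2) show False by simp
  qed
  have bdd: "bdd_above R"
  proof (rule bdd_aboveI)
    fix r assume "r \<in> R"
    then obtain x where "x \<in> W" "ip x x = 1" "r = a x x" unfolding R_def by blast
    with K WV show "r \<le> K" by fastforce
  qed
  have xR: "a x x / ip x x \<in> R" if "x \<in> W" "ip x x > 0" for x
    using normalize [OF that] unfolding R_def mem_Collect_eq by (intro exI conjI) (auto dest: sym)
  define M where "M = Sup R"
  have M: "a x x \<le> M * ip x x" if "x \<in> W" for x
  proof (cases "ip x x = 0")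
    case True
    with K WV [OF that] show ?thesis by force
  next
    case False
    then have p: "ip x x > 0" using wip.nonneg [OF that] by simp
    have "a x x / ip x x \<le> M" unfolding M_def by (rule cSup_upper [OF xR [OF that p] bdd])
    with p show ?thesis by (simp add: field_simps)
  qed
  have Mpos: "M > 0"
  proof -
    have "0 < M * ip x0 x0" using M [OF pos(1)] pos(2) by linarith
    then show ?thesis using pos0 by (simp add: zero_less_mult_iff)
  qed
  \<comment> \<open>\<open>b\<close> measures how far a vector is from attaining the supremum
    \<open>M\<close>. It is nonnegative on \<open>W\<close>, so Cauchy-Schwarz holds for it as
    well.\<close>
  define b where "b x y = M * ip x y - a x y" for x y
  interpret wb: psd_form W b
    by standard (use subW M in \<open>auto simp: b_def wip.add_left wa.add_left wip.scale_left wa.scale_left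
        wip.sym wa.sym algebra_simps\<close>)
  have "\<exists>x. x \<in> W \<and> ip x x = 1 \<and> b x x < 1 / real (Suc n)" for n
  proof -
    have "\<exists>r\<in>R. M - 1 / real (Suc n) < r"
      unfolding M_def using xR [OF pos(1) pos0] bdd by (intro less_cSupD) auto
    then show ?thesis unfolding R_def b_def by fastforce
  qed
  then obtain X where X: "\<And>n. X n \<in> W" "\<And>n. ip (X n) (X n) = 1" "\<And>n. b (X n) (X n) < 1 / real (Suc n)"
    by metis
  obtain m :: nat and f C where
    fadd: "\<forall>j<m. \<forall>x\<in>V. \<forall>y\<in>V. f j (x + y) = f j x + f j y"
    and fscale: "\<forall>j<m. \<forall>x\<in>V. \<forall>c. f j (c *\<^sub>R x) = c * f j x"
    and fbd: "\<forall>j<m. \<forall>x\<in>V. (f j x)\<^sup>2 \<le> C * ip x x"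
    and fa: "\<forall>x\<in>V. a x x \<le> M / 2 * ip x x + (\<Sum>j<m. (f j x)\<^sup>2)"
    using compact [of "M / 2"] Mpos by auto
  have fdiff: "f j (x - y) = f j x - f j y" if "j < m" "x \<in> V" "y \<in> V" for j x y
  proof -
    have "f j (x + (-1) *\<^sub>R y) = f j x + (-1) * f j y"
      using fadd fscale that V_closed by metis
    then show ?thesis by simp
  qed
  have "bounded (range (\<lambda>n. f j (X n)))" if "j < m" for j
  proof (rule boundedI)
    fix y assume "y \<in> range (\<lambda>n. f j (X n))"
    then obtain n where y: "y = f j (X n)" by auto
    have "y\<^sup>2 \<le> C" using fbd that WV X y by fastforce
    then have "sqrt (y\<^sup>2) \<le> sqrt C" by (rule real_sqrt_le_mono)
    then show "norm y \<le> sqrt C" by simp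
  qed
  then obtain r where r: "strict_mono r" "\<forall>j<m. convergent (\<lambda>n. f j (X (r n)))"
    using bounded_real_families_convergent_subseq [of m "\<lambda>n j. f j (X n)"] by blast
  define Y where "Y n = X (r n)" for n
  have Y: "Y n \<in> W" "ip (Y n) (Y n) = 1" "b (Y n) (Y n) < 1 / real (Suc n)" for n
  proof -
    have "1 / real (Suc (r n)) \<le> 1 / real (Suc n)"
      using strict_mono_imp_increasing [OF r(1), of n] by (intro divide_left_mono) auto
    with X show "Y n \<in> W" "ip (Y n) (Y n) = 1" "b (Y n) (Y n) < 1 / real (Suc n)"
      unfolding Y_def by (force intro: less_le_trans)+
  qed
  have key: "M / 2 * ip (Y i - Y j) (Y i - Y j)
      \<le> (\<Sum>l<m. (f l (Y i) - f l (Y j))\<^sup>2) + (2 / real (Suc i) + 2 / real (Suc j))" for i j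
  proof -
    define y where "y = Y i - Y j"
    have y: "y \<in> W" unfolding y_def using Y wip.V_closed by blast
    have "b y y \<le> 2 / real (Suc i) + 2 / real (Suc j)"
      unfolding y_def using wb.diff_le [OF Y(1) Y(1), of i j] Y(3) [of i] Y(3) [of j] by simp
    moreover have "a y y \<le> M / 2 * ip y y + (\<Sum>l<m. (f l (Y i) - f l (Y j))\<^sup>2)"
      using fa [rule_format, OF WV [OF y]]
      by (simp add: y_def fdiff [OF _ WV [OF Y(1)] WV [OF Y(1)]])
    ultimately show ?thesis unfolding b_def y_def by simp
  qed
  have "\<exists>x\<in>V. (\<lambda>n. ip (Y n - x) (Y n - x)) \<longlonglongrightarrow> 0"
  proof (rule complete)
    fix e :: real assume e: "e > 0"
    define e' where "e' = M / 2 * e"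
    have e': "e' > 0" using e Mpos by (simp add: e'_def)
    \<comment> \<open>With this bound the \<open>m\<close> squared differences contribute at most
      half of \<open>e'\<close>.\<close>
    define q where "q = sqrt (e' / (2 * (real m + 1)))"
    have q: "q > 0" using e' by (simp add: q_def)
    have "\<forall>l<m. \<exists>N. \<forall>i\<ge>N. \<forall>j\<ge>N. \<bar>f l (Y i) - f l (Y j)\<bar> < q"
    proof (intro allI impI)
      fix l assume "l < m"
      then have "Cauchy (\<lambda>n. f l (Y n))" using r(2) unfolding Y_def by (simp add: Cauchy_convergent_iff)
      then show "\<exists>N. \<forall>i\<ge>N. \<forall>j\<ge>N. \<bar>f l (Y i) - f l (Y j)\<bar> < q"
        using q unfolding Cauchy_def dist_real_def by blast
    qed
    then obtain N where N: "\<And>l i j. l < m \<Longrightarrow> i \<ge> N l \<Longrightarrow> j \<ge> N l \<Longrightarrow> \<bar>f l (Y i) - f l (Y j)\<bar> < q"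
      by metis
    \<comment> \<open>The sum is an upper bound for all \<open>N l\<close> at once; the ceiling
      makes \<open>2 / Suc i\<close> smaller than \<open>e' / 4\<close>.\<close>
    define N' where "N' = (\<Sum>l<m. N l) + nat \<lceil>8 / e'\<rceil>"
    show "\<exists>N. \<forall>m\<ge>N. \<forall>n\<ge>N. ip (Y m - Y n) (Y m - Y n) < e"
    proof (intro exI allI impI)
      fix i j assume ij: "i \<ge> N'" "j \<ge> N'"
      have s: "2 / real (Suc i) < e' / 4" if "i \<ge> N'" for i
      proof -
        have "8 / e' < real (Suc i)" using that unfolding N'_def by linarith
        then show ?thesis using e' by (simp add: field_simps)
      qed
      have "(\<Sum>l<m. (f l (Y i) - f l (Y j))\<^sup>2) \<le> (\<Sum>l<m. e' / (2 * (real m + 1)))"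
      proof (rule sum_mono)
        fix l assume l: "l \<in> {..<m}"
        then have "N l \<le> (\<Sum>l<m. N l)" by (intro member_le_sum) auto
        then have "\<bar>f l (Y i) - f l (Y j)\<bar> < q" using N l ij unfolding N'_def by auto
        then have "\<bar>f l (Y i) - f l (Y j)\<bar>\<^sup>2 \<le> q\<^sup>2" by (intro power_mono) auto
        then show "(f l (Y i) - f l (Y j))\<^sup>2 \<le> e' / (2 * (real m + 1))"
          using e' unfolding q_def by simp
      qed
      also have "\<dots> \<le> e' / 2" using e' by (simp add: field_simps)
      finally have "M / 2 * ip (Y i - Y j) (Y i - Y j) < M / 2 * e"
        using key [of i j] s [OF ij(1)] s [OF ij(2)] unfolding e'_def by linarith
      then show "ip (Y i - Y j) (Y i - Y j) < e" using Mpos by simp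
    qed
  qed (use Y WV in auto)
  then obtain x where x: "x \<in> V" "(\<lambda>n. ip (Y n - x) (Y n - x)) \<longlonglongrightarrow> 0" by blast
  have lim: "(\<lambda>n. ip (Y n) z) \<longlonglongrightarrow> ip x z" if z: "z \<in> V" for z
  proof -
    have "(\<lambda>n. sqrt (ip (Y n - x) (Y n - x) * ip z z)) \<longlonglongrightarrow> sqrt (0 * ip z z)"
      by (intro tendsto_intros x)
    then have sq: "(\<lambda>n. sqrt (ip (Y n - x) (Y n - x) * ip z z)) \<longlonglongrightarrow> 0" by simp
    have bd: "\<bar>ip (Y n) z - ip x z\<bar> \<le> sqrt (ip (Y n - x) (Y n - x) * ip z z)" for n
    proof -
      have "Y n \<in> V" using Y WV by blast
      then have "(ip (Y n) z - ip x z)\<^sup>2 \<le> ip (Y n - x) (Y n - x) * ip z z"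
        using ip.Cauchy_Schwarz [of "Y n - x" z] V_closed x z by (simp add: ip.diff_left)
      then show ?thesis by (metis real_sqrt_abs real_sqrt_le_iff)
    qed
    have "(\<lambda>n. ip (Y n) z - ip x z) \<longlonglongrightarrow> 0"
      by (rule Lim_null_comparison [OF _ sq]) (simp add: bd)
    then show ?thesis by (simp add: LIM_zero_iff)
  qed
  have "ip x (d j) = 0" if "j < n" for j
  proof -
    have "(\<lambda>n. ip (Y n) (d j)) \<longlonglongrightarrow> ip x (d j)" using lim d that by blast
    moreover have "ip (Y n) (d j) = 0" for n using Y(1) [of n] that by (simp add: W)
    ultimately show ?thesis by (simp add: LIMSEQ_const_iff)
  qed
  with x have xW: "x \<in> W" unfolding W by blast
  have near: "ip (Y n - x) (Y n - x) = 1 - 2 * ip (Y n) x + ip x x" for n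
    using wip.quadratic [OF Y(1) xW, of n "-1"] Y(2) by simp
  have "(\<lambda>n. 1 - 2 * ip (Y n) x + ip x x) \<longlonglongrightarrow> 1 - 2 * ip x x + ip x x"
    by (intro tendsto_intros lim x(1))
  then have "0 = 1 - 2 * ip x x + ip x x"
    using x(2) by (simp only: near LIMSEQ_unique)
  then have x1: "ip x x = 1" by simp
  have bx: "b x x = 0"
  proof -
    have "b x x \<le> 2 * (M * ip (Y n - x) (Y n - x)) + 2 * (1 / real (Suc n))" for n
    proof -
      have d: "x - Y n \<in> W" "Y n - x \<in> W" using xW Y wip.V_closed by auto
      have "b x x = b ((Y n) - (Y n - x)) ((Y n) - (Y n - x))" by simp
      also have "\<dots> \<le> 2 * b (Y n) (Y n) + 2 * b (Y n - x) (Y n - x)"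
        by (rule wb.diff_le [OF Y(1) d(2)])
      also have "b (Y n - x) (Y n - x) \<le> M * ip (Y n - x) (Y n - x)"
        unfolding b_def using wa.nonneg [OF d(2)] by simp
      finally show ?thesis using Y(3) [of n] by simp
    qed
    moreover have "(\<lambda>n. 2 * (M * ip (Y n - x) (Y n - x)) + 2 * (1 / real (Suc n))) \<longlonglongrightarrow> 2 * (M * 0) + 2 * 0"
      by (intro tendsto_intros x(2) LIMSEQ_Suc [OF lim_1_over_n])
    ultimately have "b x x \<le> 0" by (intro LIMSEQ_le_const) auto
    with wb.nonneg [OF xW] show ?thesis by simp
  qed
  have ax: "a x x = M" using bx x1 unfolding b_def by simp
  \<comment> \<open>A zero of the nonnegative form \<open>b\<close> lies in its kernel, and this is
    the eigenvalue equation on \<open>W\<close>.\<close>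
  have "b x y = 0" if "y \<in> W" for y
    using wb.Cauchy_Schwarz [OF xW that] bx by simp
  with ax have "\<forall>y\<in>W. a x y = a x x * ip x y" unfolding b_def by simp
  with xW x1 ax Mpos M show ?thesis by blast
qed

end

text \<open>Indices start at 0, so \<open>l n\<close> belongs to singular value number
  \<open>n + 1\<close>. \<open>l_max\<close> is the maximality under which \<open>e n\<close> is
  selected; \<open>eigen\<close> tests against all of \<open>V\<close>, not only against the
  complement of the earlier vectors.\<close>

locale eigen_form = compact_form V ip a
  for V ip a +
  fixes e and l :: "nat \<Rightarrow> real"
  assumes e_V: "e n \<in> V"
    and orthonormal: "ip (e i) (e j) = (if i = j then 1 else 0)"
    and l_pos: "l n > 0"
    and l_max: "y \<in> V \<Longrightarrow> (\<And>j. j < n \<Longrightarrow> ip y (e j) = 0) \<Longrightarrow> a y y \<le> l n * ip y y"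
    and eigen: "y \<in> V \<Longrightarrow> a (e n) y = l n * ip (e n) y"

context compact_form
begin

text \<open>Deflation: \<open>e n\<close> is a maximizer on the orthogonal complement of its
  predecessors. The choice depends on all earlier ones, hence the well-founded choice
  principle.\<close>

lemma eigen_form_exists: "\<exists>e l. eigen_form V ip a e l"
proof -
  define W where "W e n = {x \<in> V. \<forall>j<n. ip x (e j) = 0}" for e :: "nat \<Rightarrow> 'a" and n :: nat
  define P where "P e n r \<longleftrightarrow> r \<in> W e n \<and> ip r r = 1 \<and> a r r > 0 \<and> (\<forall>y\<in>W e n. a y y \<le> a r r * ip y y) \<and>
    (\<forall>y\<in>W e n. a r y = a r r * ip r y)" for e n r
  have "\<exists>e. \<forall>n. P e n (e n)"
  proof (rule dependent_wf_choice [of less_than])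
    show "wf less_than" by simp
    fix f g :: "nat \<Rightarrow> 'a" and n r assume "\<And>z. (z, n) \<in> less_than \<Longrightarrow> f z = g z"
    then have "W f n = W g n" by (auto simp: W_def)
    then show "P f n r = P g n r" by (simp add: P_def)
  next
    fix n and d :: "nat \<Rightarrow> 'a" assume "\<And>j. (j, n) \<in> less_than \<Longrightarrow> P d j (d j)"
    then have d: "d j \<in> V" if "j < n" for j using that by (auto simp: P_def W_def)
    obtain v where v: "\<forall>j<Suc n. v j \<in> V"
      "\<forall>c. (\<exists>j<Suc n. c j \<noteq> 0) \<longrightarrow> a (\<Sum>j<Suc n. c j *\<^sub>R v j) (\<Sum>j<Suc n. c j *\<^sub>R v j) > 0"
      using infinite_rank [of "Suc n"] by blast
    \<comment> \<open>Among \<open>n + 1\<close> vectors on whose span \<open>a\<close> is definite,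
      the \<open>n\<close> orthogonality conditions leave a nonzero combination, so the process
      never stops.\<close>
    obtain c where c: "\<exists>j\<in>{..<Suc n}. c j \<noteq> 0" "\<forall>i<n. (\<Sum>j<Suc n. ip (v j) (d i) * c j) = 0"
      using nontrivial_solution_of_linear_equations [of "{..<Suc n}" n "\<lambda>i j. ip (v j) (d i)"] by auto
    define x where "x = (\<Sum>j<Suc n. c j *\<^sub>R v j)"
    have xV: "x \<in> V" unfolding x_def using v by (intro ip.V_sum) auto
    have "ip x (d i) = 0" if "i < n" for i
    proof -
      have "ip x (d i) = (\<Sum>j<Suc n. c j * ip (v j) (d i))"
        unfolding x_def using v d that by (intro ip.sum_left) auto
      then show ?thesis using c that by (simp add: mult.commute)
    qed
    with xV have "x \<in> W d n" by (simp add: W_def)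
    moreover have "a x x > 0" unfolding x_def using v c by blast
    ultimately show "\<exists>r. P d n r"
      using maximizer [of "W d n" n d x] d unfolding P_def W_def by blast
  qed
  then obtain e where e: "\<And>n. P e n (e n)" by blast
  have eV: "e n \<in> V" for n using e [of n] unfolding P_def W_def by blast
  have orth: "ip (e i) (e j) = 0" if "j < i" for i j using e [of i] that unfolding P_def W_def by blast
  have unit: "ip (e i) (e i) = 1" for i using e [of i] unfolding P_def by blast
  have on: "ip (e i) (e j) = (if i = j then 1 else 0)" for i j
    using unit [of i] orth [of i j] orth [of j i] ip.sym [OF eV eV, of i j]
    by (cases i j rule: linorder_cases) auto
  \<comment> \<open>\<open>maximizer\<close> yields the eigenvalue equation only on
    \<open>W e n\<close>. It extends to \<open>V\<close> because the projection \<open>s\<close>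
    onto the earlier vectors is orthogonal to \<open>e n\<close> in both forms, by symmetry and the
    equations already known.\<close>
  have eig: "a (e n) y = a (e n) (e n) * ip (e n) y" if "y \<in> V" for n y
    using that
  proof (induction n arbitrary: y rule: less_induct)
    case (less n)
    define s where "s = (\<Sum>j<n. ip y (e j) *\<^sub>R e j)"
    have sV: "s \<in> V" unfolding s_def using eV by (intro ip.V_sum) auto
    have "ip s (e i) = ip y (e i)" if "i < n" for i
    proof -
      have "ip s (e i) = (\<Sum>j<n. ip y (e j) * ip (e j) (e i))"
        unfolding s_def using eV by (intro ip.sum_left) auto
      also have "\<dots> = (\<Sum>j<n. if j = i then ip y (e i) else 0)"
        by (intro sum.cong) (auto simp: on)
      finally show ?thesis using that by simp
    qed
    then have "y - s \<in> W e n" using less.prems sV eV V_closed by (simp add: W_def ip.diff_left)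
    then have "a (e n) (y - s) = a (e n) (e n) * ip (e n) (y - s)"
      using e [of n] unfolding P_def by blast
    moreover have "a (e n) s = 0"
    proof -
      have "a (e n) (e j) = 0" if "j < n" for j
        using less.IH [OF that eV, of n] a.sym [OF eV eV, of j n] that by (simp add: on)
      then show ?thesis unfolding s_def using eV by (subst a.sum_right) auto
    qed
    moreover have "ip (e n) s = 0"
      unfolding s_def using eV by (subst ip.sum_right) (auto simp: on)
    ultimately show ?case using less.prems sV eV by (simp add: a.diff_right ip.diff_right)
  qed
  have "eigen_form V ip a e (\<lambda>n. a (e n) (e n))"
  proof unfold_locales
    fix n
    show "e n \<in> V" by (rule eV)
    show "a (e n) (e n) > 0" using e [of n] unfolding P_def by blast
    show "a y y \<le> a (e n) (e n) * ip y y" if "y \<in> V" "\<And>j. j < n \<Longrightarrow> ip y (e j) = 0" for y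
      using e [of n] that unfolding P_def W_def by blast
    show "a (e n) y = a (e n) (e n) * ip (e n) y" if "y \<in> V" for y by (rule eig [OF that])
  qed (rule on)
  then show ?thesis by blast
qed

end

context eigen_form
begin

section \<open>Min-max bounds for the eigenvalues\<close>

lemma l_antimono: "i \<le> j \<Longrightarrow> l j \<le> l i"
proof (rule lift_Suc_antimono_le [of l])
  fix n
  have "a (e (Suc n)) (e (Suc n)) \<le> l n * ip (e (Suc n)) (e (Suc n))"
    by (rule l_max [OF e_V]) (simp add: orthonormal)
  then show "l (Suc n) \<le> l n" using eigen [OF e_V, of "Suc n" "Suc n"] by (simp add: orthonormal)
qed

lemma ip_sum_e: "finite J \<Longrightarrow> ip (\<Sum>j\<in>J. c j *\<^sub>R e j) (e i) = (if i \<in> J then c i else 0)"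
  using e_V by (subst ip.sum_left) (auto simp: orthonormal if_distrib cong: if_cong)

lemma ip_sum_e_self:
  assumes "finite J"
  shows "ip (\<Sum>j\<in>J. c j *\<^sub>R e j) (\<Sum>j\<in>J. c j *\<^sub>R e j) = (\<Sum>j\<in>J. (c j)\<^sup>2)"
proof -
  have "(\<Sum>j\<in>J. c j *\<^sub>R e j) \<in> V" using e_V by (intro ip.V_sum) auto
  then have "ip (\<Sum>j\<in>J. c j *\<^sub>R e j) (\<Sum>j\<in>J. c j *\<^sub>R e j) = (\<Sum>j\<in>J. c j * ip (\<Sum>j\<in>J. c j *\<^sub>R e j) (e j))"
    using e_V by (intro ip.sum_right) auto
  also have "\<dots> = (\<Sum>j\<in>J. (c j)\<^sup>2)"
    using assms by (intro sum.cong) (auto simp: ip_sum_e power2_eq_square)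
  finally show ?thesis .
qed

text \<open>Courant-Fischer: \<open>n + 1\<close> test vectors leave room for a combination
  orthogonal to \<open>e 0, ..., e (n - 1)\<close>, where \<open>l_max\<close> bounds the quotient
  of the forms from above.\<close>

lemma ge_of_test_subspace:
  assumes v: "\<And>j. j \<le> n \<Longrightarrow> v j \<in> V"
    and test: "\<And>c x. \<exists>j\<le>n. c j \<noteq> 0 \<Longrightarrow> x = (\<Sum>j\<le>n. c j *\<^sub>R v j) \<Longrightarrow> ip x x > 0 \<and> \<delta> * ip x x \<le> a x x"
  shows "\<delta> \<le> l n"
proof -
  obtain c where c: "\<exists>j\<in>{..n}. c j \<noteq> 0" "\<forall>i<n. (\<Sum>j\<le>n. ip (v j) (e i) * c j) = 0"
    using nontrivial_solution_of_linear_equations [of "{..n}" n "\<lambda>i j. ip (v j) (e i)"] by auto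
  define x where "x = (\<Sum>j\<le>n. c j *\<^sub>R v j)"
  have xV: "x \<in> V" unfolding x_def using v by (intro ip.V_sum) auto
  have "ip x (e i) = 0" if "i < n" for i
  proof -
    have "ip x (e i) = (\<Sum>j\<le>n. c j * ip (v j) (e i))"
      unfolding x_def using v e_V that by (intro ip.sum_left) auto
    then show ?thesis using c that by (simp add: mult.commute)
  qed
  then have "a x x \<le> l n * ip x x" by (rule l_max [OF xV])
  moreover have "ip x x > 0 \<and> \<delta> * ip x x \<le> a x x"
    using c(1) x_def by (intro test) auto
  ultimately have "ip x x > 0" "\<delta> * ip x x \<le> l n * ip x x" by linarith+
  then show ?thesis by simp
qed

text \<open>Dual count: some nonzero combination of \<open>e 0, ..., e n\<close> is annihilated by
  the \<open>n\<close> functionals, and on the span of these vectors the quotient of the forms is at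
  least \<open>l n\<close>.\<close>

lemma le_of_functionals:
  assumes add: "\<And>j x y. j < n \<Longrightarrow> x \<in> V \<Longrightarrow> y \<in> V \<Longrightarrow> f j (x + y) = f j x + f j y"
    and scale: "\<And>j x c. j < n \<Longrightarrow> x \<in> V \<Longrightarrow> f j (c *\<^sub>R x) = c * f j x"
    and test: "\<And>x. x \<in> V \<Longrightarrow> \<forall>j<n. f j x = 0 \<Longrightarrow> a x x \<le> \<delta> * ip x x"
  shows "l n \<le> \<delta>"
proof -
  obtain c where c: "\<exists>j\<in>{..n}. c j \<noteq> 0" "\<forall>i<n. (\<Sum>j\<le>n. f i (e j) * c j) = 0"
    using nontrivial_solution_of_linear_equations [of "{..n}" n "\<lambda>i j. f i (e j)"] by auto
  define x where "x = (\<Sum>j\<le>n. c j *\<^sub>R e j)"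
  have xV: "x \<in> V" unfolding x_def using e_V by (intro ip.V_sum) auto
  have fsum: "f i (\<Sum>j\<in>J. c j *\<^sub>R e j) = (\<Sum>j\<in>J. c j * f i (e j))" if "i < n" "finite J" for i J
    using that(2)
  proof (induction J rule: finite_induct)
    case empty
    then show ?case using scale [OF that(1) e_V, of 0 0] by simp
  next
    case (insert j J)
    have "(\<Sum>j\<in>J. c j *\<^sub>R e j) \<in> V" using e_V by (intro ip.V_sum) auto
    with insert show ?case using that e_V V_closed by (simp add: add scale)
  qed
  have f0: "\<forall>i<n. f i x = 0" unfolding x_def using fsum c by (simp add: mult.commute)
  have ipx: "ip x x = (\<Sum>j\<le>n. (c j)\<^sup>2)"
    unfolding x_def by (rule ip_sum_e_self) simp
  have ipe: "ip (e j) x = c j" if "j \<le> n" for j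
    using ip_sum_e [of "{..n}" c j] that xV e_V by (simp add: ip.sym [OF e_V] flip: x_def)
  have "a x x = (\<Sum>j\<le>n. c j * a (e j) x)"
    using a.sum_left [of "{..n}" e x c] e_V xV unfolding x_def by simp
  also have "\<dots> = (\<Sum>j\<le>n. l j * (c j)\<^sup>2)"
    by (intro sum.cong) (auto simp: eigen [OF xV] ipe power2_eq_square)
  also have "\<dots> \<ge> (\<Sum>j\<le>n. l n * (c j)\<^sup>2)"
    by (intro sum_mono mult_right_mono l_antimono) auto
  finally have "l n * ip x x \<le> a x x" by (simp add: ipx sum_distrib_left)
  also have "\<dots> \<le> \<delta> * ip x x" by (rule test [OF xV f0])
  finally have "l n * ip x x \<le> \<delta> * ip x x" .
  moreover have "ip x x > 0"
  proof -
    obtain j where "j \<le> n" "c j \<noteq> 0" using c by auto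
    then have "(c j)\<^sup>2 > 0" by simp
    also have "(c j)\<^sup>2 \<le> (\<Sum>j\<le>n. (c j)\<^sup>2)" using \<open>j \<le> n\<close> by (intro member_le_sum) auto
    finally show ?thesis by (simp add: ipx)
  qed
  ultimately show ?thesis by simp
qed

text \<open>The \<open>m\<close> functionals supplied by \<open>compact\<close> serve as the test in
  \<open>le_of_functionals\<close>.\<close>

lemma l_small: "\<epsilon> > 0 \<Longrightarrow> \<exists>n. l n \<le> \<epsilon>"
proof -
  assume "\<epsilon> > 0"
  then obtain m :: nat and f C where
    "\<forall>j<m. \<forall>x\<in>V. \<forall>y\<in>V. f j (x + y) = f j x + f j y"
    "\<forall>j<m. \<forall>x\<in>V. \<forall>c. f j (c *\<^sub>R x) = c * f j x"
    "\<forall>x\<in>V. a x x \<le> \<epsilon> * ip x x + (\<Sum>j<m. (f j x)\<^sup>2)"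
    using compact [of \<epsilon>] by metis
  then have "l m \<le> \<epsilon>" by (intro le_of_functionals [of m f]) auto
  then show ?thesis by blast
qed

lemma l_tendsto_0: "l \<longlonglongrightarrow> 0"
proof (rule LIMSEQ_I)
  fix r :: real assume "r > 0"
  then obtain n where n: "l n \<le> r / 2" using l_small [of "r / 2"] by auto
  have "norm (l m - 0) < r" if "m \<ge> n" for m
    using l_antimono [OF that] n \<open>r > 0\<close> l_pos [of m] by auto
  then show "\<exists>n. \<forall>m\<ge>n. norm (l m - 0) < r" by blast
qed

lemma finite_multiplicity: "r > 0 \<Longrightarrow> finite {n. l n = r}"
proof -
  assume r: "r > 0"
  then obtain n where n: "l n \<le> r / 2" using l_small [of "r / 2"] by auto
  have "{m. l m = r} \<subseteq> {..<n}"
  proof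
    fix m assume "m \<in> {m. l m = r}"
    then show "m \<in> {..<n}" using l_antimono [of n m] n r by (cases "m < n") auto
  qed
  then show ?thesis using finite_subset by blast
qed

end

section \<open>Singular values\<close>

context eigen_form
begin

lemma residual:
  assumes u: "u \<in> V" and J: "finite J" and r: "r = u - (\<Sum>j\<in>J. ip u (e j) *\<^sub>R e j)"
  shows "r \<in> V" "i \<in> J \<Longrightarrow> ip r (e i) = 0" "i \<notin> J \<Longrightarrow> ip r (e i) = ip u (e i)"
    "ip r r = ip u u - (\<Sum>j\<in>J. (ip u (e j))\<^sup>2)"
proof -
  define s where "s = (\<Sum>j\<in>J. ip u (e j) *\<^sub>R e j)"
  have sV: "s \<in> V" unfolding s_def using e_V by (intro ip.V_sum) auto
  have rs: "r = u - s" by (simp add: r s_def)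
  show rV: "r \<in> V" using u sV V_closed by (simp add: rs)
  show "i \<in> J \<Longrightarrow> ip r (e i) = 0" "i \<notin> J \<Longrightarrow> ip r (e i) = ip u (e i)"
    using ip_sum_e [OF J, of "\<lambda>j. ip u (e j)" i] u sV e_V by (auto simp: rs ip.diff_left simp flip: s_def)
  have "ip u s = (\<Sum>j\<in>J. ip u (e j) * ip u (e j))"
    unfolding s_def using e_V u by (intro ip.sum_right) auto
  moreover have "ip s s = (\<Sum>j\<in>J. (ip u (e j))\<^sup>2)"
    unfolding s_def by (rule ip_sum_e_self [OF J])
  ultimately show "ip r r = ip u u - (\<Sum>j\<in>J. (ip u (e j))\<^sup>2)"
    using ip.quadratic [OF u sV, of "-1"] by (simp add: rs power2_eq_square)
qed

lemma Bessel: "u \<in> V \<Longrightarrow> (\<Sum>j<n. (ip u (e j))\<^sup>2) \<le> ip u u"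
  using residual(4) [of u "{..<n}"] residual(1) [of u "{..<n}"] ip.nonneg
  by (metis diff_ge_0_iff_ge finite_lessThan)

text \<open>The representer is \<open>T* T u\<close>, built from its expansion in eigenvectors. An
  explicit one is called for because \<open>hilbert_adjoint\<close> is a definite
  description.\<close>

lemma Riesz:
  assumes u: "u \<in> V"
  shows "\<exists>z\<in>V. \<forall>x\<in>V. ip x z = a x u"
proof -
  define c where "c j = l j * ip u (e j)" for j
  define S where "S n = (\<Sum>j<n. c j *\<^sub>R e j)" for n
  have SV: "S n \<in> V" for n unfolding S_def using e_V by (intro ip.V_sum) auto
  have "summable (\<lambda>j. (ip u (e j))\<^sup>2)"
    by (rule summableI_nonneg_bounded [OF _ Bessel [OF u]]) simp
  then have "summable (\<lambda>j. (l 0)\<^sup>2 * (ip u (e j))\<^sup>2)" by (rule summable_mult)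
  then have sum: "summable (\<lambda>j. (c j)\<^sup>2)"
  proof (rule summable_comparison_test')
    fix n
    have "(l n)\<^sup>2 \<le> (l 0)\<^sup>2" using l_antimono [of 0 n] l_pos [of n] by (intro power_mono) auto
    then show "norm ((c n)\<^sup>2) \<le> (l 0)\<^sup>2 * (ip u (e n))\<^sup>2"
      by (simp add: c_def power_mult_distrib mult_right_mono)
  qed
  have diff: "ip (S m - S n) (S m - S n) = (\<Sum>j\<in>{n..<m}. (c j)\<^sup>2)" if "n \<le> m" for m n
  proof -
    have "S m = S n + (\<Sum>j\<in>{n..<m}. c j *\<^sub>R e j)"
      unfolding S_def using that by (metis lessThan_atLeast0 sum.atLeastLessThan_concat zero_le)
    then show ?thesis using ip_sum_e_self [of "{n..<m}" c] by simp
  qed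
  have sq: "ip (S m - S n) (S m - S n) = ip (S n - S m) (S n - S m)" for m n
    using SV V_closed by (simp add: ip.diff_left ip.diff_right)
  have "\<exists>z\<in>V. (\<lambda>n. ip (S n - z) (S n - z)) \<longlonglongrightarrow> 0"
  proof (rule complete [OF SV])
    fix \<epsilon> :: real assume "\<epsilon> > 0"
    with sum obtain N where N: "\<And>m n. m \<ge> N \<Longrightarrow> norm (\<Sum>j\<in>{m..<n}. (c j)\<^sup>2) < \<epsilon>"
      unfolding summable_Cauchy by blast
    show "\<exists>N. \<forall>m\<ge>N. \<forall>n\<ge>N. ip (S m - S n) (S m - S n) < \<epsilon>"
    proof (intro exI allI impI)
      fix m n assume mn: "m \<ge> N" "n \<ge> N"
      show "ip (S m - S n) (S m - S n) < \<epsilon>"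
      proof (cases "n \<le> m")
        case True
        then show ?thesis using N [OF mn(2), of m] by (simp add: diff)
      next
        case False
        then show ?thesis using N [OF mn(1), of n] by (simp add: diff sq [of m n])
      qed
    qed
  qed
  then obtain z where z: "z \<in> V" "(\<lambda>n. ip (S n - z) (S n - z)) \<longlonglongrightarrow> 0" by blast
  have "ip x z = a x u" if x: "x \<in> V" for x
  proof -
    \<comment> \<open>The \<open>e j\<close> may miss the kernel of \<open>a\<close>, so the
      remainder \<open>p n\<close> of \<open>u\<close> need not tend to 0 in \<open>ip\<close>; but
      its value under \<open>a\<close> is at most \<open>l n * ip u u\<close>, which does tend to
      0.\<close>
    define p where "p n = u - (\<Sum>j<n. ip u (e j) *\<^sub>R e j)" for n
    have pV: "p n \<in> V" and p0: "j < n \<Longrightarrow> ip (p n) (e j) = 0" and pu: "ip (p n) (p n) \<le> ip u u" for n j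
      using residual [OF u, of "{..<n}" "p n"] by (auto simp: p_def sum_nonneg)
    have axS: "ip x (S n) = a x u - a x (p n)" for n
    proof -
      have aV: "(\<Sum>j<n. ip u (e j) *\<^sub>R e j) \<in> V" using e_V by (intro ip.V_sum) auto
      have "a x u - a x (p n) = a x (\<Sum>j<n. ip u (e j) *\<^sub>R e j)"
        unfolding p_def using u x aV by (simp add: a.diff_right)
      also have "\<dots> = (\<Sum>j<n. ip u (e j) * a x (e j))"
        using e_V x by (intro a.sum_right) auto
      also have "\<dots> = (\<Sum>j<n. c j * ip x (e j))"
        using eigen [OF x] a.sym [OF e_V x] ip.sym [OF e_V x] by (simp add: c_def mult_ac)
      also have "\<dots> = ip x (S n)"
        unfolding S_def using e_V x by (intro ip.sum_right [symmetric]) auto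
      finally show ?thesis by simp
    qed
    have "(\<lambda>n. a x (p n)) \<longlonglongrightarrow> 0"
    proof (rule Lim_null_comparison)
      show "\<forall>\<^sub>F n in sequentially. norm (a x (p n)) \<le> sqrt (a x x * (l n * ip u u))"
      proof (rule always_eventually, rule allI)
        fix n
        have "a (p n) (p n) \<le> l n * ip (p n) (p n)" by (rule l_max [OF pV p0])
        also have "\<dots> \<le> l n * ip u u" using pu l_pos by (simp add: mult_left_mono less_imp_le)
        finally have "a x x * a (p n) (p n) \<le> a x x * (l n * ip u u)"
          using a.nonneg [OF x] by (rule mult_left_mono)
        then have "(a x (p n))\<^sup>2 \<le> a x x * (l n * ip u u)"
          using a.Cauchy_Schwarz [OF x pV, of n] by linarith
        then have "sqrt ((a x (p n))\<^sup>2) \<le> sqrt (a x x * (l n * ip u u))" by (rule real_sqrt_le_mono)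
        then show "norm (a x (p n)) \<le> sqrt (a x x * (l n * ip u u))" by simp
      qed
      have "(\<lambda>n. sqrt (a x x * (l n * ip u u))) \<longlonglongrightarrow> sqrt (a x x * (0 * ip u u))"
        by (intro tendsto_intros l_tendsto_0)
      then show "(\<lambda>n. sqrt (a x x * (l n * ip u u))) \<longlonglongrightarrow> 0" by simp
    qed
    then have "(\<lambda>n. a x u - a x (p n)) \<longlonglongrightarrow> a x u - 0" by (intro tendsto_intros)
    then have 1: "(\<lambda>n. ip x (S n)) \<longlonglongrightarrow> a x u" by (simp add: axS)
    have "(\<lambda>n. ip x (S n) - ip x z) \<longlonglongrightarrow> 0"
    proof (rule Lim_null_comparison)
      show "\<forall>\<^sub>F n in sequentially. norm (ip x (S n) - ip x z) \<le> sqrt (ip x x * ip (S n - z) (S n - z))"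
      proof (rule always_eventually, rule allI)
        fix n
        have "(ip x (S n) - ip x z)\<^sup>2 \<le> ip x x * ip (S n - z) (S n - z)"
          using ip.Cauchy_Schwarz [of x "S n - z"] V_closed(3) [OF SV z(1)] SV x z by (simp add: ip.diff_right)
        then have "sqrt ((ip x (S n) - ip x z)\<^sup>2) \<le> sqrt (ip x x * ip (S n - z) (S n - z))"
          by (rule real_sqrt_le_mono)
        then show "norm (ip x (S n) - ip x z) \<le> sqrt (ip x x * ip (S n - z) (S n - z))" by simp
      qed
      have "(\<lambda>n. sqrt (ip x x * ip (S n - z) (S n - z))) \<longlonglongrightarrow> sqrt (ip x x * 0)"
        by (intro tendsto_intros z(2))
      then show "(\<lambda>n. sqrt (ip x x * ip (S n - z) (S n - z))) \<longlonglongrightarrow> 0" by simp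
    qed
    then have "(\<lambda>n. ip x (S n)) \<longlonglongrightarrow> ip x z" by (simp add: LIM_zero_iff)
    with 1 show ?thesis using LIMSEQ_unique by blast
  qed
  with z show ?thesis by blast
qed

text \<open>What is left of an eigenvector after removing its components along the
  \<open>e n\<close> with \<open>l n = \<mu>\<close> is orthogonal to every \<open>e n\<close>. Its
  quotient is then at most every \<open>l n\<close>, and these tend to 0, so it vanishes because
  \<open>\<mu> > 0\<close>.\<close>

lemma eigenspace_eq_span:
  assumes "\<mu> > 0"
  shows "{u \<in> V. \<forall>x\<in>V. a x u = \<mu> * ip x u} = span (e ` {n. l n = \<mu>})" (is "?E = _")
proof
  have sub: "subspace ?E"
    unfolding subspace_def using V_closed
    by (auto simp: a.add_right ip.add_right a.scale_right ip.scale_right algebra_simps)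
      (metis V_closed(4) a.sym a.zero_left ip.sym ip.zero_left mult_zero_right)
  have "e ` {n. l n = \<mu>} \<subseteq> ?E"
    using e_V eigen by (auto simp: a.sym [OF _ e_V] ip.sym [OF _ e_V])
  then show "span (e ` {n. l n = \<mu>}) \<subseteq> ?E" by (rule span_minimal [OF _ sub])
  show "?E \<subseteq> span (e ` {n. l n = \<mu>})"
  proof
    fix u assume u: "u \<in> ?E"
    then have uV: "u \<in> V" by simp
    define J where "J = {n. l n = \<mu>}"
    have J: "finite J" unfolding J_def by (rule finite_multiplicity [OF assms])
    define s where "s = (\<Sum>j\<in>J. ip u (e j) *\<^sub>R e j)"
    define r where "r = u - s"
    note res = residual [OF uV J r_def [unfolded s_def]]
    have s: "s \<in> span (e ` J)" unfolding s_def by (intro span_sum span_scale span_base) auto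
    then have "s \<in> ?E" using \<open>e ` {n. l n = \<mu>} \<subseteq> ?E\<close> span_minimal [OF _ sub] unfolding J_def by blast
    then have rE: "r \<in> ?E" unfolding r_def using u by (intro subspace_diff [OF sub])
    have "ip r (e n) = 0" for n
    proof (cases "n \<in> J")
      case False
      \<comment> \<open>Eigenvectors for distinct eigenvalues are orthogonal.\<close>
      have "\<mu> * ip (e n) u = l n * ip (e n) u" using u e_V [of n] eigen [OF uV, of n] by simp
      with False have "ip (e n) u = 0" by (auto simp: J_def)
      with res False show ?thesis using ip.sym [OF uV e_V] by simp
    qed (use res in auto)
    then have "a r r \<le> l n * ip r r" for n using l_max [of r n] rE by simp
    moreover obtain n where "l n \<le> \<mu> / 2" using l_small [of "\<mu> / 2"] assms by auto
    ultimately have nn: "a r r \<le> l n * ip r r" "l n \<le> \<mu> / 2" by auto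
    have "\<mu> * ip r r \<le> \<mu> / 2 * ip r r"
    proof -
      have "\<mu> * ip r r = a r r" using rE by simp
      also have "\<dots> \<le> l n * ip r r" by (rule nn(1))
      also have "\<dots> \<le> \<mu> / 2 * ip r r" using nn(2) rE ip.nonneg [of r] by (intro mult_right_mono) auto
      finally show ?thesis .
    qed
    then have "ip r r \<le> 0" using assms by (simp add: field_simps)
    then have "ip r r = 0" using rE ip.nonneg [of r] by simp
    then have "r = 0" using definite rE by blast
    then show "u \<in> span (e ` {n. l n = \<mu>})" using s by (simp add: r_def J_def)
  qed
qed

lemma inj_e: "inj e"
  by (rule injI) (metis orthonormal zero_neq_one)

lemma independent_e: "independent (e ` J)"
  unfolding dependent_def
proof clarsimp
  fix n assume n: "n \<in> J" "e n \<in> span (e ` J - {e n})"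
  define W where "W = {y \<in> V. ip y (e n) = 0}"
  have "subspace W"
    unfolding W_def subspace_def using V_closed e_V [of n]
    by (auto simp: ip.add_left ip.scale_left ip.zero_left)
  moreover have "e ` J - {e n} \<subseteq> W" using e_V by (auto simp: W_def orthonormal)
  ultimately have "e n \<in> W" using n span_minimal by blast
  then show False by (simp add: W_def orthonormal)
qed

text \<open>\<open>Riesz\<close> gives a representer and definiteness of \<open>ip\<close> its
  uniqueness; together they resolve the description in \<open>hilbert_adjoint\<close>. The
  eigenspace is then a span of orthonormal vectors that can be counted.\<close>

lemma gram_eigenspace_dim:
  fixes T :: "_ \<Rightarrow> 'b::real_inner"
  assumes T: "\<And>x y. x \<in> V \<Longrightarrow> y \<in> V \<Longrightarrow> inner (T x) (T y) = a x y" and "\<mu> > 0"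
  shows "dim (gram_eigenspace V ip T \<mu>) = card {n. l n = \<mu>}"
proof -
  have adj: "hilbert_adjoint V ip T (T u) = z" if "u \<in> V" "z \<in> V" "\<forall>x\<in>V. ip x z = a x u" for u z
    unfolding hilbert_adjoint_def
  proof (rule the_equality)
    show "z \<in> V \<and> (\<forall>x\<in>V. ip x z = inner (T x) (T u))" using that T by simp
    fix w assume w: "w \<in> V \<and> (\<forall>x\<in>V. ip x w = inner (T x) (T u))"
    then have wz: "w - z \<in> V" using that(2) V_closed by blast
    have "ip (w - z) (w - z) = ip (w - z) w - ip (w - z) z"
      using w that(2) by (intro ip.diff_right wz) auto
    also have "\<dots> = inner (T (w - z)) (T u) - a (w - z) u" using w that(3) wz by simp
    also have "\<dots> = 0" using T [OF wz that(1)] by simp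
    finally have "w - z = 0" by (rule definite [OF wz])
    then show "w = z" by simp
  qed
  have "gram_eigenspace V ip T \<mu> = {u \<in> V. \<forall>x\<in>V. a x u = \<mu> * ip x u}"
  proof (intro set_eqI iffI)
    fix u assume "u \<in> gram_eigenspace V ip T \<mu>"
    then have u: "u \<in> V" "hilbert_adjoint V ip T (T u) = \<mu> *\<^sub>R u" by (auto simp: gram_eigenspace_def)
    obtain z where z: "z \<in> V" "\<forall>x\<in>V. ip x z = a x u" using Riesz [OF u(1)] by blast
    with adj u have "z = \<mu> *\<^sub>R u" by simp
    with z u show "u \<in> {u \<in> V. \<forall>x\<in>V. a x u = \<mu> * ip x u}" by (auto simp: ip.scale_right)
  next
    fix u assume u: "u \<in> {u \<in> V. \<forall>x\<in>V. a x u = \<mu> * ip x u}"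
    then have "hilbert_adjoint V ip T (T u) = \<mu> *\<^sub>R u"
      by (intro adj) (auto simp: ip.scale_right V_closed)
    with u show "u \<in> gram_eigenspace V ip T \<mu>" by (auto simp: gram_eigenspace_def)
  qed
  also have "\<dots> = span (e ` {n. l n = \<mu>})" by (rule eigenspace_eq_span [OF assms(2)])
  finally show ?thesis
    using dim_span_eq_card_independent [OF independent_e] card_image [OF inj_on_subset [OF inj_e]] by simp
qed

end

text \<open>Counting at the first disagreement: if \<open>s i\<close> were larger, the value
  \<open>r = s i\<close> would occur in \<open>s'\<close> only before \<open>i\<close>, hence less
  often than in \<open>s\<close>, while both counts are the dimension of the same
  eigenspace.\<close>

lemma singular_value_sequence_le:
  assumes s: "singular_value_sequence V ip T s" and s': "singular_value_sequence V ip T s'"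
    and i: "1 \<le> i" and eq: "\<And>j. 1 \<le> j \<Longrightarrow> j < i \<Longrightarrow> s j = s' j"
  shows "s i \<le> s' i"
proof (rule ccontr)
  assume less: "\<not> s i \<le> s' i"
  define r where "r = s i"
  have "s' i \<ge> 0" using s' i by (simp add: singular_value_sequence_def)
  then have r: "r > 0" "s' i < r" using less by (auto simp: r_def)
  have dec: "s' j \<le> s' i" if "j \<ge> i" for j
    using that
  proof (induction j rule: dec_induct)
    case (step n)
    then have "s' (Suc n) \<le> s' n" using s' i by (simp add: singular_value_sequence_def)
    with step show ?case by simp
  qed simp
  have "{j. 1 \<le> j \<and> s' j = r} \<subseteq> {j. 1 \<le> j \<and> s j = r} - {i}"
  proof
    fix j assume j: "j \<in> {j. 1 \<le> j \<and> s' j = r}"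
    then have "j < i" using dec [of j] r by (cases "j < i") auto
    with j eq show "j \<in> {j. 1 \<le> j \<and> s j = r} - {i}" by auto
  qed
  then have "{j. 1 \<le> j \<and> s' j = r} \<subset> {j. 1 \<le> j \<and> s j = r}" using i r_def by auto
  moreover have "finite {j. 1 \<le> j \<and> s j = r}" using s r by (simp add: singular_value_sequence_def)
  ultimately have "card {j. 1 \<le> j \<and> s' j = r} < card {j. 1 \<le> j \<and> s j = r}" by (rule psubset_card_mono [rotated])
  with s s' r show False by (simp add: singular_value_sequence_def)
qed

lemma singular_value_sequence_unique:
  assumes "singular_value_sequence V ip T s" "singular_value_sequence V ip T s'" "1 \<le> i"
  shows "s i = s' i"
  using assms(3)
proof (induction i rule: less_induct)
  case (less i)
  then show ?case
    using singular_value_sequence_le [OF assms(1,2), of i] singular_value_sequence_le [OF assms(2,1), of i]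
    by force
qed

lemma (in eigen_form) singular_value_eq:
  fixes T :: "_ \<Rightarrow> 'b::real_inner"
  assumes T: "\<And>x y. x \<in> V \<Longrightarrow> y \<in> V \<Longrightarrow> inner (T x) (T y) = a x y"
  shows "singular_value V ip T (Suc n) = sqrt (l n)"
proof -
  \<comment> \<open>The list starts at 1 and \<open>l\<close> at 0; truncated subtraction just
    repeats \<open>s 1\<close> in the irrelevant entry \<open>s 0\<close>.\<close>
  define s where "s i = sqrt (l (i - 1))" for i
  have "singular_value_sequence V ip T s"
    unfolding singular_value_sequence_def
  proof (intro conjI allI impI)
    fix i :: nat assume "i \<ge> 1"
    show "0 \<le> s i" using l_pos [of "i - 1"] by (simp add: s_def)
    show "s (Suc i) \<le> s i" using l_antimono [of "i - 1" i] by (simp add: s_def)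
  next
    fix r :: real assume r: "r > 0"
    have "s (Suc n) = r \<longleftrightarrow> l n = r\<^sup>2" for n
      using r l_pos [of n] by (auto simp: s_def)
    then have *: "{i. 1 \<le> i \<and> s i = r} = Suc ` {n. l n = r\<^sup>2}"
      by (auto simp: image_iff) (metis Suc_le_D)
    show "finite {i. 1 \<le> i \<and> s i = r}" unfolding * using r by (intro finite_imageI finite_multiplicity) auto
    show "card {i. 1 \<le> i \<and> s i = r} = dim (gram_eigenspace V ip T (r\<^sup>2))"
      unfolding * using gram_eigenspace_dim [OF T, of "r\<^sup>2"] r by (simp add: card_image)
  qed
  moreover from this have "singular_value_sequence V ip T (SOME s. singular_value_sequence V ip T s)"
    by (rule someI [of "singular_value_sequence V ip T"])
  ultimately have "(SOME s. singular_value_sequence V ip T s) (Suc n) = s (Suc n)"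
    by (intro singular_value_sequence_unique) auto
  then show ?thesis by (simp add: singular_value_def s_def)
qed

section \<open>The space \<open>L\<^sup>2(0,1)\<close>\<close>

abbreviation L2_class :: "(real \<Rightarrow> real) \<Rightarrow> L2" where "L2_class \<equiv> abs_L2"

lemma L2_rel_refl [simp]: "L2_rel f f \<longleftrightarrow> square_integrable01 f"
  by (simp add: L2_rel_def)

lemma square_integrable01_rep [simp]: "square_integrable01 (rep_L2 u)"
  using Quotient3_rep_reflp [OF Quotient3_L2, of u] by simp

lemma L2_class_rep [simp]: "L2_class (rep_L2 u) = u"
  by (rule Quotient3_abs_rep [OF Quotient3_L2])

lemma L2_class_eq:
  assumes "square_integrable01 f" "square_integrable01 g" "AE t in lebesgue01. f t = g t"
  shows "L2_class f = L2_class g"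
  using Quotient3_rel [OF Quotient3_L2, of f g] assms by (simp add: L2_rel_def)

lemma L2_cases:
  obtains f where "square_integrable01 f" "u = L2_class f"
  using L2_class_rep [of u] square_integrable01_rep [of u] by metis

lemma inner_L2_class:
  "square_integrable01 f \<Longrightarrow> square_integrable01 g \<Longrightarrow>
    inner (L2_class f) (L2_class g) = (LINT t|lebesgue01. f t * g t)"
  by (simp add: inner_L2.abs_eq)

lemma norm_L2_class: "square_integrable01 f \<Longrightarrow> (norm (L2_class f))\<^sup>2 = (LINT t|lebesgue01. (f t)\<^sup>2)"
  by (simp add: power2_norm_eq_inner inner_L2_class) (simp add: power2_eq_square)

lemma add_L2_class:
  "square_integrable01 f \<Longrightarrow> square_integrable01 g \<Longrightarrow>
    L2_class f + L2_class g = L2_class (\<lambda>t. f t + g t)"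
  by (simp add: plus_L2.abs_eq)

lemma scale_L2_class: "square_integrable01 f \<Longrightarrow> c *\<^sub>R L2_class f = L2_class (\<lambda>t. c * f t)"
  by (simp add: scaleR_L2.abs_eq)

lemma square_integrable01_diff:
  "square_integrable01 f \<Longrightarrow> square_integrable01 g \<Longrightarrow> square_integrable01 (\<lambda>t. f t - g t)"
  using square_integrable01_add [of f "\<lambda>t. (-1) * g t"] square_integrable01_scale [of g "-1"] by simp

lemma diff_L2_class:
  assumes "square_integrable01 f" "square_integrable01 g"
  shows "L2_class f - L2_class g = L2_class (\<lambda>t. f t - g t)"
proof -
  have "L2_class f - L2_class g = L2_class f + (-1) *\<^sub>R L2_class g" by simp
  also have "\<dots> = L2_class (\<lambda>t. f t - g t)"
    unfolding scale_L2_class [OF assms(2)]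
    using assms square_integrable01_scale [of g "-1"] by (subst add_L2_class) auto
  finally show ?thesis .
qed

lemma square_integrable01_sum:
  assumes "\<And>i. i \<in> I \<Longrightarrow> square_integrable01 (f i)"
  shows "square_integrable01 (\<lambda>t. \<Sum>i\<in>I. c i * f i t)"
  using assms
  by (induction I rule: infinite_finite_induct)
    (auto intro!: square_integrable01_add square_integrable01_scale square_integrable01_zero)

lemma sum_L2_class:
  assumes "\<And>i. i \<in> I \<Longrightarrow> square_integrable01 (f i)"
  shows "(\<Sum>i\<in>I. c i *\<^sub>R L2_class (f i)) = L2_class (\<lambda>t. \<Sum>i\<in>I. c i * f i t)"
  using assms
proof (induction I rule: infinite_finite_induct)
  case (insert i I)
  then have "square_integrable01 (\<lambda>t. \<Sum>i\<in>I. c i * f i t)" by (intro square_integrable01_sum) auto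
  with insert show ?case by (simp add: scale_L2_class add_L2_class square_integrable01_scale)
qed (auto simp: zero_L2.abs_eq)

lemma space_lebesgue01 [simp]: "space lebesgue01 = {0<..<1}"
  by (simp add: space_restrict_space)

lemma finite_measure_lebesgue01: "finite_measure lebesgue01"
  by (rule finite_measure_lebesgue_on) simp

lemma measure_lebesgue01: "measure lebesgue01 {0<..<1} = 1"
  by (simp add: measure_restrict_space)

lemma continuous_measurable_lebesgue01:
  "continuous_on UNIV f \<Longrightarrow> f \<in> borel_measurable lebesgue01" for f :: "real \<Rightarrow> real"
  by (intro measurable_restrict_space1 measurable_completion) (simp add: borel_measurable_continuous_onI)

lemma borel_measurable_lebesgue01:
  "f \<in> borel_measurable borel \<Longrightarrow> f \<in> borel_measurable lebesgue01" for f :: "real \<Rightarrow> real"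
  by (intro measurable_restrict_space1 measurable_completion) simp

lemma integrable_bounded_lebesgue01:
  fixes f :: "real \<Rightarrow> real"
  assumes "f \<in> borel_measurable lebesgue01" "\<And>t. 0 < t \<Longrightarrow> t < 1 \<Longrightarrow> \<bar>f t\<bar> \<le> B"
  shows "integrable lebesgue01 f"
  by (rule finite_measure.integrable_const_bound [OF finite_measure_lebesgue01, where B = B])
    (use assms in \<open>auto intro!: AE_I2\<close>)

lemma square_integrable01_bounded:
  assumes "f \<in> borel_measurable lebesgue01" "\<And>t. 0 < t \<Longrightarrow> t < 1 \<Longrightarrow> \<bar>f t\<bar> \<le> B"
  shows "square_integrable01 f"
proof -
  have "integrable lebesgue01 (\<lambda>t. (f t)\<^sup>2)"
  proof (rule integrable_bounded_lebesgue01)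
    show "\<bar>(f t)\<^sup>2\<bar> \<le> B\<^sup>2" if "0 < t" "t < 1" for t
      using power_mono [OF assms(2) [OF that], of 2] by simp
  qed (use assms in simp)
  with assms show ?thesis by (simp add: square_integrable01_def)
qed

lemma square_integrable01_continuous:
  assumes "continuous_on UNIV f"
  shows "square_integrable01 f"
proof -
  have "compact (f ` {0..1})"
    by (rule compact_continuous_image [OF continuous_on_subset [OF assms]]) auto
  then obtain B where "\<forall>x\<in>f ` {0..1}. norm x \<le> B"
    using compact_imp_bounded bounded_iff by metis
  then show ?thesis
    by (intro square_integrable01_bounded [OF continuous_measurable_lebesgue01 [OF assms], of B]) auto
qed

lemma integral_lebesgue01_continuous:
  fixes f :: "real \<Rightarrow> real"
  assumes "continuous_on UNIV f"
  shows "(LINT t|lebesgue01. f t) = integral {0..1} f" "integrable lebesgue01 f"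
proof -
  show i: "integrable lebesgue01 f"
    using square_integrable01_mult [OF square_integrable01_continuous [OF assms] square_integrable01_power [of 0]]
    by simp
  show "(LINT t|lebesgue01. f t) = integral {0..1} f"
    using lebesgue_integral_eq_integral [OF i] by (simp add: integral_open_interval_real)
qed

lemma square_integrable01_integrable: "square_integrable01 f \<Longrightarrow> integrable lebesgue01 f"
  using square_integrable01_mult [of f, OF _ square_integrable01_power [of 0]] by simp

lemma square_integrable01_indicator:
  assumes "A \<in> sets borel"
  shows "square_integrable01 (indicator A)"
proof (rule square_integrable01_bounded [where B = 1])
  show "(indicator A :: real \<Rightarrow> real) \<in> borel_measurable lebesgue01"
    by (intro borel_measurable_lebesgue01 borel_measurable_indicator assms)
qed (simp add: indicator_def)

lemma integral_abs_le_norm: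
  assumes "square_integrable01 f"
  shows "(LINT t|lebesgue01. \<bar>f t\<bar>) \<le> norm (L2_class f)"
proof -
  have f: "square_integrable01 (\<lambda>t. \<bar>f t\<bar>)"
    using assms by (auto simp: square_integrable01_def)
  have one: "square_integrable01 (\<lambda>t. 1)" using square_integrable01_power [of 0] by simp
  have "(LINT t|lebesgue01. \<bar>f t\<bar>) = inner (L2_class (\<lambda>t. \<bar>f t\<bar>)) (L2_class (\<lambda>t. 1))"
    by (simp add: inner_L2_class f one)
  also have "\<dots> \<le> norm (L2_class (\<lambda>t. \<bar>f t\<bar>)) * norm (L2_class (\<lambda>t. 1))"
    by (rule norm_cauchy_schwarz)
  also have "norm (L2_class (\<lambda>t. 1)) = 1"
    by (simp add: norm_eq_sqrt_inner inner_L2_class one measure_lebesgue01)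
  also have "norm (L2_class (\<lambda>t. \<bar>f t\<bar>)) = norm (L2_class f)"
    using assms by (simp add: norm_eq_sqrt_inner inner_L2_class f)
  finally show ?thesis by simp
qed

text \<open>Riesz--Fischer: a rapidly converging subsequence converges pointwise almost everywhere, and Fatou's lemma
  identifies the pointwise limit as the limit in the norm.\<close>
lemma L2_Cauchy_convergent:
  fixes X :: "nat \<Rightarrow> L2"
  assumes X: "Cauchy X"
  shows "\<exists>x. X \<longlonglongrightarrow> x"
proof -
  have "\<exists>N. \<forall>m\<ge>N. \<forall>n\<ge>N. norm (X m - X n) < (1/2) ^ k" for k :: nat
    using X unfolding Cauchy_def dist_norm by (meson zero_less_divide_1_iff zero_less_numeral zero_less_power)
  then obtain N where N: "\<And>k m n. m \<ge> N k \<Longrightarrow> n \<ge> N k \<Longrightarrow> norm (X m - X n) < (1/2) ^ k" by metis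
  \<comment> \<open>The partial sum dominates every \<open>N j\<close> with
    \<open>j \<le> k\<close>, and \<open>+ k\<close> makes the subsequence strictly
    increasing.\<close>
  define r where "r k = (\<Sum>j\<le>k. N j) + k" for k
  have r: "r m \<ge> N n" if "m \<ge> n" for m n
  proof -
    have "N n \<le> (\<Sum>j\<le>m. N j)" using that by (intro member_le_sum) auto
    then show ?thesis by (simp add: r_def)
  qed
  define F where "F n = rep_L2 (X (r n))" for n
  have F: "square_integrable01 (F n)" "L2_class (F n) = X (r n)" for n by (auto simp: F_def)
  have Fm [measurable]: "F n \<in> borel_measurable lebesgue01" for n using F by (simp add: square_integrable01_def)
  have FF: "norm (L2_class (\<lambda>t. F m t - F n t)) \<le> (1/2) ^ n" if "m \<ge> n" for m n
    using N [of n "r m" "r n"] r [of n m] r [of n n] that F by (simp flip: diff_L2_class)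
  have D: "(\<integral>\<^sup>+t. ennreal \<bar>F (Suc n) t - F n t\<bar> \<partial>lebesgue01) \<le> ennreal ((1/2) ^ n)" for n
  proof -
    have s: "square_integrable01 (\<lambda>t. F (Suc n) t - F n t)" by (intro square_integrable01_diff F)
    have "(LINT t|lebesgue01. \<bar>F (Suc n) t - F n t\<bar>) \<le> (1/2) ^ n"
      using integral_abs_le_norm [OF s] FF [of n "Suc n"] by simp
    moreover have "integrable lebesgue01 (\<lambda>t. \<bar>F (Suc n) t - F n t\<bar>)"
      using square_integrable01_integrable [OF s] by simp
    ultimately show ?thesis by (simp add: nn_integral_eq_integral)
  qed
  have "(\<integral>\<^sup>+t. (\<Sum>n. ennreal \<bar>F (Suc n) t - F n t\<bar>) \<partial>lebesgue01) =
      (\<Sum>n. \<integral>\<^sup>+t. ennreal \<bar>F (Suc n) t - F n t\<bar> \<partial>lebesgue01)"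
    by (intro nn_integral_suminf) simp
  also have "\<dots> \<le> (\<Sum>n. ennreal ((1/2) ^ n))" by (intro suminf_le D) auto
  also have "\<dots> = ennreal 2"
    using suminf_geometric [of "1/2 :: real"] by (subst suminf_ennreal2) auto
  finally have "(\<integral>\<^sup>+t. (\<Sum>n. ennreal \<bar>F (Suc n) t - F n t\<bar>) \<partial>lebesgue01) \<noteq> \<infinity>"
    by (auto simp: top_unique)
  then have "AE t in lebesgue01. (\<Sum>n. ennreal \<bar>F (Suc n) t - F n t\<bar>) \<noteq> \<infinity>"
    by (intro nn_integral_PInf_AE) auto
  then have conv: "AE t in lebesgue01. (\<lambda>n. F n t) \<longlonglongrightarrow> lim (\<lambda>n. F n t)"
  proof (rule AE_mp, intro AE_I2 impI)
    fix t assume "(\<Sum>n. ennreal \<bar>F (Suc n) t - F n t\<bar>) \<noteq> \<infinity>"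
    then have "summable (\<lambda>n. \<bar>F (Suc n) t - F n t\<bar>)"
      by (intro summable_suminf_not_top) auto
    then have "summable (\<lambda>n. F (Suc n) t - F n t)" by (rule summable_rabs_cancel)
    then have "convergent (\<lambda>n. \<Sum>i<n. F (Suc i) t - F i t)" by (simp add: summable_iff_convergent)
    then have "convergent (\<lambda>n. (F n t - F 0 t) + F 0 t)"
      by (intro convergent_add convergent_const) (simp add: sum_lessThan_telescope [of "\<lambda>i. F i t"])
    then show "(\<lambda>n. F n t) \<longlonglongrightarrow> lim (\<lambda>n. F n t)" by (simp add: convergent_LIMSEQ_iff)
  qed
  define g where "g t = lim (\<lambda>n. F n t)" for t
  have gm [measurable]: "g \<in> borel_measurable lebesgue01"
    unfolding g_def by (rule borel_measurable_lim_metric) (rule Fm)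
  have fatou: "(\<integral>\<^sup>+t. ennreal ((g t - F n t)\<^sup>2) \<partial>lebesgue01) \<le> ennreal (((1/2) ^ n)\<^sup>2)" for n
  proof -
    have "(\<integral>\<^sup>+t. ennreal ((g t - F n t)\<^sup>2) \<partial>lebesgue01)
        = (\<integral>\<^sup>+t. liminf (\<lambda>m. ennreal ((F m t - F n t)\<^sup>2)) \<partial>lebesgue01)"
    proof (rule nn_integral_cong_AE, rule AE_mp [OF conv], intro AE_I2 impI)
      fix t assume "(\<lambda>n. F n t) \<longlonglongrightarrow> lim (\<lambda>n. F n t)"
      then have "(\<lambda>m. ennreal ((F m t - F n t)\<^sup>2)) \<longlonglongrightarrow> ennreal ((g t - F n t)\<^sup>2)"
        unfolding g_def by (intro tendsto_intros tendsto_ennrealI)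
      then show "ennreal ((g t - F n t)\<^sup>2) = liminf (\<lambda>m. ennreal ((F m t - F n t)\<^sup>2))"
        by (intro lim_imp_Liminf [symmetric]) auto
    qed
    also have "\<dots> \<le> liminf (\<lambda>m. \<integral>\<^sup>+t. ennreal ((F m t - F n t)\<^sup>2) \<partial>lebesgue01)"
      by (intro nn_integral_liminf) simp
    also have "\<dots> \<le> ennreal (((1/2) ^ n)\<^sup>2)"
    proof (intro Liminf_le eventually_sequentiallyI [of n])
      fix m assume "m \<ge> n"
      have s: "square_integrable01 (\<lambda>t. F m t - F n t)" by (intro square_integrable01_diff F)
      have "(LINT t|lebesgue01. (F m t - F n t)\<^sup>2) \<le> ((1/2) ^ n)\<^sup>2"
        using power_mono [OF FF [OF \<open>m \<ge> n\<close>], of 2] by (simp add: norm_L2_class [OF s])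
      then show "(\<integral>\<^sup>+t. ennreal ((F m t - F n t)\<^sup>2) \<partial>lebesgue01) \<le> ennreal (((1/2) ^ n)\<^sup>2)"
        using s by (subst nn_integral_eq_integral) (auto simp: square_integrable01_def ennreal_leI)
    qed simp
    finally show ?thesis .
  qed
  have sd: "square_integrable01 (\<lambda>t. g t - F n t)" for n
  proof -
    have "integrable lebesgue01 (\<lambda>t. (g t - F n t)\<^sup>2)"
      using fatou [of n] by (intro integrableI_bounded) (auto simp: less_top [symmetric] top_unique)
    then show ?thesis by (simp add: square_integrable01_def)
  qed
  have sg: "square_integrable01 g"
    using square_integrable01_add [OF sd [of 0] F(1) [of 0]] by simp
  have "norm (X (r n) - L2_class g) \<le> (1/2) ^ n" for n
  proof -
    have "ennreal (LINT t|lebesgue01. (g t - F n t)\<^sup>2) \<le> ennreal (((1/2) ^ n)\<^sup>2)"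
      using fatou [of n] sd [of n] by (subst nn_integral_eq_integral [symmetric]) (auto simp: square_integrable01_def)
    then have "(norm (L2_class g - X (r n)))\<^sup>2 \<le> ((1/2) ^ n)\<^sup>2"
      using F sg norm_L2_class [OF sd, of n] by (simp add: diff_L2_class flip: F(2))
    then show ?thesis by (simp add: norm_minus_commute power2_le_iff_abs_le)
  qed
  then have "\<forall>\<^sub>F n in sequentially. norm (X (r n) - L2_class g) \<le> (1/2) ^ n" by (intro always_eventually) blast
  moreover have "(\<lambda>n. (1/2::real) ^ n) \<longlonglongrightarrow> 0" by (intro LIMSEQ_power_zero) simp
  ultimately have "(\<lambda>n. X (r n) - L2_class g) \<longlonglongrightarrow> 0"
    by (rule Lim_null_comparison)
  then have "(X \<circ> r) \<longlonglongrightarrow> L2_class g" by (simp add: LIM_zero_iff o_def)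
  moreover have "strict_mono r" by (rule strict_monoI_Suc) (simp add: r_def)
  ultimately have "X \<longlonglongrightarrow> L2_class g" using Cauchy_converges_subseq [OF X] by blast
  then show ?thesis by blast
qed

section \<open>Test functions\<close>

text \<open>An existential chain of derivatives instead of iterated \<open>deriv\<close>: closure
  under sums, products and affine substitutions follows by plain induction, without a Leibniz
  formula.\<close>

primrec times_differentiable :: "nat \<Rightarrow> (real \<Rightarrow> real) \<Rightarrow> bool" where
  "times_differentiable 0 f = True"
| "times_differentiable (Suc n) f =
    (\<exists>f'. (\<forall>x. (f has_real_derivative f' x) (at x)) \<and> times_differentiable n f')"

lemma times_differentiable_Suc:
  "times_differentiable (Suc n) f \<Longrightarrow> times_differentiable n f"
proof (induction n arbitrary: f)
  case (Suc n)
  then obtain f' where "\<forall>x. (f has_real_derivative f' x) (at x)" "times_differentiable (Suc n) f'"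
    by (subst (asm) times_differentiable.simps) blast
  then show ?case unfolding times_differentiable.simps(2) [of n f] using Suc.IH by blast
qed simp

lemma times_differentiable_add:
  "times_differentiable n f \<Longrightarrow> times_differentiable n g \<Longrightarrow> times_differentiable n (\<lambda>x. f x + g x)"
proof (induction n arbitrary: f g)
  case (Suc n)
  then obtain f' g' where "\<forall>x. (f has_real_derivative f' x) (at x)" "times_differentiable n f'"
    "\<forall>x. (g has_real_derivative g' x) (at x)" "times_differentiable n g'" by auto
  with Suc.IH show ?case by (auto intro!: exI [of _ "\<lambda>x. f' x + g' x"] derivative_eq_intros)
qed simp

lemma times_differentiable_mult:
  "times_differentiable n f \<Longrightarrow> times_differentiable n g \<Longrightarrow> times_differentiable n (\<lambda>x. f x * g x)"
proof (induction n arbitrary: f g)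
  case (Suc n)
  then obtain f' g' where fg: "\<forall>x. (f has_real_derivative f' x) (at x)" "times_differentiable n f'"
    "\<forall>x. (g has_real_derivative g' x) (at x)" "times_differentiable n g'" by auto
  have "times_differentiable n (\<lambda>x. f' x * g x + f x * g' x)"
    using Suc fg times_differentiable_Suc by (intro times_differentiable_add Suc.IH) blast+
  moreover have "\<forall>x. ((\<lambda>x. f x * g x) has_real_derivative f' x * g x + f x * g' x) (at x)"
    using fg by (auto intro!: derivative_eq_intros)
  ultimately show ?case by auto
qed simp

lemma times_differentiable_const: "times_differentiable n (\<lambda>x. c)"
  by (induction n arbitrary: c) (auto intro!: exI [of _ "\<lambda>x. 0"])

lemma times_differentiable_affine:
  "times_differentiable n f \<Longrightarrow> times_differentiable n (\<lambda>x. f (p * x + q))"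
proof (induction n arbitrary: f)
  case (Suc n)
  then obtain f' where f: "\<forall>x. (f has_real_derivative f' x) (at x)" "times_differentiable n f'" by auto
  have "times_differentiable n (\<lambda>x. f' (p * x + q) * p)"
    using Suc.IH f by (intro times_differentiable_mult times_differentiable_const) auto
  moreover have "((\<lambda>x. f (p * x + q)) has_real_derivative f' (p * x + q) * p) (at x)" for x
    by (rule DERIV_chain2 [of f]) (use f in \<open>auto intro!: derivative_eq_intros\<close>)
  ultimately show ?case
    unfolding times_differentiable.simps by (intro exI [of _ "\<lambda>x. f' (p * x + q) * p"] conjI allI)
qed simp

lemma times_differentiable_iterated_deriv:
  assumes "\<And>n. times_differentiable n f"
  shows "(deriv ^^ n) f field_differentiable (at t)"
proof -
  have "times_differentiable (Suc m) ((deriv ^^ n) f)" for m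
  proof (induction n arbitrary: m)
    case (Suc n)
    then obtain f' where f: "\<forall>x. ((deriv ^^ n) f has_real_derivative f' x) (at x)" "times_differentiable (Suc m) f'"
      by (metis times_differentiable.simps(2))
    then have "deriv ((deriv ^^ n) f) = f'" by (auto intro: DERIV_imp_deriv)
    with f show ?case by simp
  qed (use assms in simp)
  from this [of 0] show ?thesis by (auto simp: field_differentiable_def)
qed

text \<open>The classical flat function \<open>exp (- (1 / x))\<close>, with a polynomial factor in
  \<open>1 / x\<close> so that the family is closed under differentiation.\<close>

definition exp_bump :: "real poly \<Rightarrow> real \<Rightarrow> real"
  where "exp_bump p x = (if x \<le> 0 then 0 else poly p (1 / x) * exp (- (1 / x)))"

lemma exp_bump_tendsto_0: "(exp_bump p \<longlongrightarrow> 0) (at_right 0)"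
proof -
  have "((\<lambda>y. poly p y * exp (- y)) \<longlongrightarrow> 0) at_top"
  proof -
    have "((\<lambda>y::real. \<Sum>i\<le>degree p. coeff p i * (y ^ i / exp y)) \<longlongrightarrow> (\<Sum>i\<le>degree p. coeff p i * 0)) at_top"
      by (intro tendsto_intros tendsto_power_div_exp_0)
    then show ?thesis
      by (simp add: poly_altdef sum_distrib_right sum_divide_distrib exp_minus divide_inverse mult.assoc)
  qed
  then have "((\<lambda>x. poly p (1 / x) * exp (- (1 / x))) \<longlongrightarrow> 0) (at_right 0)"
    using filterlim_compose [OF _ filterlim_inverse_at_top_right] by (fastforce simp: inverse_eq_divide)
  then show ?thesis
    by (rule Lim_transform_eventually) (auto simp: exp_bump_def eventually_at_filter)
qed

text \<open>With \<open>y = 1 / x\<close>, whose derivative is \<open>- y\<^sup>2\<close>, the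
  product rule turns the factor \<open>p\<close> into \<open>y\<^sup>2 * (p - p')\<close>.\<close>

lemma exp_bump_has_derivative:
  "(exp_bump p has_real_derivative exp_bump ([:0, 0, 1:] * (p - pderiv p)) x) (at x)"
proof (cases x "0::real" rule: linorder_cases)
  case less
  have "((\<lambda>x. 0) has_real_derivative 0) (at x)" by simp
  then have "(exp_bump p has_real_derivative 0) (at x)"
    by (rule DERIV_cong_ev [THEN iffD1, rotated -1, OF _ refl _ refl])
      (use less in \<open>auto simp: exp_bump_def eventually_nhds intro!: exI [of _ "{..<0}"]\<close>)
  then show ?thesis using less by (simp add: exp_bump_def)
next
  case greater
  have "((\<lambda>x. poly p (1 / x) * exp (- (1 / x))) has_real_derivative
      (poly (pderiv p) (1 / x) * (- 1 / x\<^sup>2)) * exp (- (1 / x)) + poly p (1 / x) * (exp (- (1 / x)) * (1 / x\<^sup>2))) (at x)"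
    using greater
    by (auto intro!: derivative_eq_intros DERIV_chain2 [OF poly_DERIV] simp: power2_eq_square field_simps)
  then have "((\<lambda>x. poly p (1 / x) * exp (- (1 / x))) has_real_derivative
      exp_bump ([:0, 0, 1:] * (p - pderiv p)) x) (at x)"
    using greater by (simp add: exp_bump_def power2_eq_square field_simps)
  then show ?thesis
    by (rule DERIV_cong_ev [THEN iffD1, rotated -1, OF _ refl _ refl])
      (use greater in \<open>auto simp: exp_bump_def eventually_nhds intro!: exI [of _ "{0<..}"]\<close>)
next
  case equal
  have left: "((\<lambda>h. (exp_bump p (0 + h) - exp_bump p 0) / h) \<longlongrightarrow> 0) (at_left 0)"
    by (rule Lim_transform_eventually [OF tendsto_const])
      (auto simp: exp_bump_def eventually_at_filter)
  \<comment> \<open>Division by \<open>h\<close> multiplies the polynomial factor by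
    \<open>1 / h\<close>, so the right difference quotient at 0 is again a member of the
    family.\<close>
  have "((\<lambda>h. exp_bump ([:0, 1:] * p) h) \<longlongrightarrow> 0) (at_right 0)" by (rule exp_bump_tendsto_0)
  then have "((\<lambda>h. (exp_bump p (0 + h) - exp_bump p 0) / h) \<longlongrightarrow> 0) (at_right 0)"
    by (rule Lim_transform_eventually)
      (auto simp: exp_bump_def eventually_at_filter)
  with left show ?thesis
    unfolding DERIV_def equal by (simp add: exp_bump_def filterlim_split_at)
qed

lemma times_differentiable_exp_bump: "times_differentiable n (exp_bump p)"
  by (induction n arbitrary: p) (auto intro: exp_bump_has_derivative)

text \<open>The arguments are \<open>n * (x - c)\<close> and \<open>n * (d - x)\<close>, in the
  affine shape that \<open>times_differentiable_affine\<close> expects. As \<open>n\<close> grows,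
  the bumps tend to the indicator of \<open>{c<..<d}\<close>.\<close>

definition interval_bump :: "real \<Rightarrow> real \<Rightarrow> nat \<Rightarrow> real \<Rightarrow> real"
  where "interval_bump c d n x = exp_bump 1 (real n * x + (- real n * c)) * exp_bump 1 (- real n * x + real n * d)"

lemma test_function01_interval_bump:
  assumes "0 < c" "d < 1"
  shows "test_function01 (interval_bump c d n)"
  unfolding test_function01_def
proof (intro conjI allI)
  show "(deriv ^^ m) (interval_bump c d n) field_differentiable at t" for m t
    unfolding interval_bump_def
    by (intro times_differentiable_iterated_deriv times_differentiable_mult
        times_differentiable_affine times_differentiable_exp_bump)
  have "interval_bump c d n t = 0" if "t \<notin> {c..d}" for t
  proof -
    have "t < c \<or> d < t" using that by auto
    then have "real n * (t - c) \<le> 0 \<or> real n * (d - t) \<le> 0"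
      by (auto simp: mult_le_0_iff)
    then show ?thesis by (auto simp: interval_bump_def exp_bump_def algebra_simps)
  qed
  with assms show "\<exists>a b. 0 < a \<and> b < 1 \<and> (\<forall>t. t \<notin> {a..b} \<longrightarrow> interval_bump c d n t = 0)" by blast
qed

lemma exp_bump_one_bounds: "0 \<le> exp_bump 1 x" "exp_bump 1 x \<le> 1"
  by (auto simp: exp_bump_def)

lemma interval_bump_bounds: "0 \<le> interval_bump c d n x" "interval_bump c d n x \<le> 1"
  unfolding interval_bump_def using exp_bump_one_bounds by (auto intro: mult_le_one)

lemma exp_bump_one_limit: "(\<lambda>n. exp_bump 1 (real n * y)) \<longlonglongrightarrow> (if y > 0 then 1 else 0)"
proof (cases "y > 0")
  case True
  have "(\<lambda>n. exp (- (1 / y * (1 / real n)))) \<longlonglongrightarrow> exp (- (1 / y * 0))"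
    by (intro tendsto_intros lim_1_over_n)
  then have "(\<lambda>n. exp (- (1 / y * (1 / real n)))) \<longlonglongrightarrow> 1" by simp
  moreover have "\<forall>\<^sub>F n in sequentially. exp (- (1 / y * (1 / real n))) = exp_bump 1 (real n * y)"
    using eventually_gt_at_top [of 0] by eventually_elim (use True in \<open>simp add: exp_bump_def not_le\<close>)
  ultimately show ?thesis using True by (simp add: Lim_transform_eventually)
next
  case False
  then have "exp_bump 1 (real n * y) = 0" for n by (simp add: exp_bump_def mult_nonneg_nonpos)
  with False show ?thesis by simp
qed

lemma interval_bump_limit: "(\<lambda>n. interval_bump c d n x) \<longlonglongrightarrow> indicator {c<..<d} x"
proof -
  have "(\<lambda>n. exp_bump 1 (real n * (x - c)) * exp_bump 1 (real n * (d - x)))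
      \<longlonglongrightarrow> (if x - c > 0 then 1 else 0) * (if d - x > 0 then 1 else 0)"
    by (intro tendsto_mult exp_bump_one_limit)
  then show ?thesis
    unfolding interval_bump_def indicator_def
    by (cases "c < x"; cases "x < d") (auto simp: algebra_simps)
qed

lemma test_function01_continuous:
  assumes "test_function01 \<phi>"
  shows "continuous_on UNIV ((deriv ^^ n) \<phi>)"
  using assms
  by (auto simp: test_function01_def continuous_on_eq_continuous_at
      intro: field_differentiable_imp_continuous_at)

lemma test_function01_square_integrable:
  "test_function01 \<phi> \<Longrightarrow> square_integrable01 ((deriv ^^ n) \<phi>)"
  by (intro square_integrable01_continuous test_function01_continuous)

lemma test_function01_square_integrable_0: "test_function01 \<phi> \<Longrightarrow> square_integrable01 \<phi>"
  using test_function01_square_integrable [of \<phi> 0] by simp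

lemma test_function01_has_derivative:
  "test_function01 \<phi> \<Longrightarrow> ((deriv ^^ n) \<phi> has_real_derivative (deriv ^^ Suc n) \<phi> t) (at t)"
  unfolding test_function01_def using DERIV_deriv_iff_field_differentiable by auto

lemma test_function01_deriv:
  assumes "test_function01 \<phi>"
  shows "test_function01 ((deriv ^^ j) \<phi>)"
  unfolding test_function01_def
proof (intro conjI allI)
  show "(deriv ^^ n) ((deriv ^^ j) \<phi>) field_differentiable at t" for n t
  proof -
    have "(deriv ^^ n) ((deriv ^^ j) \<phi>) = (deriv ^^ (n + j)) \<phi>" by (simp add: funpow_add)
    then show ?thesis using assms by (simp add: test_function01_def)
  qed
  obtain a b where ab: "0 < a" "b < 1" "\<forall>t. t \<notin> {a..b} \<longrightarrow> \<phi> t = 0"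
    using assms by (auto simp: test_function01_def)
  have "(deriv ^^ j) \<phi> t = 0" if "t \<notin> {a..b}" for t
    using that
  proof (induction j arbitrary: t)
    case (Suc j)
    have "open (- {a..b})" by auto
    have "((\<lambda>_. 0) has_real_derivative 0) (at t)" by simp
    from has_field_derivative_transform_within_open [OF this \<open>open (- {a..b})\<close>, of "(deriv ^^ j) \<phi>"]
    have "((deriv ^^ j) \<phi> has_real_derivative 0) (at t)"
      using Suc.prems Suc.IH by simp
    then show ?case by (simp add: DERIV_imp_deriv)
  qed (use ab in auto)
  with ab show "\<exists>a b. 0 < a \<and> b < 1 \<and> (\<forall>t. t \<notin> {a..b} \<longrightarrow> (deriv ^^ j) \<phi> t = 0)" by blast
qed

text \<open>Vanishing mean is what makes the antiderivative that starts at 0 vanish again to the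
  right of the support.\<close>

lemma test_function01_antiderivative:
  assumes \<theta>: "test_function01 \<theta>" and int: "(LINT t|lebesgue01. \<theta> t) = 0"
  shows "\<exists>\<phi>. test_function01 \<phi> \<and> deriv \<phi> = \<theta>"
proof -
  have cont: "continuous_on UNIV \<theta>" using test_function01_continuous [OF \<theta>, of 0] by simp
  then obtain F where F: "\<And>x. (F has_real_derivative \<theta> x) (at x)"
    using einterval_antiderivative [of "-\<infinity>" "\<infinity>" \<theta>]
    by (auto simp: continuous_on_eq_continuous_at has_real_derivative_iff_has_vector_derivative)
  define \<phi> where "\<phi> x = F x - F 0" for x
  have D: "(\<phi> has_real_derivative \<theta> x) (at x)" for x
    unfolding \<phi>_def using F by (auto intro!: derivative_eq_intros)
  have d: "deriv \<phi> = \<theta>" using D by (auto intro: DERIV_imp_deriv)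
  obtain a b where ab: "0 < a" "b < 1" "\<forall>t. t \<notin> {a..b} \<longrightarrow> \<theta> t = 0"
    using \<theta> by (auto simp: test_function01_def)
  have "(deriv ^^ n) \<phi> field_differentiable (at t)" for n t
  proof (cases n)
    case 0
    then show ?thesis using D by (auto simp: field_differentiable_def)
  next
    case (Suc m)
    then show ?thesis using \<theta> d by (simp add: funpow_Suc_right test_function01_def del: funpow.simps)
  qed
  moreover have "\<phi> t = 0" if "t \<notin> {min a (1/2)..max b (1/2)}" for t
  proof (cases "t < a")
    case True
    have "\<phi> t = \<phi> 0"
    proof (rule has_field_derivative_zero_constant [of "{..<a}" \<phi>, THEN exE])
      show "(\<phi> has_real_derivative 0) (at x within {..<a})" if "x \<in> {..<a}" for x
        using D [of x] ab that by (auto intro: has_field_derivative_at_within)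
    qed (use True ab in auto)
    then show ?thesis by (simp add: \<phi>_def)
  next
    case False
    then have t: "b < t" using that by auto
    have "\<phi> t = \<phi> 1"
    proof (rule has_field_derivative_zero_constant [of "{b<..}" \<phi>, THEN exE])
      show "(\<phi> has_real_derivative 0) (at x within {b<..})" if "x \<in> {b<..}" for x
        using D [of x] ab that by (auto intro: has_field_derivative_at_within)
    qed (use t ab in auto)
    moreover have "(\<theta> has_integral (\<phi> 1 - \<phi> 0)) {0..1}"
      using D by (intro fundamental_theorem_of_calculus)
        (auto simp: has_real_derivative_iff_has_vector_derivative [symmetric] intro: has_field_derivative_at_within)
    then have "\<phi> 1 - \<phi> 0 = 0"
      using int integral_lebesgue01_continuous(1) [OF cont] by (simp add: integral_unique)
    ultimately show ?thesis by (simp add: \<phi>_def)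
  qed
  ultimately have "test_function01 \<phi>"
    unfolding test_function01_def using ab
    by (intro conjI allI exI [of _ "min a (1/2)"] exI [of _ "max b (1/2)"]) auto
  with d show ?thesis by blast
qed

section \<open>Weak derivatives and the Poincare inequality\<close>

lemma AE_lebesgue01_negligible:
  assumes "negligible N" "\<And>t. 0 < t \<Longrightarrow> t < 1 \<Longrightarrow> t \<notin> N \<Longrightarrow> P t"
  shows "AE t in lebesgue01. P t"
proof -
  have "N \<in> null_sets lebesgue" using assms(1) by (simp add: negligible_iff_null_sets)
  then have "AE t in lebesgue. t \<notin> N" by (rule AE_not_in)
  then show ?thesis
    by (subst AE_restrict_space_iff) (use assms(2) in \<open>auto elim: eventually_mono\<close>)
qed

lemma integral_lebesgue01_indicator_mult:
  fixes f :: "real \<Rightarrow> real"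
  assumes "integrable lebesgue01 f" "0 \<le> c" "d \<le> 1"
  shows "f integrable_on {c<..<d}" "(LINT t|lebesgue01. f t * indicator {c<..<d} t) = integral {c<..<d} f"
proof -
  have i: "integrable lebesgue01 (\<lambda>t. f t * indicator {c<..<d} t)"
    using assms by (intro integrable_real_mult_indicator) (auto simp: sets_restrict_space_iff)
  have *: "(if t \<in> {0<..<1} then f t * indicator {c<..<d} t else 0) = (if t \<in> {c<..<d} then f t else 0)" for t
    using assms by (auto simp: indicator_def)
  have "((\<lambda>t. f t * indicator {c<..<d} t) has_integral
      (LINT t|lebesgue01. f t * indicator {c<..<d} t)) {0<..<1}"
    using has_integral_integral_lebesgue_on [OF i] by simp
  then have "(f has_integral (LINT t|lebesgue01. f t * indicator {c<..<d} t)) {c<..<d}"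
    by (subst (asm) has_integral_restrict_UNIV [symmetric], unfold *) (subst (asm) has_integral_restrict_UNIV)
  then show "f integrable_on {c<..<d}" "(LINT t|lebesgue01. f t * indicator {c<..<d} t) = integral {c<..<d} f"
    by (auto simp: integral_unique)
qed

text \<open>At almost every point a representative of \<open>u\<close> is the limit of its averages over shrinking intervals, which vanish.\<close>
lemma L2_eq_0_intervals:
  assumes "\<And>c d. 0 < c \<Longrightarrow> c < d \<Longrightarrow> d < 1 \<Longrightarrow> inner u (L2_class (indicator {c<..<d})) = 0"
  shows "u = 0"
proof -
  obtain f where f: "square_integrable01 f" "u = L2_class f" by (rule L2_cases)
  note fi = square_integrable01_integrable [OF f(1)]
  \<comment> \<open>Extension by zero, because the differentiation theorem is applied on the whole
    line.\<close>
  define g where "g t = (if t \<in> {0<..<1} then f t else 0)" for t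
  have "f integrable_on {0<..<1}" using integral_lebesgue01_indicator_mult(1) [OF fi, of 0 1] by simp
  then have gU: "g integrable_on UNIV" unfolding g_def by (simp only: integrable_restrict_UNIV)
  then have "g integrable_on cbox a b" for a b by (rule integrable_on_subcbox) auto
  then obtain N where N: "negligible N" "\<And>x e. x \<notin> N \<Longrightarrow> 0 < e \<Longrightarrow>
      \<exists>d>0. \<forall>h. 0 < h \<and> h < d \<longrightarrow> norm (integral (cbox x (x + h *\<^sub>R One)) g /\<^sub>R h ^ DIM(real) - g x) < e"
    by (rule integrable_ccontinuous_explicit [of g]) blast
  have int0: "integral (cbox x (x + h)) g = 0" if "0 < x" "0 < h" "x + h < 1" for x h
  proof -
    have "integral (cbox x (x + h)) g = integral {x<..<x + h} g" by (simp add: integral_open_interval_real)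
    also have "\<dots> = integral {x<..<x + h} f" by (rule integral_cong) (use that in \<open>auto simp: g_def\<close>)
    also have "\<dots> = inner u (L2_class (indicator {x<..<x + h}))"
      using that f by (simp add: integral_lebesgue01_indicator_mult(2) [OF fi] inner_L2_class square_integrable01_indicator)
    also have "\<dots> = 0" using that by (intro assms) auto
    finally show ?thesis .
  qed
  have "AE t in lebesgue01. f t = 0"
  proof (rule AE_lebesgue01_negligible [OF N(1)])
    fix t assume t: "0 < t" "t < 1" "t \<notin> N"
    have "\<bar>f t\<bar> < e" if "e > 0" for e
    proof -
      obtain d where d: "d > 0" "\<forall>h. 0 < h \<and> h < d \<longrightarrow> norm (integral (cbox t (t + h *\<^sub>R One)) g /\<^sub>R h ^ DIM(real) - g t) < e"
        using N(2) [OF t(3) \<open>e > 0\<close>] by blast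
      define h where "h = min d (1 - t) / 2"
      have h: "0 < h" "h < d" "t + h < 1" using d t by (auto simp: h_def min_def field_simps)
      show ?thesis using d(2) [rule_format, of h] int0 [OF t(1) h(1) h(3)] h t by (simp add: g_def)
    qed
    then show "f t = 0" by (metis abs_of_pos dual_order.irrefl zero_less_abs_iff)
  qed
  then show ?thesis
    unfolding f(2) zero_L2.abs_eq by (intro L2_class_eq f square_integrable01_zero)
qed

text \<open>Fundamental lemma of the calculus of variations: smooth bumps tend to the indicator of
  an interval pointwise and boundedly, so dominated convergence reduces the claim to
  intervals.\<close>

lemma L2_eq_0_test_functions:
  assumes "\<And>\<phi>. test_function01 \<phi> \<Longrightarrow> inner u (L2_class \<phi>) = 0"
  shows "u = 0"
proof (rule L2_eq_0_intervals)
  fix c d :: real assume cd: "0 < c" "c < d" "d < 1"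
  obtain f where f: "square_integrable01 f" "u = L2_class f" by (rule L2_cases)
  have fm [measurable]: "f \<in> borel_measurable lebesgue01" using f by (simp add: square_integrable01_def)
  have b: "square_integrable01 (interval_bump c d n)" for n
    by (intro test_function01_square_integrable_0 test_function01_interval_bump cd)
  then have bm [measurable]: "interval_bump c d n \<in> borel_measurable lebesgue01" for n
    by (simp add: square_integrable01_def)
  have im [measurable]: "(indicator {c<..<d} :: real \<Rightarrow> real) \<in> borel_measurable lebesgue01"
    by (intro borel_measurable_lebesgue01 borel_measurable_indicator) simp
  have "(\<lambda>n. LINT t|lebesgue01. f t * interval_bump c d n t) \<longlonglongrightarrow> (LINT t|lebesgue01. f t * indicator {c<..<d} t)"
  proof (rule integral_dominated_convergence [where w = "\<lambda>t. \<bar>f t\<bar>"])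
    show "integrable lebesgue01 (\<lambda>t. \<bar>f t\<bar>)" using square_integrable01_integrable [OF f(1)] by simp
    show "AE t in lebesgue01. (\<lambda>n. f t * interval_bump c d n t) \<longlonglongrightarrow> f t * indicator {c<..<d} t"
      by (intro AE_I2 tendsto_mult tendsto_const interval_bump_limit)
    show "AE t in lebesgue01. norm (f t * interval_bump c d n t) \<le> \<bar>f t\<bar>" for n
      using interval_bump_bounds by (intro AE_I2) (simp add: abs_mult mult_left_le)
  qed measurable
  moreover have "(LINT t|lebesgue01. f t * interval_bump c d n t) = 0" for n
    using assms [OF test_function01_interval_bump [OF cd(1,3)], of n] f b by (simp add: inner_L2_class)
  ultimately have "(LINT t|lebesgue01. f t * indicator {c<..<d} t) = 0"
    by (simp add: LIMSEQ_const_iff)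
  then show "inner u (L2_class (indicator {c<..<d})) = 0"
    using f by (simp add: inner_L2_class square_integrable01_indicator)
qed

lemma has_weak_deriv01_iff:
  "has_weak_deriv01 j u v \<longleftrightarrow> (\<forall>\<phi>. test_function01 \<phi> \<longrightarrow>
    inner u (L2_class ((deriv ^^ j) \<phi>)) = (-1) ^ j * inner v (L2_class \<phi>))"
proof -
  obtain f g where fg: "square_integrable01 f" "u = L2_class f" "square_integrable01 g" "v = L2_class g"
    by (meson L2_cases)
  then show ?thesis
    by (auto simp: has_weak_deriv01.abs_eq inner_L2_class test_function01_square_integrable
        test_function01_square_integrable_0)
qed

lemma has_weak_deriv01_unique:
  assumes "has_weak_deriv01 j u v" "has_weak_deriv01 j u w"
  shows "v = w"
proof -
  have "inner (v - w) (L2_class \<phi>) = 0" if "test_function01 \<phi>" for \<phi>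
  proof -
    have "(-1) ^ j * inner v (L2_class \<phi>) = (-1) ^ j * inner w (L2_class \<phi>)"
      using assms that unfolding has_weak_deriv01_iff by metis
    then show ?thesis by (simp add: inner_diff_left)
  qed
  then have "v - w = 0" by (rule L2_eq_0_test_functions)
  then show ?thesis by simp
qed

lemma weak_deriv01_eq: "has_weak_deriv01 j u v \<Longrightarrow> weak_deriv01 j u = v"
  unfolding weak_deriv01_def using has_weak_deriv01_unique by blast

lemma test_function01_lincomb:
  assumes f: "test_function01 f" and g: "test_function01 g"
  shows "test_function01 (\<lambda>t. f t + c * g t)"
proof -
  have D: "((\<lambda>t. (deriv ^^ n) f t + c * (deriv ^^ n) g t) has_real_derivative
      (deriv ^^ Suc n) f t + c * (deriv ^^ Suc n) g t) (at t)" for n t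
    using test_function01_has_derivative [OF f] test_function01_has_derivative [OF g]
    by (intro DERIV_add DERIV_cmult)
  have *: "(deriv ^^ n) (\<lambda>t. f t + c * g t) = (\<lambda>t. (deriv ^^ n) f t + c * (deriv ^^ n) g t)" for n
  proof (induction n)
    case (Suc n)
    show ?case using D [of n] by (auto simp: Suc intro: DERIV_imp_deriv)
  qed simp
  obtain a b a' b' where ab: "0 < a" "b < 1" "\<forall>t. t \<notin> {a..b} \<longrightarrow> f t = 0" "0 < a'" "b' < 1" "\<forall>t. t \<notin> {a'..b'} \<longrightarrow> g t = 0"
    using f g by (auto simp: test_function01_def)
  show ?thesis
    unfolding test_function01_def *
  proof (intro conjI allI)
    show "(\<lambda>t. (deriv ^^ n) f t + c * (deriv ^^ n) g t) field_differentiable at t" for n t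
      using D [of n t] by (auto simp: field_differentiable_def)
    have "f t + c * g t = 0" if "t \<notin> {min a a'..max b b'}" for t
    proof -
      have "t \<notin> {a..b}" "t \<notin> {a'..b'}" using that by auto
      then show ?thesis using ab(3,6) by (metis add_0 mult_zero_right)
    qed
    then show "\<exists>a b. 0 < a \<and> b < 1 \<and> (\<forall>t. t \<notin> {a..b} \<longrightarrow> f t + c * g t = 0)"
      using ab by (metis max_less_iff_conj min_less_iff_conj)
  qed
qed

lemma integral_lebesgue01_indicator:
  assumes "0 \<le> a" "a \<le> b" "b \<le> 1"
  shows "(LINT t|lebesgue01. indicator {a..<b} t) = b - a"
proof -
  have "AE t in lebesgue01. indicator {a..<b} t = (1 * indicator {a<..<b} t :: real)"
    by (rule AE_lebesgue01_negligible [of "{a}"]) (auto simp: indicator_def)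
  then have "(LINT t|lebesgue01. indicator {a..<b} t) = (LINT t|lebesgue01. 1 * indicator {a<..<b} t :: real)"
    by (intro integral_cong_AE borel_measurable_lebesgue01 borel_measurable_times borel_measurable_indicator) auto
  also have "\<dots> = integral {a<..<b} (\<lambda>t. 1)"
    using assms finite_measure.integrable_const [OF finite_measure_lebesgue01]
    by (intro integral_lebesgue01_indicator_mult) auto
  also have "\<dots> = b - a" using assms by (simp flip: integral_open_interval_real)
  finally show ?thesis .
qed

text \<open>The integral of \<open>f\<close> from 0 to \<open>t\<close>; the indicator keeps the
  measure fixed, so that linearity and Fubini apply directly.\<close>

definition primitive01 :: "(real \<Rightarrow> real) \<Rightarrow> real \<Rightarrow> real"
  where "primitive01 f t = (LINT s|lebesgue01. indicator {..<t} s * f s)"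

text \<open>Cauchy-Schwarz against the indicator of \<open>{s..<t}\<close>. The energy stays
  localized to that interval, so that the cells in \<open>Poincare\<close> add up to the total
  energy and not to \<open>N\<close> times it.\<close>

lemma primitive01_diff:
  assumes f: "square_integrable01 f" and st: "0 \<le> s" "s \<le> t" "t \<le> 1"
  shows "(primitive01 f t - primitive01 f s)\<^sup>2 \<le> (t - s) * (LINT r|lebesgue01. indicator {s..<t} r * (f r)\<^sup>2)"
proof -
  define i where "i = (indicator {s..<t} :: real \<Rightarrow> real)"
  have i: "square_integrable01 i" unfolding i_def by (intro square_integrable01_indicator) simp
  have ii: "i r * i r = i r" for r by (simp add: i_def indicator_def)
  have fm [measurable]: "f \<in> borel_measurable lebesgue01" "i \<in> borel_measurable lebesgue01"
    using f i by (auto simp: square_integrable01_def)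
  have if2: "square_integrable01 (\<lambda>r. i r * f r)"
  proof -
    have "integrable lebesgue01 (\<lambda>r. (i r * f r)\<^sup>2)"
    proof (rule Bochner_Integration.integrable_bound)
      show "integrable lebesgue01 (\<lambda>r. (f r)\<^sup>2)" using f by (simp add: square_integrable01_def)
      show "AE r in lebesgue01. norm ((i r * f r)\<^sup>2) \<le> norm ((f r)\<^sup>2)"
        by (intro AE_I2) (auto simp: i_def indicator_def)
    qed measurable
    then show ?thesis by (simp add: square_integrable01_def)
  qed
  have int: "integrable lebesgue01 (\<lambda>s. indicator {..<t} s * f s)" for t
    using square_integrable01_mult [OF square_integrable01_indicator f] by simp
  have "primitive01 f t - primitive01 f s = (LINT r|lebesgue01. indicator {..<t} r * f r - indicator {..<s} r * f r)"
    unfolding primitive01_def by (simp add: int)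
  also have "\<dots> = (LINT r|lebesgue01. i r * (i r * f r))"
    using st by (intro Bochner_Integration.integral_cong) (auto simp: i_def indicator_def)
  also have "\<dots> = inner (L2_class i) (L2_class (\<lambda>r. i r * f r))" by (simp add: inner_L2_class i if2)
  finally have "(primitive01 f t - primitive01 f s)\<^sup>2 \<le> inner (L2_class i) (L2_class i) *
      inner (L2_class (\<lambda>r. i r * f r)) (L2_class (\<lambda>r. i r * f r))"
    using Cauchy_Schwarz_ineq by metis
  also have "inner (L2_class i) (L2_class i) = t - s"
    unfolding inner_L2_class [OF i i] ii using integral_lebesgue01_indicator [OF st] by (simp add: i_def)
  also have "inner (L2_class (\<lambda>r. i r * f r)) (L2_class (\<lambda>r. i r * f r)) = (LINT r|lebesgue01. i r * (f r)\<^sup>2)"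
    unfolding inner_L2_class [OF if2 if2]
    by (intro Bochner_Integration.integral_cong) (auto simp: i_def indicator_def power2_eq_square)
  finally show ?thesis unfolding i_def .
qed

lemma primitive01_measurable:
  assumes f: "square_integrable01 f"
  shows "primitive01 f \<in> borel_measurable lebesgue01" "square_integrable01 (primitive01 f)"
proof -
  have fm [measurable]: "f \<in> borel_measurable lebesgue01" using f by (simp add: square_integrable01_def)
  have id [measurable]: "(\<lambda>x::real. x) \<in> borel_measurable lebesgue01"
    by (intro continuous_measurable_lebesgue01 continuous_on_id)
  interpret sigma_finite_measure lebesgue01
    by (rule finite_measure.axioms) (rule finite_measure_lebesgue01)
  have "(\<lambda>t. LINT s|lebesgue01. (if s < t then f s else 0)) \<in> borel_measurable lebesgue01"
    by (rule borel_measurable_lebesgue_integral) measurable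
  also have "(\<lambda>t. LINT s|lebesgue01. (if s < t then f s else 0)) = primitive01 f"
    unfolding primitive01_def by (intro ext Bochner_Integration.integral_cong) (auto simp: indicator_def)
  finally show m: "primitive01 f \<in> borel_measurable lebesgue01" .
  have "\<bar>primitive01 f t\<bar> \<le> (LINT s|lebesgue01. \<bar>f s\<bar>)" for t
  proof -
    have "\<bar>primitive01 f t\<bar> \<le> (LINT s|lebesgue01. \<bar>indicator {..<t} s * f s\<bar>)"
      unfolding primitive01_def by (rule integral_abs_bound)
    also have "\<dots> \<le> (LINT s|lebesgue01. \<bar>f s\<bar>)"
    proof (rule integral_mono)
      show "integrable lebesgue01 (\<lambda>s. \<bar>indicator {..<t} s * f s\<bar>)"
        using square_integrable01_mult [OF square_integrable01_indicator f, of "{..<t}"] by simp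
      show "integrable lebesgue01 (\<lambda>s. \<bar>f s\<bar>)" using square_integrable01_integrable [OF f] by simp
    qed (auto simp: indicator_def)
    finally show ?thesis .
  qed
  with m show "square_integrable01 (primitive01 f)" by (rule square_integrable01_bounded)
qed

lemma test_function01_tail_integral:
  assumes \<phi>: "test_function01 \<phi>" and s: "0 < s" "s < 1"
  shows "(LINT t|lebesgue01. (if s < t then deriv \<phi> t else 0)) = - \<phi> s"
proof -
  have c: "continuous_on UNIV (deriv \<phi>)" using test_function01_continuous [OF \<phi>, of 1] by simp
  have "(LINT t|lebesgue01. (if s < t then deriv \<phi> t else 0)) = (LINT t|lebesgue01. deriv \<phi> t * indicator {s<..<1} t)"
    by (intro Bochner_Integration.integral_cong) (auto simp: indicator_def)
  also have "\<dots> = integral {s<..<1} (deriv \<phi>)"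
    using s integral_lebesgue01_continuous(2) [OF c] by (intro integral_lebesgue01_indicator_mult) auto
  also have "\<dots> = integral {s..1} (deriv \<phi>)" by (simp add: integral_open_interval_real)
  also have "\<dots> = \<phi> 1 - \<phi> s"
    using s test_function01_has_derivative [OF \<phi>, of 0]
    by (intro integral_unique fundamental_theorem_of_calculus)
      (auto simp: has_real_derivative_iff_has_vector_derivative [symmetric] intro: has_field_derivative_at_within)
  also have "\<phi> 1 = 0" using \<phi> by (force simp: test_function01_def)
  finally show ?thesis by simp
qed

text \<open>\<open>f\<close> is merely square integrable, so in place of a product rule the order of
  integration is exchanged on the triangle \<open>s < t\<close>.\<close>

lemma primitive01_by_parts:
  assumes f: "square_integrable01 f" and \<phi>: "test_function01 \<phi>"
  shows "(LINT t|lebesgue01. primitive01 f t * deriv \<phi> t) = - (LINT t|lebesgue01. f t * \<phi> t)"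
proof -
  have fm [measurable]: "f \<in> borel_measurable lebesgue01" using f by (simp add: square_integrable01_def)
  have d: "square_integrable01 (deriv \<phi>)" using test_function01_square_integrable [OF \<phi>, of 1] by simp
  then have dm [measurable]: "deriv \<phi> \<in> borel_measurable lebesgue01" by (simp add: square_integrable01_def)
  have id [measurable]: "(\<lambda>x::real. x) \<in> borel_measurable lebesgue01"
    by (intro continuous_measurable_lebesgue01 continuous_on_id)
  interpret sigma_finite_measure lebesgue01
    by (rule finite_measure.axioms) (rule finite_measure_lebesgue01)
  interpret P: pair_sigma_finite lebesgue01 lebesgue01 by standard
  define h where "h s t = (if s < t then f s * deriv \<phi> t else 0)" for s t
  have fi: "integrable lebesgue01 f" by (rule square_integrable01_integrable [OF f])
  have di: "integrable lebesgue01 (deriv \<phi>)" by (rule square_integrable01_integrable [OF d])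
  have hm [measurable]: "(\<lambda>(s, t). h s t) \<in> borel_measurable (lebesgue01 \<Otimes>\<^sub>M lebesgue01)"
    unfolding h_def by measurable
  have fd: "integrable (lebesgue01 \<Otimes>\<^sub>M lebesgue01) (\<lambda>(s, t). f s * deriv \<phi> t)"
  proof (rule P.Fubini_integrable)
    have "(\<lambda>s. LINT t|lebesgue01. norm (f s * deriv \<phi> t)) = (\<lambda>s. \<bar>f s\<bar> * (LINT t|lebesgue01. \<bar>deriv \<phi> t\<bar>))"
      by (simp add: abs_mult)
    then show "integrable lebesgue01 (\<lambda>s. LINT t|lebesgue01. norm (case (s, t) of (s, t) \<Rightarrow> f s * deriv \<phi> t))"
      using fi by simp
  qed (use di in \<open>auto intro!: AE_I2\<close>)
  have hi: "integrable (lebesgue01 \<Otimes>\<^sub>M lebesgue01) (\<lambda>(s, t). h s t)"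
    by (rule Bochner_Integration.integrable_bound [OF fd hm]) (auto simp: h_def intro!: AE_I2)
  have "(LINT t|lebesgue01. primitive01 f t * deriv \<phi> t) = (LINT t|lebesgue01. LINT s|lebesgue01. h s t)"
  proof (intro Bochner_Integration.integral_cong refl)
    fix t
    have "primitive01 f t * deriv \<phi> t = (LINT s|lebesgue01. indicator {..<t} s * f s * deriv \<phi> t)"
      by (simp add: primitive01_def)
    also have "\<dots> = (LINT s|lebesgue01. h s t)"
      by (intro Bochner_Integration.integral_cong) (auto simp: h_def indicator_def)
    finally show "primitive01 f t * deriv \<phi> t = (LINT s|lebesgue01. h s t)" .
  qed
  also have "\<dots> = (LINT s|lebesgue01. LINT t|lebesgue01. h s t)"
    by (rule P.Fubini_integral [OF hi])
  also have "\<dots> = (LINT s|lebesgue01. - (f s * \<phi> s))"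
  proof (intro Bochner_Integration.integral_cong refl)
    fix s assume "s \<in> space lebesgue01"
    then have s: "0 < s" "s < 1" by auto
    have "(LINT t|lebesgue01. h s t) = (LINT t|lebesgue01. f s * (if s < t then deriv \<phi> t else 0))"
      by (intro Bochner_Integration.integral_cong) (auto simp: h_def)
    also have "\<dots> = - (f s * \<phi> s)" by (simp add: test_function01_tail_integral [OF \<phi> s])
    finally show "(LINT t|lebesgue01. h s t) = - (f s * \<phi> s)" .
  qed
  finally show ?thesis by simp
qed

text \<open>Lemma of du Bois-Reymond: adding a multiple of one fixed \<open>\<rho>\<close> with
  nonzero mean turns any test function into the derivative of a test function.\<close>

lemma orthogonal_to_derivatives_imp_const:
  assumes "\<And>\<phi>. test_function01 \<phi> \<Longrightarrow> inner w (L2_class (deriv \<phi>)) = 0"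
  shows "\<exists>c. w = L2_class (\<lambda>t. c)"
proof -
  define e where "e = L2_class (\<lambda>t. 1)"
  have one: "square_integrable01 (\<lambda>t. 1)" using square_integrable01_power [of 0] by simp
  have e: "inner e (L2_class \<phi>) = (LINT t|lebesgue01. \<phi> t)" if "test_function01 \<phi>" for \<phi>
    unfolding e_def using one test_function01_square_integrable_0 [OF that] by (simp add: inner_L2_class)
  have "inner e e = 1" unfolding e_def by (simp add: inner_L2_class one measure_lebesgue01)
  then have "e \<noteq> 0" by auto
  then obtain \<rho> where \<rho>: "test_function01 \<rho>" "inner e (L2_class \<rho>) \<noteq> 0"
    using L2_eq_0_test_functions [of e] by blast
  define c where "c = inner w (L2_class \<rho>) / inner e (L2_class \<rho>)"
  have "inner (w - c *\<^sub>R e) (L2_class \<psi>) = 0" if \<psi>: "test_function01 \<psi>" for \<psi>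
  proof -
    define q where "q = - inner e (L2_class \<psi>) / inner e (L2_class \<rho>)"
    define \<theta> where "\<theta> t = \<psi> t + q * \<rho> t" for t
    have \<theta>: "test_function01 \<theta>" unfolding \<theta>_def by (intro test_function01_lincomb \<psi> \<rho>)
    have \<theta>c: "L2_class \<theta> = L2_class \<psi> + q *\<^sub>R L2_class \<rho>"
      unfolding \<theta>_def using \<psi> \<rho> test_function01_square_integrable_0
      by (simp add: scale_L2_class add_L2_class square_integrable01_scale)
    have "inner e (L2_class \<theta>) = 0" using \<rho> by (simp add: \<theta>c inner_add_right inner_diff_right q_def)
    then obtain \<phi> where "test_function01 \<phi>" "deriv \<phi> = \<theta>"
      using test_function01_antiderivative [OF \<theta>] e [OF \<theta>] by auto
    then have "inner w (L2_class \<theta>) = 0" using assms by blast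
    then have "inner w (L2_class \<psi>) = c * inner e (L2_class \<psi>)"
      using \<rho> by (simp add: \<theta>c inner_add_right inner_diff_right q_def c_def field_simps)
    then show ?thesis by (simp add: inner_diff_left)
  qed
  then have "w - c *\<^sub>R e = 0" by (rule L2_eq_0_test_functions)
  then have "w = L2_class (\<lambda>t. c)" by (simp add: e_def scale_L2_class one)
  then show ?thesis by blast
qed

text \<open>The difference of \<open>u\<close> and the primitive of \<open>f\<close> is orthogonal
  to all derivatives of test functions. The resulting representative of \<open>u\<close> has
  pointwise oscillation controlled by \<open>primitive01_diff\<close>.\<close>

lemma weak_deriv01_primitive:
  assumes f: "square_integrable01 f" and u: "has_weak_deriv01 1 u (L2_class f)"
  shows "\<exists>c. u = L2_class (\<lambda>t. c + primitive01 f t)"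
proof -
  note p = primitive01_measurable(2) [OF f]
  have "inner (u - L2_class (primitive01 f)) (L2_class (deriv \<phi>)) = 0" if \<phi>: "test_function01 \<phi>" for \<phi>
  proof -
    have d: "square_integrable01 (deriv \<phi>)" using test_function01_square_integrable [OF \<phi>, of 1] by simp
    have "inner u (L2_class (deriv \<phi>)) = - inner (L2_class f) (L2_class \<phi>)"
      using u \<phi> by (simp add: has_weak_deriv01_iff)
    moreover have "inner (L2_class (primitive01 f)) (L2_class (deriv \<phi>)) = - inner (L2_class f) (L2_class \<phi>)"
      using primitive01_by_parts [OF f \<phi>] d p f test_function01_square_integrable_0 [OF \<phi>]
      by (simp add: inner_L2_class)
    ultimately show ?thesis by (simp add: inner_diff_left)
  qed
  then obtain c where c: "u - L2_class (primitive01 f) = L2_class (\<lambda>t. c)"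
    using orthogonal_to_derivatives_imp_const by blast
  have "square_integrable01 (\<lambda>t. c)" by (intro square_integrable01_continuous continuous_intros)
  then have "u = L2_class (\<lambda>t. c + primitive01 f t)"
    using c p by (simp add: diff_eq_eq add_L2_class)
  then show ?thesis by blast
qed

text \<open>Half-open cells partition the interval. The indicators are not normalized: the inner
  product with one is the cell mean divided by \<open>N\<close>, whence the factor \<open>N\<close>
  in \<open>Poincare\<close>.\<close>

definition cell_class :: "nat \<Rightarrow> nat \<Rightarrow> L2"
  where "cell_class N m = L2_class (indicator {real m / real N..<real (Suc m) / real N})"

text \<open>On a cell of length \<open>1 / N\<close> a primitive with energy \<open>A m\<close>
  oscillates by at most \<open>sqrt (A m / N)\<close>, so it stays that close to its mean; squaring
  and integrating over the cell brings the second factor \<open>1 / N\<close>.\<close>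

lemma Poincare:
  assumes N: "N \<ge> 1" and uv: "has_weak_deriv01 1 u v"
  shows "(norm u)\<^sup>2 \<le> (1 / real N)\<^sup>2 * (norm v)\<^sup>2 + real N * (\<Sum>m<N. (inner u (cell_class N m))\<^sup>2)"
proof -
  obtain f where f: "square_integrable01 f" "v = L2_class f" by (rule L2_cases)
  obtain c where c: "u = L2_class (\<lambda>t. c + primitive01 f t)"
    using weak_deriv01_primitive [OF f(1)] uv f(2) by blast
  define h where "h t = c + primitive01 f t" for t
  have h: "square_integrable01 h" unfolding h_def
    by (intro square_integrable01_add primitive01_measurable f square_integrable01_continuous continuous_intros)
  have u: "u = L2_class h" unfolding c h_def ..
  define i where "i m = (indicator {real m / real N..<real (Suc m) / real N} :: real \<Rightarrow> real)" for m
  have i: "square_integrable01 (i m)" for m unfolding i_def by (intro square_integrable01_indicator) simp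
  define A where "A m = (LINT r|lebesgue01. i m r * (f r)\<^sup>2)" for m
  \<comment> \<open>The mean of \<open>u\<close> on cell \<open>m\<close>.\<close>
  define \<mu> where "\<mu> m = real N * inner u (cell_class N m)" for m
  have N0: "real N > 0" using N by simp
  have ih: "integrable lebesgue01 (\<lambda>t. i m t * h t)" for m by (intro square_integrable01_mult i h)
  have ii: "integrable lebesgue01 (i m)" for m by (intro square_integrable01_integrable i)
  have i2: "integrable lebesgue01 (\<lambda>r. i m r * (f r)\<^sup>2)" for m
  proof (rule Bochner_Integration.integrable_bound)
    show "integrable lebesgue01 (\<lambda>r. (f r)\<^sup>2)" using f by (simp add: square_integrable01_def)
    show "(\<lambda>r. i m r * (f r)\<^sup>2) \<in> borel_measurable lebesgue01"
      using f i [of m] by (auto simp: square_integrable01_def)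
  qed (auto simp: i_def indicator_def intro!: AE_I2)
  have lenm: "(LINT t|lebesgue01. i m t) = 1 / real N" if "m < N" for m
    using that N0 unfolding i_def
    by (subst integral_lebesgue01_indicator) (auto simp: field_simps)
  have \<mu>: "(LINT t|lebesgue01. i m t * h t) = \<mu> m / real N" for m
  proof -
    have "cell_class N m = L2_class (i m)" by (simp only: cell_class_def i_def)
    then show ?thesis using N0 h i [of m] by (simp add: \<mu>_def u inner_L2_class mult.commute)
  qed
  have cell: "\<exists>m<N. i m t = 1 \<and> (\<forall>l<N. l \<noteq> m \<longrightarrow> i l t = 0)" if t: "0 < t" "t < 1" for t
  proof -
    define m where "m = nat \<lfloor>real N * t\<rfloor>"
    have m: "real m \<le> real N * t" "real N * t < real m + 1"
      using t N0 unfolding m_def by (auto simp: le_floor_iff)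
    have "real N * t < real N * 1" using t N0 by (intro mult_strict_left_mono) auto
    then have "m < N" using m by linarith
    moreover have "i l t = (if l = m then 1 else 0)" for l
    proof -
      have "t \<in> {real l / real N..<real (Suc l) / real N} \<longleftrightarrow> real l \<le> real N * t \<and> real N * t < real l + 1"
        using N0 by (auto simp: field_simps)
      also have "\<dots> \<longleftrightarrow> l = m" using m by auto
      finally show ?thesis by (simp add: i_def indicator_def)
    qed
    ultimately show ?thesis by auto
  qed
  have A0: "A m \<ge> 0" for m unfolding A_def by (intro Bochner_Integration.integral_nonneg) (auto simp: i_def)
  have osc: "(h t - h s)\<^sup>2 \<le> A m / real N" if m: "m < N" and st: "i m s = 1" "i m t = 1" "s \<le> t" for m s t
  proof -
    have b: "real m / real N \<le> s" "t < real (Suc m) / real N" using st by (auto simp: i_def indicator_def split: if_splits)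
    have "0 \<le> real m / real N" by simp
    then have s0: "0 \<le> s" using b by linarith
    have "real (Suc m) / real N \<le> 1" using m N0 by (simp add: field_simps)
    then have t1: "t \<le> 1" using b by linarith
    have "real (Suc m) / real N = real m / real N + 1 / real N" by (simp add: add_divide_distrib)
    then have ts: "t - s \<le> 1 / real N" using b by linarith
    have I2: "integrable lebesgue01 (\<lambda>r. indicator {s..<t} r * (f r)\<^sup>2)"
    proof (rule Bochner_Integration.integrable_bound [OF i2 [of m]])
      show "(\<lambda>r. indicator {s..<t} r * (f r)\<^sup>2) \<in> borel_measurable lebesgue01"
      proof (rule borel_measurable_times)
        show "(indicator {s..<t} :: real \<Rightarrow> real) \<in> borel_measurable lebesgue01"
          by (intro borel_measurable_lebesgue01 borel_measurable_indicator) simp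
        show "(\<lambda>r. (f r)\<^sup>2) \<in> borel_measurable lebesgue01"
          using f(1) by (intro borel_measurable_power) (simp add: square_integrable01_def)
      qed
    qed (use b in \<open>auto simp: i_def indicator_def intro!: AE_I2\<close>)
    have "(h t - h s)\<^sup>2 = (primitive01 f t - primitive01 f s)\<^sup>2" by (simp add: h_def)
    also have "\<dots> \<le> (t - s) * (LINT r|lebesgue01. indicator {s..<t} r * (f r)\<^sup>2)"
      by (rule primitive01_diff [OF f(1) s0 st(3) t1])
    also have "\<dots> \<le> (1 / real N) * A m"
    proof (rule mult_mono [OF ts])
      show "(LINT r|lebesgue01. indicator {s..<t} r * (f r)\<^sup>2) \<le> A m"
        unfolding A_def by (intro integral_mono I2 i2) (use b in \<open>auto simp: i_def indicator_def\<close>)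
    qed (auto intro!: Bochner_Integration.integral_nonneg)
    finally show ?thesis by simp
  qed
  have dev: "(h t - \<mu> m)\<^sup>2 \<le> A m / real N" if m: "m < N" and t: "i m t = 1" for m t
  proof -
    define \<delta> where "\<delta> = sqrt (A m / real N)"
    have \<delta>: "\<bar>h t - h s\<bar> \<le> \<delta>" if "i m s = 1" for s
    proof -
      have "(h t - h s)\<^sup>2 \<le> A m / real N"
        using osc [OF m that t] osc [OF m t that] by (cases "s \<le> t") (auto simp: power2_commute)
      then have "sqrt ((h t - h s)\<^sup>2) \<le> \<delta>" unfolding \<delta>_def by (rule real_sqrt_le_mono)
      then show ?thesis by simp
    qed
    have i01: "i m s = 0 \<or> i m s = 1" for s by (auto simp: i_def indicator_def)
    have "(LINT s|lebesgue01. i m s * h s) \<le> (LINT s|lebesgue01. i m s * (h t + \<delta>))"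
    proof (intro integral_mono ih integrable_mult_left ii)
      show "i m s * h s \<le> i m s * (h t + \<delta>)" for s using \<delta> [of s] i01 [of s] by auto
    qed
    moreover have "(LINT s|lebesgue01. i m s * (h t - \<delta>)) \<le> (LINT s|lebesgue01. i m s * h s)"
    proof (intro integral_mono ih integrable_mult_left ii)
      show "i m s * (h t - \<delta>) \<le> i m s * h s" for s using \<delta> [of s] i01 [of s] by auto
    qed
    ultimately have "\<mu> m / real N \<le> (h t + \<delta>) / real N" "(h t - \<delta>) / real N \<le> \<mu> m / real N"
      using lenm [OF m] \<mu> [of m] ii [of m] by simp_all
    then have "\<bar>h t - \<mu> m\<bar> \<le> \<delta>" using N0 by (simp add: divide_le_cancel abs_le_iff)
    then have "\<bar>h t - \<mu> m\<bar>\<^sup>2 \<le> \<delta>\<^sup>2" by (intro power_mono) auto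
    then show ?thesis using A0 [of m] N0 by (simp add: \<delta>_def)
  qed
  \<comment> \<open>\<open>dev\<close> solved for the square of \<open>h t\<close>, with the cell
    selected by indicators. The right-hand side is affine in \<open>h\<close>, so its integral
    involves only cell lengths and cell means.\<close>
  have point: "(h t)\<^sup>2 \<le> (\<Sum>m<N. (A m / real N - (\<mu> m)\<^sup>2) * i m t + 2 * \<mu> m * (i m t * h t))"
    if t: "0 < t" "t < 1" for t
  proof -
    obtain m where m: "m < N" "i m t = 1" "\<And>l. l < N \<Longrightarrow> l \<noteq> m \<Longrightarrow> i l t = 0" using cell [OF t] by blast
    have "(\<Sum>l<N. (A l / real N - (\<mu> l)\<^sup>2) * i l t + 2 * \<mu> l * (i l t * h t))
        = (\<Sum>l<N. if l = m then (A m / real N - (\<mu> m)\<^sup>2) + 2 * \<mu> m * h t else 0)"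
      by (intro sum.cong) (auto simp: m)
    also have "\<dots> = (A m / real N - (\<mu> m)\<^sup>2) + 2 * \<mu> m * h t" using m by simp
    finally show ?thesis using dev [OF m(1,2)] by (simp add: power2_diff mult_ac)
  qed
  have "(norm u)\<^sup>2 = (LINT t|lebesgue01. (h t)\<^sup>2)" unfolding u by (rule norm_L2_class [OF h])
  also have "\<dots> \<le> (LINT t|lebesgue01. (\<Sum>m<N. (A m / real N - (\<mu> m)\<^sup>2) * i m t + 2 * \<mu> m * (i m t * h t)))"
    using h point by (intro integral_mono Bochner_Integration.integrable_sum Bochner_Integration.integrable_add
        integrable_mult_right ii ih) (auto simp: square_integrable01_def)
  also have "\<dots> = (\<Sum>m<N. (A m / real N - (\<mu> m)\<^sup>2) * (LINT t|lebesgue01. i m t) + 2 * \<mu> m * (\<mu> m / real N))"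
    using ii ih by (simp add: Bochner_Integration.integral_sum Bochner_Integration.integral_add \<mu>)
  \<comment> \<open>On each cell, \<open>(A / N - \<mu>\<^sup>2) / N + 2 * \<mu>\<^sup>2 / N = A /
    N\<^sup>2 + \<mu>\<^sup>2 / N\<close>.\<close>
  also have "\<dots> = (\<Sum>m<N. A m / (real N)\<^sup>2 + (\<mu> m)\<^sup>2 / real N)"
    by (intro sum.cong) (auto simp: lenm field_simps power2_eq_square)
  also have "\<dots> = (1 / real N)\<^sup>2 * (\<Sum>m<N. A m) + real N * (\<Sum>m<N. (inner u (cell_class N m))\<^sup>2)"
    using N0 by (simp add: sum.distrib \<mu>_def power_mult_distrib sum_distrib_left power_divide sum_divide_distrib)
      (simp add: power2_eq_square)
  also have "(\<Sum>m<N. A m) \<le> (norm v)\<^sup>2"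
  proof -
    have "(\<Sum>m<N. A m) = (LINT r|lebesgue01. (\<Sum>m<N. i m r * (f r)\<^sup>2))"
      unfolding A_def using i2 by (simp add: Bochner_Integration.integral_sum)
    also have "\<dots> \<le> (LINT r|lebesgue01. (f r)\<^sup>2)"
    proof (intro integral_mono Bochner_Integration.integrable_sum i2)
      show "integrable lebesgue01 (\<lambda>r. (f r)\<^sup>2)" using f by (simp add: square_integrable01_def)
      fix r assume "r \<in> space lebesgue01"
      then have "0 < r" "r < 1" by auto
      then obtain m where m: "m < N" "i m r = 1" "\<And>l. l < N \<Longrightarrow> l \<noteq> m \<Longrightarrow> i l r = 0" using cell by blast
      have "(\<Sum>l<N. i l r * (f r)\<^sup>2) = (\<Sum>l<N. if l = m then (f r)\<^sup>2 else 0)"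
        by (intro sum.cong) (auto simp: m)
      then show "(\<Sum>l<N. i l r * (f r)\<^sup>2) \<le> (f r)\<^sup>2" using m by simp
    qed
    finally show ?thesis by (simp add: f norm_L2_class)
  qed
  finally show ?thesis by (simp add: mult_left_mono)
qed

section \<open>Sobolev spaces\<close>

lemma has_weak_deriv01_add:
  "has_weak_deriv01 j u v \<Longrightarrow> has_weak_deriv01 j u' v' \<Longrightarrow> has_weak_deriv01 j (u + u') (v + v')"
  by (simp add: has_weak_deriv01_iff inner_add_left algebra_simps)

lemma has_weak_deriv01_scale: "has_weak_deriv01 j u v \<Longrightarrow> has_weak_deriv01 j (c *\<^sub>R u) (c *\<^sub>R v)"
  by (simp add: has_weak_deriv01_iff)

lemma has_weak_deriv01_0: "has_weak_deriv01 0 u u"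
  by (simp add: has_weak_deriv01_iff)

lemma sobolev01_has_weak_deriv:
  "u \<in> sobolev01 k \<Longrightarrow> j \<le> k \<Longrightarrow> has_weak_deriv01 j u (weak_deriv01 j u)"
  using weak_deriv01_eq unfolding sobolev01_def by blast

lemma weak_deriv01_0: "weak_deriv01 0 u = u"
  by (rule weak_deriv01_eq [OF has_weak_deriv01_0])

lemma weak_deriv01_add:
  "u \<in> sobolev01 k \<Longrightarrow> v \<in> sobolev01 k \<Longrightarrow> j \<le> k \<Longrightarrow> weak_deriv01 j (u + v) = weak_deriv01 j u + weak_deriv01 j v"
  by (intro weak_deriv01_eq has_weak_deriv01_add sobolev01_has_weak_deriv)

lemma weak_deriv01_scale:
  "u \<in> sobolev01 k \<Longrightarrow> j \<le> k \<Longrightarrow> weak_deriv01 j (c *\<^sub>R u) = c *\<^sub>R weak_deriv01 j u"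
  by (intro weak_deriv01_eq has_weak_deriv01_scale sobolev01_has_weak_deriv)

lemma subspace_sobolev01: "subspace (sobolev01 k)"
  unfolding subspace_def
proof (intro conjI ballI allI)
  have "has_weak_deriv01 j 0 0" for j by (simp add: has_weak_deriv01_iff)
  then show "0 \<in> sobolev01 k" unfolding sobolev01_def by blast
  show "x + y \<in> sobolev01 k" if "x \<in> sobolev01 k" "y \<in> sobolev01 k" for x y
    using that has_weak_deriv01_add unfolding sobolev01_def by blast
  show "c *\<^sub>R x \<in> sobolev01 k" if "x \<in> sobolev01 k" for c x
    using that has_weak_deriv01_scale unfolding sobolev01_def by blast
qed

lemma weak_deriv01_diff:
  assumes "u \<in> sobolev01 k" "v \<in> sobolev01 k" "j \<le> k"
  shows "weak_deriv01 j (u - v) = weak_deriv01 j u - weak_deriv01 j v"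
proof -
  have "u - v \<in> sobolev01 k" using assms subspace_diff [OF subspace_sobolev01] by blast
  then have "weak_deriv01 j (u - v + v) = weak_deriv01 j (u - v) + weak_deriv01 j v"
    using assms by (intro weak_deriv01_add)
  then show ?thesis by simp
qed

text \<open>Testing the identity of order \<open>j\<close> with \<open>deriv \<phi>\<close> gives
  the identity of order \<open>j + 1\<close> for \<open>\<phi>\<close>. Thus the first-order
  \<open>Poincare\<close> applies between consecutive derivatives.\<close>

lemma weak_deriv01_Suc:
  assumes "u \<in> sobolev01 k" "Suc j \<le> k"
  shows "has_weak_deriv01 1 (weak_deriv01 j u) (weak_deriv01 (Suc j) u)"
  unfolding has_weak_deriv01_iff
proof (intro allI impI)
  fix \<phi> assume \<phi>: "test_function01 \<phi>"
  have d: "test_function01 (deriv \<phi>)" using test_function01_deriv [OF \<phi>, of 1] by simp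
  have "(-1) ^ j * inner (weak_deriv01 j u) (L2_class (deriv \<phi>)) = inner u (L2_class ((deriv ^^ j) (deriv \<phi>)))"
    using sobolev01_has_weak_deriv [OF assms(1), of j] assms(2) d by (simp add: has_weak_deriv01_iff)
  also have "\<dots> = inner u (L2_class ((deriv ^^ Suc j) \<phi>))" by (simp only: funpow_Suc_right o_apply)
  also have "\<dots> = (-1) ^ Suc j * inner (weak_deriv01 (Suc j) u) (L2_class \<phi>)"
    using sobolev01_has_weak_deriv [OF assms] \<phi> by (simp only: has_weak_deriv01_iff)
  finally have "(-1) ^ j * inner (weak_deriv01 j u) (L2_class (deriv \<phi>))
      = (-1) ^ j * - inner (weak_deriv01 (Suc j) u) (L2_class \<phi>)" by simp
  then have "inner (weak_deriv01 j u) (L2_class (deriv \<phi>)) = - inner (weak_deriv01 (Suc j) u) (L2_class \<phi>)"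
    by (subst (asm) mult_cancel_left) simp
  then show "inner (weak_deriv01 j u) (L2_class ((deriv ^^ 1) \<phi>)) = (-1) ^ 1 * inner (weak_deriv01 (Suc j) u) (L2_class \<phi>)"
    by simp
qed

text \<open>\<open>Poincare\<close> iterated \<open>k\<close> times. The mean conditions amount to
  \<open>k * N\<close> linear functionals, the codimension behind the upper bound for the
  embedding.\<close>

lemma norm_le_weak_deriv01:
  assumes N: "N \<ge> 1" and u: "u \<in> sobolev01 k"
    and z: "\<And>j m. j < k \<Longrightarrow> m < N \<Longrightarrow> inner (weak_deriv01 j u) (cell_class N m) = 0"
  shows "(norm u)\<^sup>2 \<le> ((1 / real N)\<^sup>2) ^ k * (norm (weak_deriv01 k u))\<^sup>2"
proof -
  have "(norm u)\<^sup>2 \<le> ((1 / real N)\<^sup>2) ^ j * (norm (weak_deriv01 j u))\<^sup>2" if "j \<le> k" for j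
    using that
  proof (induction j)
    case 0
    then show ?case by (simp add: weak_deriv01_0)
  next
    case (Suc j)
    have "(norm (weak_deriv01 j u))\<^sup>2 \<le> (1 / real N)\<^sup>2 * (norm (weak_deriv01 (Suc j) u))\<^sup>2"
      using Poincare [OF N weak_deriv01_Suc [OF u Suc.prems]] z Suc.prems by simp
    then have "((1 / real N)\<^sup>2) ^ j * (norm (weak_deriv01 j u))\<^sup>2
        \<le> ((1 / real N)\<^sup>2) ^ j * ((1 / real N)\<^sup>2 * (norm (weak_deriv01 (Suc j) u))\<^sup>2)"
      by (intro mult_left_mono) auto
    with Suc show ?case by (simp add: mult_ac)
  qed
  then show ?thesis by blast
qed

text \<open>All derivatives converge in \<open>L2\<close>, and the weak derivative relation is
  closed, being a family of continuous linear identities indexed by test functions.\<close>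

lemma sobolev01_complete:
  assumes X: "\<And>n. X n \<in> sobolev01 k"
    and Cauchy: "\<And>e. e > 0 \<Longrightarrow> \<exists>N. \<forall>m\<ge>N. \<forall>n\<ge>N. sobolev01_inner k (X m - X n) (X m - X n) < e"
  shows "\<exists>x\<in>sobolev01 k. (\<lambda>n. sobolev01_inner k (X n - x) (X n - x)) \<longlonglongrightarrow> 0"
proof -
  define Y where "Y j n = weak_deriv01 j (X n)" for j n
  have "\<exists>y. Y j \<longlonglongrightarrow> y" if j: "j \<le> k" for j
  proof (rule L2_Cauchy_convergent, unfold Cauchy_def, intro allI impI)
    fix e :: real assume "e > 0"
    then obtain N where N: "\<forall>m\<ge>N. \<forall>n\<ge>N. sobolev01_inner k (X m - X n) (X m - X n) < e\<^sup>2"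
      using Cauchy [of "e\<^sup>2"] by auto
    have "dist (Y j m) (Y j n) < e" if "m \<ge> N" "n \<ge> N" for m n
    proof -
      have "(norm (Y j m - Y j n))\<^sup>2 = inner (weak_deriv01 j (X m - X n)) (weak_deriv01 j (X m - X n))"
        by (simp add: Y_def weak_deriv01_diff [OF X X j] power2_norm_eq_inner)
      also have "\<dots> \<le> sobolev01_inner k (X m - X n) (X m - X n)"
        unfolding sobolev01_inner_def using j by (intro member_le_sum) auto
      also have "\<dots> < e\<^sup>2" using N that by blast
      finally show ?thesis using \<open>e > 0\<close> by (simp add: dist_norm power2_less_imp_less)
    qed
    then show "\<exists>M. \<forall>m\<ge>M. \<forall>n\<ge>M. dist (Y j m) (Y j n) < e" by blast
  qed
  then obtain y where y: "\<And>j. j \<le> k \<Longrightarrow> Y j \<longlonglongrightarrow> y j" by metis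
  have w: "has_weak_deriv01 j (y 0) (y j)" if j: "j \<le> k" for j
    unfolding has_weak_deriv01_iff
  proof (intro allI impI)
    fix \<phi> assume \<phi>: "test_function01 \<phi>"
    have 1: "inner (Y 0 n) (L2_class ((deriv ^^ j) \<phi>)) = (-1) ^ j * inner (Y j n) (L2_class \<phi>)" for n
      using sobolev01_has_weak_deriv [OF X j, of n] \<phi> by (simp add: has_weak_deriv01_iff Y_def weak_deriv01_0)
    have 2: "(\<lambda>n. inner (Y 0 n) (L2_class ((deriv ^^ j) \<phi>))) \<longlonglongrightarrow> inner (y 0) (L2_class ((deriv ^^ j) \<phi>))"
      by (intro tendsto_inner tendsto_const y) simp
    have 3: "(\<lambda>n. (-1) ^ j * inner (Y j n) (L2_class \<phi>)) \<longlonglongrightarrow> (-1) ^ j * inner (y j) (L2_class \<phi>)"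
      by (intro tendsto_mult tendsto_inner tendsto_const y j)
    show "inner (y 0) (L2_class ((deriv ^^ j) \<phi>)) = (-1) ^ j * inner (y j) (L2_class \<phi>)"
      by (rule LIMSEQ_unique [OF 2 [unfolded 1] 3])
  qed
  then have yV: "y 0 \<in> sobolev01 k" unfolding sobolev01_def by blast
  have "sobolev01_inner k (X n - y 0) (X n - y 0) = (\<Sum>j\<le>k. inner (Y j n - y j) (Y j n - y j))" for n
    unfolding sobolev01_inner_def Y_def
    by (intro sum.cong refl) (simp add: weak_deriv01_diff [OF X yV] weak_deriv01_eq [OF w])
  moreover have "(\<lambda>n. \<Sum>j\<le>k. inner (Y j n - y j) (Y j n - y j)) \<longlonglongrightarrow> (\<Sum>j\<le>k. inner (y j - y j) (y j - y j))"
    by (intro tendsto_sum tendsto_inner tendsto_diff tendsto_const y) auto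
  ultimately have "(\<lambda>n. sobolev01_inner k (X n - y 0) (X n - y 0)) \<longlonglongrightarrow> 0" by simp
  with yV show ?thesis by blast
qed

section \<open>Smooth functions and cosines as elements of the Sobolev spaces\<close>

lemma smooth_continuous:
  assumes "\<And>n t. (U n has_real_derivative U (Suc n) t) (at t)"
  shows "continuous_on UNIV (U n)"
  using assms by (intro DERIV_continuous_on [of _ _ "U (Suc n)"]) (auto intro: has_field_derivative_at_within)

text \<open>\<open>U\<close> lists successive classical derivatives, so the induction can pass from
  \<open>U m\<close> to \<open>U (Suc m)\<close>. Integration by parts leaves no boundary terms,
  since test functions vanish at 0 and 1.\<close>

lemma smooth_has_weak_deriv01:
  assumes U: "\<And>n t. (U n has_real_derivative U (Suc n) t) (at t)"
  shows "has_weak_deriv01 j (L2_class (U m)) (L2_class (U (m + j)))"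
proof (induction j arbitrary: m)
  case (Suc j)
  note sq = square_integrable01_continuous [OF smooth_continuous [of U, OF U]]
  show ?case unfolding has_weak_deriv01_iff
  proof (intro allI impI)
    fix \<phi> assume \<phi>: "test_function01 \<phi>"
    define \<psi> where "\<psi> = (deriv ^^ j) \<phi>"
    have \<psi>: "test_function01 \<psi>" unfolding \<psi>_def by (rule test_function01_deriv [OF \<phi>])
    have D: "(\<psi> has_real_derivative deriv \<psi> t) (at t)" for t
      using test_function01_has_derivative [OF \<psi>, of 0] by simp
    have c: "continuous_on UNIV (\<lambda>t. U m t * deriv \<psi> t)" "continuous_on UNIV (\<lambda>t. U (Suc m) t * \<psi> t)"
      using test_function01_continuous [OF \<psi>, of 0] test_function01_continuous [OF \<psi>, of 1]
        smooth_continuous [of U, OF U]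
      by (auto intro: continuous_on_mult)
    have "((\<lambda>t. U m t * deriv \<psi> t + U (Suc m) t * \<psi> t) has_integral (U m 1 * \<psi> 1 - U m 0 * \<psi> 0)) {0..1}"
    proof (rule fundamental_theorem_of_calculus)
      fix t
      have "((\<lambda>t. U m t * \<psi> t) has_real_derivative U m t * deriv \<psi> t + U (Suc m) t * \<psi> t) (at t)"
        using DERIV_mult [OF U [of m t] D [of t]] by (simp add: mult_ac add_ac)
      then show "((\<lambda>t. U m t * \<psi> t) has_vector_derivative U m t * deriv \<psi> t + U (Suc m) t * \<psi> t) (at t within {0..1})"
        by (simp add: has_real_derivative_iff_has_vector_derivative [symmetric] has_field_derivative_at_within)
    qed simp
    moreover have "\<psi> 1 = 0" "\<psi> 0 = 0" using \<psi> by (force simp: test_function01_def)+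
    ultimately have "integral {0..1} (\<lambda>t. U m t * deriv \<psi> t + U (Suc m) t * \<psi> t) = 0"
      by (simp add: integral_unique)
    then have "(LINT t|lebesgue01. U m t * deriv \<psi> t + U (Suc m) t * \<psi> t) = 0"
      using c by (subst integral_lebesgue01_continuous) (auto intro!: continuous_intros)
    then have "inner (L2_class (U m)) (L2_class (deriv \<psi>)) = - inner (L2_class (U (Suc m))) (L2_class \<psi>)"
      using c sq test_function01_square_integrable [OF \<psi>, of 1] test_function01_square_integrable_0 [OF \<psi>]
      by (simp add: inner_L2_class integral_lebesgue01_continuous(2))
    moreover have "inner (L2_class (U (Suc m))) (L2_class \<psi>) = (-1) ^ j * inner (L2_class (U (Suc m + j))) (L2_class \<phi>)"
      using Suc.IH [of "Suc m"] \<phi> by (simp add: has_weak_deriv01_iff \<psi>_def)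
    ultimately show "inner (L2_class (U m)) (L2_class ((deriv ^^ Suc j) \<phi>)) =
        (-1) ^ Suc j * inner (L2_class (U (m + Suc j))) (L2_class \<phi>)"
      by (simp add: \<psi>_def)
  qed
qed (simp add: has_weak_deriv01_iff)

lemma smooth_sobolev01:
  assumes U: "\<And>n t. (U n has_real_derivative U (Suc n) t) (at t)"
  shows "L2_class (U 0) \<in> sobolev01 k" "weak_deriv01 j (L2_class (U 0)) = L2_class (U j)"
  using smooth_has_weak_deriv01 [of U _ 0, OF U] weak_deriv01_eq unfolding sobolev01_def by auto

text \<open>The phase \<open>pi * q\<close> accommodates \<open>pi * j\<close>, the sum of the
  phases \<open>pi * (j / 2)\<close> of two members of \<open>cos_family\<close>.\<close>

lemma cos_integral_01:
  assumes "p \<noteq> 0"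
  shows "((\<lambda>t. cos (pi * of_int p * t + pi * of_int q)) has_integral 0) {0..1}"
proof -
  define F where "F t = sin (pi * of_int p * t + pi * of_int q) / (pi * of_int p)" for t :: real
  have "((\<lambda>t. cos (pi * of_int p * t + pi * of_int q)) has_integral (F 1 - F 0)) {0..1}"
  proof (rule fundamental_theorem_of_calculus)
    fix t :: real
    have "(F has_real_derivative cos (pi * of_int p * t + pi * of_int q)) (at t)"
      unfolding F_def using assms by (auto intro!: derivative_eq_intros)
    then show "(F has_vector_derivative cos (pi * of_int p * t + pi * of_int q)) (at t within {0..1})"
      by (simp add: has_real_derivative_iff_has_vector_derivative [symmetric] has_field_derivative_at_within)
  qed simp
  moreover have "sin (pi * real_of_int r) = 0" for r
    by (auto simp: sin_zero_iff_int2 mult.commute)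
  from this [of "p + q"] this [of q]
  have "sin (pi * real_of_int p + pi * real_of_int q) = 0" "sin (pi * real_of_int q) = 0"
    by (simp_all add: distrib_left)
  ultimately show ?thesis by (simp add: F_def)
qed

text \<open>The \<open>j\<close>-th derivative of \<open>cos (pi * l * t)\<close>: each
  differentiation advances the phase by a quarter period, which treats even and odd orders
  alike.\<close>

definition cos_family :: "nat \<Rightarrow> nat \<Rightarrow> real \<Rightarrow> real"
  where "cos_family l j t = (pi * real l) ^ j * cos (pi * real l * t + pi * (real j / 2))"

lemma cos_family_derivative: "(cos_family l j has_real_derivative cos_family l (Suc j) t) (at t)"
proof -
  have "cos (pi * real l * t + pi * (real (Suc j) / 2)) = - sin (pi * real l * t + pi * (real j / 2))"
    using minus_sin_cos_eq [of "pi * real l * t + pi * (real j / 2)"] by (simp add: add_divide_distrib algebra_simps)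
  then show ?thesis
    unfolding cos_family_def by (auto intro!: derivative_eq_intros)
qed

lemma cos_family_inner:
  assumes "l \<ge> 1" "m \<ge> 1"
  shows "inner (L2_class (cos_family l j)) (L2_class (cos_family m j)) = (if l = m then (pi * real l) ^ (2 * j) / 2 else 0)"
proof -
  have c: "continuous_on UNIV (cos_family l j)" for l
    by (rule smooth_continuous) (rule cos_family_derivative)
  let ?f = "\<lambda>t. cos (pi * of_int (int l - int m) * t + pi * of_int 0)"
  let ?g = "\<lambda>t. cos (pi * of_int (int l + int m) * t + pi * of_int (int j))"
  have e: "cos_family l j t * cos_family m j t = (pi * real l) ^ j * (pi * real m) ^ j / 2 * (?f t + ?g t)" for t
    by (simp add: cos_family_def cos_times_cos algebra_simps)
  have "inner (L2_class (cos_family l j)) (L2_class (cos_family m j)) = integral {0..1} (\<lambda>t. cos_family l j t * cos_family m j t)"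
    using c by (simp add: inner_L2_class square_integrable01_continuous integral_lebesgue01_continuous continuous_on_mult)
  also have "\<dots> = (if l = m then (pi * real l) ^ (2 * j) / 2 else 0)"
  proof (rule integral_unique)
    have g: "(?g has_integral 0) {0..1}" using assms by (intro cos_integral_01) auto
    have f: "(?f has_integral (if l = m then 1 else 0)) {0..1}"
    proof (cases "l = m")
      case True
      then show ?thesis using has_integral_const_real [of "1::real" 0 1] by simp
    next
      case False
      then show ?thesis using cos_integral_01 [of "int l - int m" 0] by simp
    qed
    show "((\<lambda>t. cos_family l j t * cos_family m j t) has_integral (if l = m then (pi * real l) ^ (2 * j) / 2 else 0)) {0..1}"
    proof -
      have "(pi * real l) ^ j * (pi * real m) ^ j / 2 * ((if l = m then 1 else 0) + 0)
          = (if l = m then (pi * real l) ^ (2 * j) / 2 else 0)"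
        by (simp add: mult_2 power_add)
      with has_integral_mult_right [OF has_integral_add [OF f g], of "(pi * real l) ^ j * (pi * real m) ^ j / 2"]
      show ?thesis unfolding e by (simp only:)
    qed
  qed
  finally show ?thesis .
qed

text \<open>Test functions for the embedding: the derivatives of the cosines are orthogonal as well.\<close>
lemma cos_family_sobolev01:
  fixes n :: nat
  assumes "x = (\<Sum>l\<le>n. c l *\<^sub>R L2_class (cos_family (Suc l) 0))"
  shows "sobolev01_inner k x x \<le> real (Suc k) * (pi * real (Suc n)) ^ (2 * k) * inner x x"
    "inner x x = (\<Sum>l\<le>n. (c l)\<^sup>2 / 2)"
proof -
  have sq: "square_integrable01 (cos_family l j)" for l j
    by (rule square_integrable01_continuous, rule smooth_continuous) (rule cos_family_derivative)
  define U where "U j t = (\<Sum>l\<le>n. c l * cos_family (Suc l) j t)" for j t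
  have U: "(U j has_real_derivative U (Suc j) t) (at t)" for j t
    unfolding U_def by (intro DERIV_sum DERIV_cmult cos_family_derivative)
  have UL: "L2_class (U j) = (\<Sum>l\<le>n. c l *\<^sub>R L2_class (cos_family (Suc l) j))" for j
    unfolding U_def using sq by (simp add: sum_L2_class)
  have x: "x = L2_class (U 0)" by (simp add: assms UL)
  have norm: "inner (L2_class (U j)) (L2_class (U j)) = (\<Sum>l\<le>n. (c l)\<^sup>2 * ((pi * real (Suc l)) ^ (2 * j) / 2))" for j
  proof -
    have "inner (L2_class (U j)) (L2_class (U j)) = (\<Sum>l\<le>n. c l * (\<Sum>m\<le>n. c m * (if m = l then (pi * real (Suc l)) ^ (2 * j) / 2 else 0)))"
      unfolding UL inner_sum_left inner_sum_right
      by (intro sum.cong refl) (auto simp: cos_family_inner sum_distrib_left intro!: sum.cong)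
    also have "\<dots> = (\<Sum>l\<le>n. (c l)\<^sup>2 * ((pi * real (Suc l)) ^ (2 * j) / 2))"
      by (intro sum.cong refl) (simp add: power2_eq_square if_distrib cong: if_cong)
    finally show ?thesis .
  qed
  show xx: "inner x x = (\<Sum>l\<le>n. (c l)\<^sup>2 / 2)" using norm [of 0] by (simp add: x)
  have "sobolev01_inner k x x = (\<Sum>j\<le>k. inner (L2_class (U j)) (L2_class (U j)))"
    unfolding sobolev01_inner_def x using smooth_sobolev01(2) [of U, OF U] by simp
  also have "\<dots> \<le> (\<Sum>j\<le>k. (pi * real (Suc n)) ^ (2 * k) * inner x x)"
  proof (rule sum_mono)
    fix j assume j: "j \<in> {..k}"
    have "inner (L2_class (U j)) (L2_class (U j)) \<le> (\<Sum>l\<le>n. (c l)\<^sup>2 * ((pi * real (Suc n)) ^ (2 * k) / 2))"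
      unfolding norm
    proof (intro sum_mono mult_left_mono divide_right_mono)
      fix l assume l: "l \<in> {..n}"
      \<comment> \<open>A base of at least 1 allows the exponent \<open>2 * j\<close> to be raised
        to \<open>2 * k\<close>.\<close>
      have "1 \<le> pi * real (Suc n)" using pi_gt3 mult_mono [of 1 pi 1 "real (Suc n)"] by simp
      have "(pi * real (Suc l)) ^ (2 * j) \<le> (pi * real (Suc n)) ^ (2 * j)"
        using l by (intro power_mono mult_left_mono) auto
      also have "\<dots> \<le> (pi * real (Suc n)) ^ (2 * k)"
        using j \<open>1 \<le> pi * real (Suc n)\<close> by (intro power_increasing) auto
      finally show "(pi * real (Suc l)) ^ (2 * j) \<le> (pi * real (Suc n)) ^ (2 * k)" .
    qed auto
    also have "\<dots> = (pi * real (Suc n)) ^ (2 * k) * inner x x"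
      by (simp add: xx sum_distrib_left mult_ac)
    finally show "inner (L2_class (U j)) (L2_class (U j)) \<le> (pi * real (Suc n)) ^ (2 * k) * inner x x" .
  qed
  finally show "sobolev01_inner k x x \<le> real (Suc k) * (pi * real (Suc n)) ^ (2 * k) * inner x x" by simp
qed

section \<open>The norm of the Hausdorff moment operator\<close>

text \<open>The kernel \<open>1 / ((x + a) sqrt x)\<close> is logarithmically convex, so its value at the midpoint of
  \<open>[j, j + 1]\<close> is at most its integral over that interval.\<close>
lemma hilbert_row_sum_sharp:
  "(\<Sum>j<N. 1 / ((real i + real j + 1) * sqrt (real j + 1/2))) \<le> pi / sqrt (real i + 1/2)"
proof -
  define a where "a = real i + 1/2"
  have a: "a > 0" by (simp add: a_def)
  define b where "b = sqrt a"
  have b: "b > 0" "b\<^sup>2 = a" using a by (auto simp: b_def)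
  \<comment> \<open>Antiderivative of the kernel \<open>h\<close>; its total increase
    \<open>pi / b\<close> on the half-line is the right-hand side of the claim.\<close>
  define f where "f x = 2 / b * arctan (sqrt x / b)" for x
  define h where "h x = 1 / ((x + a) * sqrt x)" for x
  have der: "(f has_real_derivative h x) (at x)" if "x > 0" for x
  proof -
    have "(f has_real_derivative
        2 / b * (1 / (1 + (sqrt x / b)\<^sup>2) * (1 / (2 * sqrt x * b)))) (at x)"
      unfolding f_def using that b(1)
      by (auto intro!: derivative_eq_intros simp: inverse_eq_divide)
    moreover have "2 / b * (1 / (1 + (sqrt x / b)\<^sup>2) * (1 / (2 * sqrt x * b)))
        = 1 / ((b\<^sup>2 * (1 + (sqrt x / b)\<^sup>2)) * sqrt x)"
      by (simp add: power2_eq_square)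
    moreover have "b\<^sup>2 * (1 + (sqrt x / b)\<^sup>2) = x + a"
      using that a b by (simp add: power_divide distrib_left)
    ultimately show ?thesis by (simp only: h_def)
  qed
  \<comment> \<open>Logarithmic convexity, \<open>(h m)\<^sup>2 \<le> h (m + s) * h (m - s)\<close>,
    followed by the inequality of arithmetic and geometric means.\<close>
  have convex: "2 * h m \<le> h (m + s) + h (m - s)" if "0 \<le> s" "s < m" for m s
  proof -
    have pos: "h (m + s) > 0" "h (m - s) > 0" "h m > 0" using that a by (auto simp: h_def)
    have "(m + s + a) * (m - s + a) \<le> (m + a)\<^sup>2" by (simp add: power2_eq_square algebra_simps)
    moreover have "sqrt (m + s) * sqrt (m - s) \<le> sqrt m * sqrt m"
      unfolding real_sqrt_mult [symmetric] by (intro real_sqrt_le_mono) (simp add: algebra_simps)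
    ultimately have "((m + s + a) * (m - s + a)) * (sqrt (m + s) * sqrt (m - s)) \<le> (m + a)\<^sup>2 * (sqrt m * sqrt m)"
      by (rule mult_mono) (use that a in auto)
    then have "1 / ((m + a)\<^sup>2 * (sqrt m * sqrt m)) \<le> 1 / (((m + s + a) * (m - s + a)) * (sqrt (m + s) * sqrt (m - s)))"
      using that a by (intro divide_left_mono) auto
    moreover have "(h m)\<^sup>2 = 1 / ((m + a)\<^sup>2 * (sqrt m * sqrt m))"
      by (simp only: h_def power_divide power_mult_distrib power_one power2_eq_square [of "sqrt m"])
    moreover have "h (m + s) * h (m - s) = 1 / (((m + s + a) * (m - s + a)) * (sqrt (m + s) * sqrt (m - s)))"
      by (simp only: h_def times_divide_times_eq mult_1_left) (simp only: mult_ac)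
    ultimately have "(h m)\<^sup>2 \<le> h (m + s) * h (m - s)" by simp
    also have "4 * (h (m + s) * h (m - s)) \<le> (h (m + s) + h (m - s))\<^sup>2"
      using zero_le_power2 [of "h (m + s) - h (m - s)"] by (simp add: power2_eq_square algebra_simps)
    finally have "(2 * h m)\<^sup>2 \<le> (h (m + s) + h (m - s))\<^sup>2" by (simp add: power2_eq_square)
    then show ?thesis by (rule power2_le_imp_le) (use pos in auto)
  qed
  have step: "h (real j + 1/2) \<le> f (real (Suc j)) - f (real j)" for j
  proof -
    define m where "m = real j + 1/2"
    \<comment> \<open>The integral of \<open>h\<close> over \<open>[m - s, m + s]\<close> minus its
      midpoint approximation. It is 0 at \<open>s = 0\<close> and increases by
      \<open>convex\<close>; the value at \<open>s = 1/2\<close> gives the claim.\<close>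
    define \<phi> where "\<phi> s = f (m + s) - f (m - s) - 2 * s * h m" for s
    have D: "(\<phi> has_real_derivative h (m + s) + h (m - s) - 2 * h m) (at s)" if "0 < s" "s < 1/2" for s
    proof -
      have "((\<lambda>s. f (m + s)) has_real_derivative h (m + s) * 1) (at s)"
        by (rule DERIV_chain2 [OF der]) (use that in \<open>auto simp: m_def intro!: derivative_eq_intros\<close>)
      moreover have "((\<lambda>s. f (m - s)) has_real_derivative h (m - s) * (- 1)) (at s)"
        by (rule DERIV_chain2 [OF der]) (use that in \<open>auto simp: m_def intro!: derivative_eq_intros\<close>)
      ultimately show ?thesis unfolding \<phi>_def by (auto intro!: derivative_eq_intros)
    qed
    have "continuous_on {0..1/2} \<phi>"
      unfolding \<phi>_def f_def using b by (intro continuous_intros) auto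
    \<comment> \<open>Derivatives are used only in the open interval: for \<open>j = 0\<close> the
      kernel is singular at \<open>m - 1/2 = 0\<close>, where \<open>f\<close> is still
      continuous.\<close>
    then have "\<phi> 0 \<le> \<phi> (1/2)"
    proof (rule DERIV_nonneg_imp_increasing_open [rotated -1])
      fix s :: real assume s: "0 < s" "s < 1/2"
      then have "s < m" by (simp add: m_def)
      with D [OF s] convex [of s m] s show "\<exists>y. (\<phi> has_real_derivative y) (at s) \<and> 0 \<le> y" by force
    qed simp
    then show ?thesis by (simp add: \<phi>_def m_def add.commute)
  qed
  have "(\<Sum>j<N. 1 / ((real i + real j + 1) * sqrt (real j + 1/2)))
      \<le> (\<Sum>j<N. f (real (Suc j)) - f (real j))"
  proof (rule sum_mono)
    fix j
    have "1 / ((real i + real j + 1) * sqrt (real j + 1/2)) = h (real j + 1/2)"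
      by (simp add: h_def a_def add_ac)
    then show "1 / ((real i + real j + 1) * sqrt (real j + 1/2)) \<le> f (real (Suc j)) - f (real j)"
      using step by simp
  qed
  also have "\<dots> = f (real N) - f 0"
    using sum_lessThan_telescope [of "\<lambda>j. f (real j)" N] by (simp only: of_nat_0)
  also have "\<dots> = 2 / b * arctan (sqrt (real N) / b)"
    by (simp add: f_def)
  also have "\<dots> \<le> 2 / b * (pi / 2)"
    using b by (intro mult_left_mono less_imp_le [OF arctan_ubound]) auto
  finally show ?thesis
    by (simp add: a_def b_def)
qed

text \<open>Schur test with the weights \<open>sqrt (i + 1/2)\<close>, for which the weighted row
  sums of the symmetric kernel are at most \<open>pi\<close>.\<close>

lemma hilbert_inequality_sharp:
  "(\<Sum>i<N. \<Sum>j<N. x i * x j / (real i + real j + 1)) \<le> pi * (\<Sum>i<N. (x i)\<^sup>2)"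
proof -
  define w where "w i = sqrt (real i + 1/2)" for i :: nat
  define K where "K i j = (x i)\<^sup>2 * w i / ((real i + real j + 1) * w j)" for i j
  have w: "w i > 0" for i by (simp add: w_def)
  have "x i * x j / (real i + real j + 1) \<le> (K i j + K j i) / 2" for i j
  proof -
    define r where "r = sqrt (w i / w j)"
    have r: "r > 0" "r\<^sup>2 = w i / w j" using w [of i] w [of j] by (auto simp: r_def)
    have "0 \<le> (x i * r - x j / r)\<^sup>2" by simp
    also have "\<dots> = (x i)\<^sup>2 * r\<^sup>2 + (x j)\<^sup>2 / r\<^sup>2 - 2 * (x i * x j)"
      using r(1) by (simp add: power2_diff power_mult_distrib power_divide)
    finally have "x i * x j \<le> ((x i)\<^sup>2 * (w i / w j) + (x j)\<^sup>2 * (w j / w i)) / 2"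
      unfolding r(2) by simp
    then have "x i * x j / (real i + real j + 1)
        \<le> ((x i)\<^sup>2 * (w i / w j) + (x j)\<^sup>2 * (w j / w i)) / 2 / (real i + real j + 1)"
      by (intro divide_right_mono) auto
    also have "\<dots> = (K i j + K j i) / 2"
      by (simp add: K_def add_divide_distrib add_ac mult_ac)
    finally show ?thesis .
  qed
  then have "(\<Sum>i<N. \<Sum>j<N. x i * x j / (real i + real j + 1)) \<le> (\<Sum>i<N. \<Sum>j<N. (K i j + K j i) / 2)"
    by (intro sum_mono)
  also have "\<dots> = ((\<Sum>i<N. \<Sum>j<N. K i j) + (\<Sum>i<N. \<Sum>j<N. K j i)) / 2"
    by (simp add: sum.distrib flip: sum_divide_distrib)
  also have "(\<Sum>i<N. \<Sum>j<N. K j i) = (\<Sum>i<N. \<Sum>j<N. K i j)"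
    by (rule sum.swap)
  also have "((\<Sum>i<N. \<Sum>j<N. K i j) + (\<Sum>i<N. \<Sum>j<N. K i j)) / 2 = (\<Sum>i<N. \<Sum>j<N. K i j)"
    by simp
  also have "(\<Sum>i<N. \<Sum>j<N. K i j)
      = (\<Sum>i<N. (x i)\<^sup>2 * w i * (\<Sum>j<N. 1 / ((real i + real j + 1) * w j)))"
    by (simp add: K_def sum_distrib_left)
  also have "\<dots> \<le> (\<Sum>i<N. (x i)\<^sup>2 * w i * (pi / w i))"
    using w less_imp_le by (intro sum_mono mult_left_mono) (auto simp: w_def hilbert_row_sum_sharp)
  also have "\<dots> = pi * (\<Sum>i<N. (x i)\<^sup>2)"
    using w by (simp add: sum_distrib_left less_imp_neq [symmetric] mult_ac)
  finally show ?thesis .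
qed

lemma hausdorff_moment_nth:
  "Rep_ell2 (hausdorff_moment z) n = inner (L2_class (\<lambda>t. t ^ n)) z"
proof -
  obtain f where "square_integrable01 f" "z = L2_class f" by (rule L2_cases)
  then have "inner (L2_class (\<lambda>t. t ^ n)) z = inner (L2_class (\<lambda>t. t ^ n)) (L2_class (rep_L2 z))" by simp
  also have "\<dots> = (LINT t|lebesgue01. t ^ n * rep_L2 z t)"
    by (rule inner_L2_class) (simp_all add: square_integrable01_power)
  finally show ?thesis by (simp add: hausdorff_moment.rep_eq)
qed

lemma ell2_norm: "(norm x)\<^sup>2 = (\<Sum>n. (Rep_ell2 x n)\<^sup>2)" "summable (\<lambda>n. (Rep_ell2 x n)\<^sup>2)"
  using Rep_ell2 [of x] by (simp_all add: power2_norm_eq_inner inner_ell2.rep_eq) (simp add: power2_eq_square)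

text \<open>Duality: \<open>z\<close> is tested against the polynomial \<open>P\<close> that has its
  first \<open>N\<close> moments as coefficients. The Gram matrix of the monomials is the Hilbert
  matrix, so \<open>S * S \<le> pi * S * (norm z)\<^sup>2\<close>, and \<open>S\<close>
  cancels.\<close>

lemma norm_hausdorff_moment_le: "(norm (hausdorff_moment z))\<^sup>2 \<le> pi * (norm z)\<^sup>2"
proof -
  define m where "m n = inner (L2_class (\<lambda>t. t ^ n)) z" for n
  have m: "Rep_ell2 (hausdorff_moment z) n = m n" for n by (simp add: m_def hausdorff_moment_nth)
  have "(\<Sum>n<N. (m n)\<^sup>2) \<le> pi * (norm z)\<^sup>2" for N
  proof -
    define S where "S = (\<Sum>n<N. (m n)\<^sup>2)"
    define P where "P = (\<Sum>n<N. m n *\<^sub>R L2_class (\<lambda>t. t ^ n))"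
    have g: "inner (L2_class (\<lambda>t. t ^ i)) (L2_class (\<lambda>t. t ^ j)) = 1 / (real i + real j + 1)" for i j
      by (simp add: inner_L2_class square_integrable01_power integral01_power flip: power_add)
    have "S = inner P z" by (simp add: S_def P_def inner_sum_left power2_eq_square flip: m_def)
    have "inner P P = (\<Sum>i<N. \<Sum>j<N. m i * m j / (real i + real j + 1))"
      by (simp add: P_def inner_sum_left inner_sum_right g sum_distrib_left mult.commute)
        (intro sum.cong, auto simp: mult_ac add_ac)
    also have "\<dots> \<le> pi * S" unfolding S_def by (rule hilbert_inequality_sharp)
    finally have PP: "inner P P \<le> pi * S" .
    have "S * S \<le> inner P P * inner z z"
      using Cauchy_Schwarz_ineq [of P z] by (simp add: \<open>S = inner P z\<close> power2_eq_square)
    also have "\<dots> \<le> pi * S * inner z z" using PP by (intro mult_right_mono) auto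
    finally have "S * S \<le> S * (pi * inner z z)" by (simp add: mult_ac)
    moreover have "S \<ge> 0" unfolding S_def by (intro sum_nonneg) auto
    ultimately have "S \<le> pi * inner z z" by (cases "S = 0") auto
    then show ?thesis by (simp add: S_def power2_norm_eq_inner)
  qed
  then show ?thesis
    using ell2_norm [of "hausdorff_moment z"] by (simp add: m suminf_le_const)
qed

section \<open>Chebyshev polynomials and moments\<close>

text \<open>Chebyshev polynomials of the second kind, transplanted from \<open>[-1, 1]\<close> to \<open>[0, 1]\<close>.\<close>
fun chebyshev01 :: "nat \<Rightarrow> real poly" where
  "chebyshev01 0 = 1"
| "chebyshev01 (Suc 0) = [:2, -4:]"
| "chebyshev01 (Suc (Suc n)) = [:2, -4:] * chebyshev01 (Suc n) - chebyshev01 n"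

text \<open>At \<open>t = (1 - cos s) / 2\<close> the factor \<open>[:2, -4:]\<close> becomes
  \<open>2 * cos s\<close>, and the recursion turns into the addition formulas for
  \<open>sin\<close>.\<close>

lemma chebyshev01_trig: "poly (chebyshev01 n) ((1 - cos s) / 2) * sin s = sin (real (Suc n) * s)"
proof (induction n rule: chebyshev01.induct)
  case 2
  show ?case using sin_double [of s] by (simp add: field_simps)
next
  case (3 n)
  have "poly (chebyshev01 (Suc (Suc n))) ((1 - cos s) / 2) * sin s
      = 2 * cos s * (poly (chebyshev01 (Suc n)) ((1 - cos s) / 2) * sin s) - poly (chebyshev01 n) ((1 - cos s) / 2) * sin s"
  proof -
    have l: "poly [:2, -4:] ((1 - cos s) / 2) = 2 * cos s" by (simp add: field_simps)
    show ?thesis by (simp only: chebyshev01.simps poly_diff poly_mult l) (simp add: algebra_simps)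
  qed
  also have "\<dots> = 2 * cos s * sin (real (Suc (Suc n)) * s) - sin (real (Suc n) * s)"
    by (simp only: 3)
  also have "\<dots> = sin (real (Suc (Suc (Suc n))) * s)"
  proof -
    have "real (Suc (Suc (Suc n))) * s = real (Suc (Suc n)) * s + s" "real (Suc n) * s = real (Suc (Suc n)) * s - s"
      by (simp_all add: algebra_simps)
    then show ?thesis by (simp only: sin_add sin_diff) (simp add: algebra_simps)
  qed
  finally show ?case .
qed simp

text \<open>The base 7 is \<open>2 + 4 + 1\<close>, the total size of the coefficients in the
  recursion.\<close>

lemma coeff_chebyshev01_bound: "\<bar>coeff (chebyshev01 n) i\<bar> \<le> 7 ^ n"
proof (induction n arbitrary: i rule: chebyshev01.induct)
  case 2
  show ?case by (cases i) (auto simp: coeff_pCons split: nat.split)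
next
  case (3 n)
  have "coeff (chebyshev01 (Suc (Suc n))) i = 2 * coeff (chebyshev01 (Suc n)) i
      - 4 * (case i of 0 \<Rightarrow> 0 | Suc j \<Rightarrow> coeff (chebyshev01 (Suc n)) j) - coeff (chebyshev01 n) i"
    by (cases i) (auto simp: coeff_pCons)
  moreover have "\<bar>case i of 0 \<Rightarrow> 0 | Suc j \<Rightarrow> coeff (chebyshev01 (Suc n)) j\<bar> \<le> 7 ^ Suc n"
    using 3(1) by (cases i) auto
  ultimately show ?case using 3(1) [of i] 3(2) [of i] by simp
qed (auto simp: coeff_1)

lemma degree_chebyshev01: "degree (chebyshev01 n) \<le> n"
proof (induction n rule: chebyshev01.induct)
  case (3 n)
  have "degree ([:2, -4:] * chebyshev01 (Suc n)) \<le> Suc (Suc n)"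
    by (rule order_trans [OF degree_mult_le]) (use 3 in auto)
  with 3 show ?case by (auto intro!: degree_diff_le)
qed auto

lemma cos_integral_pi:
  assumes "p \<noteq> 0"
  shows "((\<lambda>t. cos (of_int p * t)) has_integral 0) {0..pi}"
proof -
  define F where "F t = sin (of_int p * t) / of_int p" for t :: real
  have "((\<lambda>t. cos (of_int p * t)) has_integral (F pi - F 0)) {0..pi}"
  proof (rule fundamental_theorem_of_calculus)
    fix t :: real
    have "(F has_real_derivative cos (of_int p * t)) (at t)"
      unfolding F_def using assms by (auto intro!: derivative_eq_intros)
    then show "(F has_vector_derivative cos (of_int p * t)) (at t within {0..pi})"
      by (simp add: has_real_derivative_iff_has_vector_derivative [symmetric] has_field_derivative_at_within)
  qed simp
  moreover have "sin (real_of_int p * pi) = 0" by (auto simp: sin_zero_iff_int2)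
  ultimately show ?thesis by (simp add: F_def)
qed

lemma sin_orthogonal:
  "((\<lambda>t. sin (real (Suc l) * t) * sin (real (Suc m) * t)) has_integral (if l = m then pi / 2 else 0)) {0..pi}"
proof -
  let ?f = "\<lambda>t. cos (of_int (int l - int m) * t)"
  let ?g = "\<lambda>t. cos (of_int (int l + int m + 2) * t)"
  have e: "sin (real (Suc l) * t) * sin (real (Suc m) * t) = 1 / 2 * (?f t - ?g t)" for t :: real
    by (simp add: sin_times_sin field_simps)
  have g: "(?g has_integral 0) {0..pi}" by (intro cos_integral_pi) auto
  have f: "(?f has_integral (if l = m then pi else 0)) {0..pi}"
  proof (cases "l = m")
    case True
    then show ?thesis using has_integral_const_real [of "1::real" 0 pi] by simp
  next
    case False
    then show ?thesis using cos_integral_pi [of "int l - int m"] by simp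
  qed
  have "1 / 2 * ((if l = m then pi else 0) - 0) = (if l = m then pi / 2 else 0)" by simp
  with has_integral_mult_right [OF has_integral_diff [OF f g], of "1 / 2"]
  show ?thesis unfolding e by (simp only:)
qed

text \<open>Substituting \<open>t = (1 - cos s) / 2\<close> turns the weight \<open>2 sqrt (t (1 - t)) \<le> 1\<close> into \<open>sin s\<close>.\<close>
lemma chebyshev01_norm:
  fixes n :: nat
  defines "p b \<equiv> (\<Sum>m\<le>n. smult (b m) (chebyshev01 m))"
  shows "(\<Sum>m\<le>n. (b m)\<^sup>2) \<le> 2 * (norm (L2_class (poly (p b))))\<^sup>2"
proof -
  define f where "f t = (poly (p b) t)\<^sup>2 * (2 * sqrt (t * (1 - t)))" for t
  define g where "g s = (1 - cos s) / 2" for s :: real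
  have cp: "continuous_on UNIV (poly (p b))" by (intro continuous_intros)
  have A: "((\<lambda>s. (sin s / 2) *\<^sub>R f (g s)) has_integral (integral {g 0..g pi} f)) {0..pi}"
  proof (rule has_integral_substitution [where c = 0 and d = 1])
    show "g ` {0..pi} \<subseteq> {0..1}" by (auto simp: g_def)
    show "continuous_on {0..1} f" unfolding f_def by (intro continuous_intros)
    show "(g has_field_derivative sin s / 2) (at s within {0..pi})" if "s \<in> {0..pi}" for s
      unfolding g_def by (auto intro!: derivative_eq_intros)
  qed (auto simp: g_def)
  have B: "(sin s / 2) *\<^sub>R f (g s) = (\<Sum>l\<le>n. \<Sum>m\<le>n. b l * b m / 2 * (sin (real (Suc l) * s) * sin (real (Suc m) * s)))"
    if s: "s \<in> {0..pi}" for s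
  proof -
    have "sin s \<ge> 0" using s by (intro sin_ge_zero) auto
    have "g s * (1 - g s) = (sin s / 2)\<^sup>2"
      by (simp add: g_def power_divide sin_squared_eq) (simp add: field_simps power2_eq_square)
    then have "2 * sqrt (g s * (1 - g s)) = sin s" using \<open>sin s \<ge> 0\<close> by simp
    \<comment> \<open>One factor \<open>sin s\<close> comes from the Jacobian of the substitution,
      the other from the weight.\<close>
    then have "(sin s / 2) *\<^sub>R f (g s) = (poly (p b) (g s) * sin s)\<^sup>2 / 2"
      by (simp add: f_def power2_eq_square)
    also have "poly (p b) (g s) * sin s = (\<Sum>m\<le>n. b m * sin (real (Suc m) * s))"
      by (simp add: p_def poly_sum sum_distrib_right g_def mult.assoc chebyshev01_trig)
    finally show ?thesis
      by (simp add: power2_eq_square sum_product sum_divide_distrib mult_ac)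
  qed
  have "g 0 = 0" "g pi = 1" by (auto simp: g_def)
  then have I: "((\<lambda>s. \<Sum>l\<le>n. \<Sum>m\<le>n. b l * b m / 2 * (sin (real (Suc l) * s) * sin (real (Suc m) * s)))
      has_integral (integral {0..1} f)) {0..pi}"
    using has_integral_eq [OF B A] by simp
  have "((\<lambda>s. \<Sum>l\<le>n. \<Sum>m\<le>n. b l * b m / 2 * (sin (real (Suc l) * s) * sin (real (Suc m) * s)))
      has_integral (\<Sum>l\<le>n. \<Sum>m\<le>n. b l * b m / 2 * (if l = m then pi / 2 else 0))) {0..pi}"
    by (intro has_integral_sum has_integral_mult_right sin_orthogonal) auto
  with I have "integral {0..1} f = (\<Sum>l\<le>n. \<Sum>m\<le>n. b l * b m / 2 * (if l = m then pi / 2 else 0))"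
    by (rule has_integral_unique)
  also have "\<dots> = pi / 4 * (\<Sum>m\<le>n. (b m)\<^sup>2)"
    by (simp add: sum_distrib_left power2_eq_square if_distrib mult_ac cong: if_cong)
  finally have If: "integral {0..1} f = pi / 4 * (\<Sum>m\<le>n. (b m)\<^sup>2)" .
  have "integral {0..1} f \<le> integral {0..1} (\<lambda>t. (poly (p b) t)\<^sup>2)"
  proof (rule integral_le)
    show "f integrable_on {0..1}" unfolding f_def by (intro integrable_continuous_real continuous_intros)
    show "(\<lambda>t. (poly (p b) t)\<^sup>2) integrable_on {0..1}" by (intro integrable_continuous_real continuous_intros)
    fix t :: real assume "t \<in> {0..1}"
    have "sqrt (t * (1 - t)) \<le> sqrt ((1 / 2)\<^sup>2)"
      using zero_le_power2 [of "t - 1 / 2"] by (intro real_sqrt_le_mono) (simp add: power2_eq_square algebra_simps)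
    then have "2 * sqrt (t * (1 - t)) \<le> 1" by simp
    then show "f t \<le> (poly (p b) t)\<^sup>2" unfolding f_def by (intro mult_left_le) auto
  qed
  also have "\<dots> = (norm (L2_class (poly (p b))))\<^sup>2"
    using cp by (simp add: norm_L2_class square_integrable01_continuous integral_lebesgue01_continuous(1) continuous_on_power)
  finally have "pi / 4 * (\<Sum>m\<le>n. (b m)\<^sup>2) \<le> (norm (L2_class (poly (p b))))\<^sup>2" by (simp add: If)
  moreover have "1 / 2 * (\<Sum>m\<le>n. (b m)\<^sup>2) \<le> pi / 4 * (\<Sum>m\<le>n. (b m)\<^sup>2)"
    using pi_gt3 by (intro mult_right_mono sum_nonneg) auto
  ultimately show ?thesis by simp
qed

section \<open>Norms and moments of polynomials with bounded coefficients\<close>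

lemma coeff_pderiv_funpow_bound:
  fixes q :: "real poly"
  assumes "degree q \<le> n" "\<And>i. \<bar>coeff q i\<bar> \<le> K"
  shows "degree ((pderiv ^^ j) q) \<le> n" "\<bar>coeff ((pderiv ^^ j) q) i\<bar> \<le> real (Suc n) ^ j * K"
proof -
  have *: "degree ((pderiv ^^ j) q) \<le> n \<and> (\<forall>i. \<bar>coeff ((pderiv ^^ j) q) i\<bar> \<le> real (Suc n) ^ j * K)" for j
  proof (induction j)
    case (Suc j)
    define r where "r = (pderiv ^^ j) q"
    have r: "degree r \<le> n" "\<And>i. \<bar>coeff r i\<bar> \<le> real (Suc n) ^ j * K" using Suc by (auto simp: r_def)
    have K: "0 \<le> real (Suc n) ^ j * K" using r(2) [of 0] by simp
    have "\<bar>coeff (pderiv r) i\<bar> \<le> real (Suc n) * (real (Suc n) ^ j * K)" for i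
    proof (cases "Suc i \<le> n")
      case True
      then have "real (Suc i) * \<bar>coeff r (Suc i)\<bar> \<le> real (Suc n) * (real (Suc n) ^ j * K)"
        using r(2) by (intro mult_mono) auto
      then show ?thesis by (simp add: coeff_pderiv abs_mult)
    next
      case False
      then have "coeff r (Suc i) = 0" using r(1) by (intro coeff_eq_0) auto
      then show ?thesis using K by (simp add: coeff_pderiv)
    qed
    moreover have "degree (pderiv r) \<le> n" using r(1) by (simp add: degree_pderiv)
    ultimately show ?case by (simp add: r_def mult_ac)
  qed (use assms in auto)
  from * show "degree ((pderiv ^^ j) q) \<le> n" "\<bar>coeff ((pderiv ^^ j) q) i\<bar> \<le> real (Suc n) ^ j * K" by auto
qed

lemma norm_poly_le:
  assumes "degree q \<le> n" "\<And>i. \<bar>coeff q i\<bar> \<le> K"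
  shows "norm (L2_class (poly q)) \<le> real (Suc n) * K"
proof -
  have c: "continuous_on UNIV (poly q)" by (intro continuous_intros)
  have K: "0 \<le> K" using assms(2) [of 0] by simp
  have b: "\<bar>poly q t\<bar> \<le> real (Suc n) * K" if t: "0 < t" "t < 1" for t
  proof -
    have "poly q t = (\<Sum>i\<le>n. coeff q i * t ^ i)"
      unfolding poly_altdef using assms(1)
      by (intro sum.mono_neutral_left) (auto simp: coeff_eq_0 not_le)
    also have "\<bar>\<dots>\<bar> \<le> (\<Sum>i\<le>n. \<bar>coeff q i * t ^ i\<bar>)" by (rule sum_abs)
    also have "\<dots> \<le> (\<Sum>i\<le>n. K)"
    proof (rule sum_mono)
      fix i
      have "\<bar>coeff q i\<bar> * t ^ i \<le> K * 1"
        using t assms(2) K by (intro mult_mono power_le_one) auto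
      then show "\<bar>coeff q i * t ^ i\<bar> \<le> K" using t by (simp add: abs_mult)
    qed
    finally show ?thesis by simp
  qed
  have "(norm (L2_class (poly q)))\<^sup>2 = (LINT t|lebesgue01. (poly q t)\<^sup>2)"
    by (rule norm_L2_class [OF square_integrable01_continuous [OF c]])
  also have "\<dots> \<le> (LINT t|lebesgue01. (real (Suc n) * K)\<^sup>2)"
  proof (rule integral_mono)
    show "integrable lebesgue01 (\<lambda>t. (poly q t)\<^sup>2)"
      using c by (intro integral_lebesgue01_continuous(2) continuous_on_power)
    show "integrable lebesgue01 (\<lambda>t. (real (Suc n) * K)\<^sup>2)"
      by (intro integral_lebesgue01_continuous(2) continuous_on_const)
    fix t assume "t \<in> space lebesgue01"
    then have "\<bar>poly q t\<bar>\<^sup>2 \<le> (real (Suc n) * K)\<^sup>2" using b by (intro power_mono) auto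
    then show "(poly q t)\<^sup>2 \<le> (real (Suc n) * K)\<^sup>2" by simp
  qed
  also have "\<dots> = (real (Suc n) * K)\<^sup>2" by (simp add: measure_lebesgue01)
  finally show ?thesis by (rule power2_le_imp_le) (use K in auto)
qed

text \<open>Each moment is one coordinate of the moment sequence, hence at most its norm, and the
  pairing has \<open>n + 1\<close> terms with coefficients bounded by \<open>K\<close>.\<close>

lemma norm_hausdorff_moment_poly:
  assumes "degree q \<le> n" "\<And>i. \<bar>coeff q i\<bar> \<le> K"
  shows "(norm (L2_class (poly q)))\<^sup>2 \<le> real (Suc n) * K * norm (hausdorff_moment (L2_class (poly q)))"
proof -
  define z where "z = L2_class (poly q)"
  have K: "0 \<le> K" using assms(2) [of 0] by simp
  have "poly q = (\<lambda>t. \<Sum>i\<le>n. coeff q i * t ^ i)"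
    unfolding poly_altdef using assms(1)
    by (intro ext sum.mono_neutral_left) (auto simp: coeff_eq_0 not_le)
  then have z: "z = (\<Sum>i\<le>n. coeff q i *\<^sub>R L2_class (\<lambda>t. t ^ i))"
    by (simp add: z_def sum_L2_class square_integrable01_power)
  have m: "\<bar>inner (L2_class (\<lambda>t. t ^ i)) z\<bar> \<le> norm (hausdorff_moment z)" for i
  proof -
    have "(Rep_ell2 (hausdorff_moment z) i)\<^sup>2 \<le> (norm (hausdorff_moment z))\<^sup>2"
      unfolding ell2_norm(1) using sum_le_suminf [OF ell2_norm(2), of "{i}"] by simp
    then have "sqrt ((Rep_ell2 (hausdorff_moment z) i)\<^sup>2) \<le> sqrt ((norm (hausdorff_moment z))\<^sup>2)"
      by (rule real_sqrt_le_mono)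
    then show ?thesis by (simp add: hausdorff_moment_nth)
  qed
  have "(norm z)\<^sup>2 = (\<Sum>i\<le>n. coeff q i * inner (L2_class (\<lambda>t. t ^ i)) z)"
    unfolding power2_norm_eq_inner by (subst z) (simp add: inner_sum_left)
  also have "\<dots> \<le> (\<Sum>i\<le>n. K * norm (hausdorff_moment z))"
  proof (rule sum_mono)
    fix i
    have "\<bar>coeff q i * inner (L2_class (\<lambda>t. t ^ i)) z\<bar> \<le> K * norm (hausdorff_moment z)"
      unfolding abs_mult using assms(2) m K by (intro mult_mono) auto
    then show "coeff q i * inner (L2_class (\<lambda>t. t ^ i)) z \<le> K * norm (hausdorff_moment z)" by linarith
  qed
  finally show ?thesis by (simp add: z_def)
qed

text \<open>Product of two bounds for polynomials of degree at most \<open>n\<close>: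
  \<open>4 * Suc k * Suc n ^ (2 * k + 4) * 7 ^ (2 * n)\<close> for the squared Sobolev norm against
  the squared \<open>L2\<close> norm, and \<open>4 * Suc n ^ 4 * 7 ^ (2 * n)\<close> for the latter
  against the squared norm of the moments.\<close>

definition moment_constant :: "nat \<Rightarrow> nat \<Rightarrow> real"
  where "moment_constant k n = 16 * real (Suc k) * real (Suc n) ^ (2 * k + 8) * 7 ^ (4 * n)"

text \<open>The coefficients of the polynomial are bounded by a multiple of \<open>norm x\<close>.
  This controls all derivatives, and through the moments also \<open>norm x\<close> itself. The
  second claim makes the test functions linearly independent.\<close>

lemma chebyshev01_sobolev01:
  fixes n :: nat and x :: L2
  assumes x: "x = (\<Sum>m\<le>n. b m *\<^sub>R L2_class (poly (chebyshev01 m)))"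
  shows "sobolev01_inner k x x \<le> moment_constant k n * inner (hausdorff_moment x) (hausdorff_moment x)"
    "(\<Sum>m\<le>n. (b m)\<^sup>2) \<le> 2 * inner x x"
proof -
  define p where "p = (\<Sum>m\<le>n. smult (b m) (chebyshev01 m))"
  have sq: "square_integrable01 (poly r)" for r by (intro square_integrable01_continuous continuous_intros)
  have xp: "x = L2_class (poly p)"
  proof -
    have "poly p = (\<lambda>t. \<Sum>m\<le>n. b m * poly (chebyshev01 m) t)" by (rule ext) (simp add: p_def poly_sum)
    then show ?thesis unfolding x by (simp add: sum_L2_class [OF sq])
  qed
  have b: "(\<Sum>m\<le>n. (b m)\<^sup>2) \<le> 2 * (norm x)\<^sup>2"
    unfolding xp p_def by (rule chebyshev01_norm)
  then show "(\<Sum>m\<le>n. (b m)\<^sup>2) \<le> 2 * inner x x" by (simp add: power2_norm_eq_inner)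
  have b1: "\<bar>b m\<bar> \<le> 2 * norm x" if "m \<le> n" for m
  proof -
    have "(b m)\<^sup>2 \<le> (\<Sum>m\<le>n. (b m)\<^sup>2)" using that by (intro member_le_sum) auto
    also have "\<dots> \<le> 4 * (norm x)\<^sup>2" using b zero_le_power2 [of "norm x"] by linarith
    also have "\<dots> = (2 * norm x)\<^sup>2" by (simp add: power_mult_distrib)
    finally show ?thesis using abs_le_square_iff [of "b m" "2 * norm x"] by simp
  qed
  \<comment> \<open>There are \<open>n + 1\<close> Chebyshev terms, each with weight at most
    \<open>2 * norm x\<close> and coefficients at most \<open>7 ^ n\<close>.\<close>
  define K where "K = 2 * real (Suc n) * 7 ^ n * norm x"
  have deg: "degree p \<le> n"
    unfolding p_def
    by (intro degree_sum_le) (auto intro: order_trans [OF degree_smult_le] order_trans [OF degree_chebyshev01])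
  have cK: "\<bar>coeff p i\<bar> \<le> K" for i
  proof -
    have "\<bar>coeff p i\<bar> \<le> (\<Sum>m\<le>n. \<bar>b m * coeff (chebyshev01 m) i\<bar>)"
      unfolding p_def coeff_sum coeff_smult by (rule sum_abs)
    also have "\<dots> \<le> (\<Sum>m\<le>n. 2 * norm x * 7 ^ n)"
    proof (rule sum_mono)
      fix m assume m: "m \<in> {..n}"
      have "\<bar>coeff (chebyshev01 m) i\<bar> \<le> 7 ^ n"
        by (rule order_trans [OF coeff_chebyshev01_bound]) (use m in \<open>auto intro: power_increasing\<close>)
      then show "\<bar>b m * coeff (chebyshev01 m) i\<bar> \<le> 2 * norm x * 7 ^ n"
        unfolding abs_mult using b1 m by (intro mult_mono) auto
    qed
    finally show ?thesis by (simp add: K_def algebra_simps)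
  qed
  define U where "U j = poly ((pderiv ^^ j) p)" for j
  have U: "(U j has_real_derivative U (Suc j) t) (at t)" for j t
    unfolding U_def using poly_DERIV by simp
  have xU: "x = L2_class (U 0)" by (simp add: xp U_def)
  have "sobolev01_inner k x x = (\<Sum>j\<le>k. (norm (L2_class (U j)))\<^sup>2)"
    unfolding sobolev01_inner_def xU using smooth_sobolev01(2) [of U, OF U] by (simp add: power2_norm_eq_inner)
  also have "\<dots> \<le> (\<Sum>j\<le>k. (real (Suc n) * (real (Suc n) ^ k * K))\<^sup>2)"
  proof (intro sum_mono power_mono)
    fix j assume j: "j \<in> {..k}"
    have K0: "0 \<le> K" by (simp add: K_def)
    have "norm (L2_class (U j)) \<le> real (Suc n) * (real (Suc n) ^ j * K)"
      unfolding U_def using coeff_pderiv_funpow_bound [OF deg cK] by (intro norm_poly_le) auto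
    also have "\<dots> \<le> real (Suc n) * (real (Suc n) ^ k * K)"
      using j K0 by (intro mult_left_mono mult_right_mono power_increasing) auto
    finally show "norm (L2_class (U j)) \<le> real (Suc n) * (real (Suc n) ^ k * K)" .
  qed simp
  also have "\<dots> = 4 * real (Suc k) * real (Suc n) ^ (2 * k + 4) * 7 ^ (2 * n) * (norm x)\<^sup>2"
    by (simp add: K_def power_mult_distrib power_add power_mult [symmetric] mult_ac power2_eq_square eval_nat_numeral power_even_eq)
      (simp add: algebra_simps)
  also have "\<dots> \<le> 4 * real (Suc k) * real (Suc n) ^ (2 * k + 4) * 7 ^ (2 * n) *
      (2 * real (Suc n) ^ 2 * 7 ^ n * norm (hausdorff_moment x))\<^sup>2"
  proof (intro mult_left_mono power_mono)
    \<comment> \<open>\<open>K\<close> contains one factor \<open>norm x\<close>, so the quadratic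
      bound can be divided by \<open>norm x\<close>.\<close>
    have "norm x * norm x \<le> norm x * (2 * real (Suc n) ^ 2 * 7 ^ n * norm (hausdorff_moment x))"
      using norm_hausdorff_moment_poly [OF deg cK] by (simp add: xp [symmetric] K_def power2_eq_square algebra_simps)
    then show "norm x \<le> 2 * real (Suc n) ^ 2 * 7 ^ n * norm (hausdorff_moment x)"
      by (cases "norm x = 0") auto
  qed auto
  also have "\<dots> = moment_constant k n * inner (hausdorff_moment x) (hausdorff_moment x)"
  proof -
    have "(7::real) ^ (4 * n) = 7 ^ (2 * n) * (7 ^ n)\<^sup>2" by (simp add: power_mult [symmetric] power_add [symmetric])
    moreover have "real (Suc n) ^ (2 * k + 8) = real (Suc n) ^ (2 * k + 4) * (real (Suc n) ^ 2)\<^sup>2"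
      by (simp add: power_mult [symmetric] power_add [symmetric] add.commute)
    ultimately show ?thesis
      unfolding moment_constant_def power2_norm_eq_inner [symmetric] by (simp add: power_mult_distrib mult_ac)
  qed
  finally show "sobolev01_inner k x x \<le> moment_constant k n * inner (hausdorff_moment x) (hausdorff_moment x)" .
qed

section \<open>Singular value estimates\<close>

lemma psd_form_sobolev01: "psd_form (sobolev01 k) (sobolev01_inner k)"
proof
  show "subspace (sobolev01 k)" by (rule subspace_sobolev01)
  fix x y z :: L2 and c :: real
  show "sobolev01_inner k x y = sobolev01_inner k y x"
    unfolding sobolev01_inner_def by (simp add: inner_commute)
  assume x: "x \<in> sobolev01 k"
  show "0 \<le> sobolev01_inner k x x" unfolding sobolev01_inner_def by (intro sum_nonneg) auto
  show "sobolev01_inner k (c *\<^sub>R x) z = c * sobolev01_inner k x z"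
    unfolding sobolev01_inner_def using x by (simp add: weak_deriv01_scale sum_distrib_left)
  assume "y \<in> sobolev01 k"
  with x show "sobolev01_inner k (x + y) z = sobolev01_inner k x z + sobolev01_inner k y z"
    unfolding sobolev01_inner_def by (simp add: weak_deriv01_add inner_add_left sum.distrib)
qed

lemma norm_weak_deriv01_le: "j \<le> k \<Longrightarrow> (norm (weak_deriv01 j x))\<^sup>2 \<le> sobolev01_inner k x x"
  unfolding sobolev01_inner_def power2_norm_eq_inner by (intro member_le_sum) auto

lemma norm_le_sobolev01_inner: "(norm x)\<^sup>2 \<le> sobolev01_inner k x x"
  using norm_weak_deriv01_le [of 0 k x] by (simp add: weak_deriv01_0)

text \<open>The bound on \<open>T\<close> is in the \<open>L2\<close> norm, so that both operators
  are covered. The functionals required by compactness are scaled cell means, and the first-order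
  \<open>Poincare\<close> bounds the rest by \<open>C / N\<^sup>2\<close> times the squared Sobolev
  norm.\<close>

lemma compact_form_sobolev01:
  fixes T :: "L2 \<Rightarrow> 'b::real_inner"
  assumes k: "k \<ge> 1"
    and add: "\<And>x y. x \<in> sobolev01 k \<Longrightarrow> y \<in> sobolev01 k \<Longrightarrow> T (x + y) = T x + T y"
    and scale: "\<And>x c. x \<in> sobolev01 k \<Longrightarrow> T (c *\<^sub>R x) = c *\<^sub>R T x"
    and bound: "\<And>x. x \<in> sobolev01 k \<Longrightarrow> (norm (T x))\<^sup>2 \<le> C * (norm x)\<^sup>2" and C: "C > 0"
    and rank: "\<And>n. \<exists>v. (\<forall>j\<le>n. v j \<in> sobolev01 k) \<and> (\<forall>c. (\<exists>j\<le>n::nat. c j \<noteq> 0) \<longrightarrow> T (\<Sum>j\<le>n. c j *\<^sub>R v j) \<noteq> 0)"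
  shows "compact_form (sobolev01 k) (sobolev01_inner k) (\<lambda>x y. inner (T x) (T y))"
proof -
  interpret ip: psd_form "sobolev01 k" "sobolev01_inner k" by (rule psd_form_sobolev01)
  have a: "psd_form (sobolev01 k) (\<lambda>x y. inner (T x) (T y))"
    by unfold_locales (auto simp: subspace_sobolev01 add scale inner_add_left intro: inner_commute)
  show ?thesis
  proof (intro compact_form.intro psd_form_sobolev01 a compact_form_axioms.intro)
    fix x assume "x \<in> sobolev01 k" "sobolev01_inner k x x = 0"
    then show "x = 0" using norm_le_sobolev01_inner [of x k] by simp
  next
    fix X :: "nat \<Rightarrow> L2"
    assume "\<And>n. X n \<in> sobolev01 k"
      "\<And>e. 0 < e \<Longrightarrow> \<exists>N. \<forall>m\<ge>N. \<forall>n\<ge>N. sobolev01_inner k (X m - X n) (X m - X n) < e"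
    then show "\<exists>x\<in>sobolev01 k. (\<lambda>n. sobolev01_inner k (X n - x) (X n - x)) \<longlonglongrightarrow> 0"
      by (rule sobolev01_complete)
  next
    fix e :: real assume e: "e > 0"
    define N where "N = Suc (nat \<lceil>C / e\<rceil>)"
    have N: "N \<ge> 1" by (simp add: N_def)
    have Ne: "C * (1 / real N)\<^sup>2 \<le> e"
    proof -
      have "C / e \<le> real N" unfolding N_def by linarith
      then have "C \<le> e * real N" using e by (simp add: field_simps)
      also have "\<dots> \<le> e * (real N)\<^sup>2" using N e by (intro mult_left_mono) (auto simp: power2_eq_square)
      finally show ?thesis using N by (simp add: field_simps power_divide)
    qed
    \<comment> \<open>The scaling absorbs the factors \<open>C\<close> and \<open>N\<close> of the
      mean term in \<open>Poincare\<close>.\<close>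
    define f where "f j x = sqrt (C * real N) * inner x (cell_class N j)" for j x
    have f2: "(f j x)\<^sup>2 = C * real N * (inner x (cell_class N j))\<^sup>2" for j x
      using C by (simp add: f_def power_mult_distrib)
    define B where "B = C * real N * (\<Sum>m<N. (norm (cell_class N m))\<^sup>2)"
    have "(f j x)\<^sup>2 \<le> B * sobolev01_inner k x x" if "j < N" for j x
    proof -
      have "(inner x (cell_class N j))\<^sup>2 \<le> (norm x)\<^sup>2 * (norm (cell_class N j))\<^sup>2"
        using Cauchy_Schwarz_ineq [of x "cell_class N j"] by (simp add: power2_norm_eq_inner)
      also have "\<dots> \<le> sobolev01_inner k x x * (\<Sum>m<N. (norm (cell_class N m))\<^sup>2)"
        using that order_trans [OF zero_le_power2 norm_le_sobolev01_inner]
        by (intro mult_mono norm_le_sobolev01_inner member_le_sum) auto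
      finally have "C * real N * (inner x (cell_class N j))\<^sup>2
          \<le> C * real N * (sobolev01_inner k x x * (\<Sum>m<N. (norm (cell_class N m))\<^sup>2))"
        using C by (intro mult_left_mono) auto
      then show ?thesis by (simp add: f2 B_def mult_ac)
    qed
    moreover have "inner (T x) (T x) \<le> e * sobolev01_inner k x x + (\<Sum>j<N. (f j x)\<^sup>2)" if x: "x \<in> sobolev01 k" for x
    proof -
      have "inner (T x) (T x) \<le> C * (norm x)\<^sup>2" using bound [OF x] by (simp add: power2_norm_eq_inner)
      also have "\<dots> \<le> C * ((1 / real N)\<^sup>2 * (norm (weak_deriv01 1 x))\<^sup>2 + real N * (\<Sum>m<N. (inner x (cell_class N m))\<^sup>2))"
        using C by (intro mult_left_mono Poincare [OF N] sobolev01_has_weak_deriv [OF x k]) auto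
      also have "\<dots> = C * (1 / real N)\<^sup>2 * (norm (weak_deriv01 1 x))\<^sup>2 + (\<Sum>j<N. (f j x)\<^sup>2)"
        by (simp add: f2 distrib_left sum_distrib_left mult_ac)
      also have "C * (1 / real N)\<^sup>2 * (norm (weak_deriv01 1 x))\<^sup>2 \<le> e * sobolev01_inner k x x"
        using e by (intro mult_mono Ne norm_weak_deriv01_le k) auto
      finally show ?thesis by simp
    qed
    moreover have "f j (x + y) = f j x + f j y" "f j (c *\<^sub>R x) = c * f j x" for j x y c
      by (simp_all add: f_def inner_add_left algebra_simps)
    ultimately show "\<exists>(m::nat) f B. (\<forall>j<m. \<forall>x\<in>sobolev01 k. \<forall>y\<in>sobolev01 k. f j (x + y) = f j x + f j y) \<and>
      (\<forall>j<m. \<forall>x\<in>sobolev01 k. \<forall>c. f j (c *\<^sub>R x) = c * f j x) \<and>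
      (\<forall>j<m. \<forall>x\<in>sobolev01 k. (f j x)\<^sup>2 \<le> B * sobolev01_inner k x x) \<and>
      (\<forall>x\<in>sobolev01 k. inner (T x) (T x) \<le> e * sobolev01_inner k x x + (\<Sum>j<m. (f j x)\<^sup>2))"
      by (intro exI [of _ N] exI [of _ f] exI [of _ B]) simp
  next
    fix n :: nat
    show "\<exists>v. (\<forall>j<n. v j \<in> sobolev01 k) \<and>
      (\<forall>c. (\<exists>j<n. c j \<noteq> 0) \<longrightarrow> 0 < inner (T (\<Sum>j<n. c j *\<^sub>R v j)) (T (\<Sum>j<n. c j *\<^sub>R v j)))"
    proof (cases n)
      case (Suc m)
      with rank [of m] show ?thesis by (auto simp: lessThan_Suc_atMost less_Suc_eq_le)
    qed simp
  qed
qed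

lemma hausdorff_moment_add: "hausdorff_moment (x + y) = hausdorff_moment x + hausdorff_moment y"
  by (simp add: Rep_ell2_inject [symmetric] plus_ell2.rep_eq hausdorff_moment_nth inner_add_right fun_eq_iff)

lemma hausdorff_moment_scale: "hausdorff_moment (c *\<^sub>R x) = c *\<^sub>R hausdorff_moment x"
  by (simp add: Rep_ell2_inject [symmetric] scaleR_ell2.rep_eq hausdorff_moment_nth fun_eq_iff)

lemma cos_family_in_sobolev01: "L2_class (cos_family l 0) \<in> sobolev01 k"
  by (rule smooth_sobolev01(1)) (rule cos_family_derivative)

lemma poly_in_sobolev01: "L2_class (poly p) \<in> sobolev01 k"
proof -
  have "(poly ((pderiv ^^ j) p) has_real_derivative poly ((pderiv ^^ Suc j) p) t) (at t)" for j t
    using poly_DERIV by simp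
  from smooth_sobolev01(1) [of "\<lambda>j. poly ((pderiv ^^ j) p)", OF this] show ?thesis by simp
qed

lemma cos_family_combination_nonzero:
  assumes "\<exists>j\<le>n::nat. c j \<noteq> 0" "x = (\<Sum>l\<le>n. c l *\<^sub>R L2_class (cos_family (Suc l) 0))"
  shows "inner x x > 0"
proof -
  obtain j where j: "j \<le> n" "c j \<noteq> 0" using assms by blast
  then have "0 < (c j)\<^sup>2 / 2" by simp
  also have "\<dots> \<le> (\<Sum>l\<le>n. (c l)\<^sup>2 / 2)"
    by (rule member_le_sum) (use j in auto)
  finally show ?thesis using cos_family_sobolev01(2) [OF assms(2)] by linarith
qed

lemma chebyshev01_combination_nonzero:
  assumes "\<exists>j\<le>n::nat. c j \<noteq> 0" "x = (\<Sum>m\<le>n. c m *\<^sub>R L2_class (poly (chebyshev01 m)))"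
  shows "inner x x > 0"
proof -
  obtain j where j: "j \<le> n" "c j \<noteq> 0" using assms by blast
  then have "0 < (c j)\<^sup>2" by simp
  also have "\<dots> \<le> (\<Sum>l\<le>n. (c l)\<^sup>2)" by (rule member_le_sum) (use j in auto)
  finally show ?thesis using chebyshev01_sobolev01(2) [OF assms(2)] by linarith
qed

lemma moment_constant_pos: "moment_constant k n > 0"
  by (simp add: moment_constant_def)

lemma sobolev01_singular_values:
  assumes k: "k \<ge> 1"
  defines "\<sigma> n \<equiv> singular_value (sobolev01 k) (sobolev01_inner k) (sobolev01_embedding k) (Suc n)"
    and "\<tau> n \<equiv> singular_value (sobolev01 k) (sobolev01_inner k) (hausdorff_moment \<circ> sobolev01_embedding k) (Suc n)"
  shows "\<tau> n \<le> sqrt pi * \<sigma> n"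
    and "N \<ge> 1 \<Longrightarrow> k * N \<le> n \<Longrightarrow> \<sigma> n \<le> (1 / real N) ^ k"
    and "1 / (sqrt (real (Suc k)) * (pi * real (Suc n)) ^ k) \<le> \<sigma> n"
    and "1 / sqrt (moment_constant k n) \<le> \<tau> n"
proof -
  let ?V = "sobolev01 k" and ?ip = "sobolev01_inner k"
  have emb: "sobolev01_embedding k x = x" if "x \<in> ?V" for x
    using that by (simp add: sobolev01_embedding_def)
  have "\<exists>v. (\<forall>j\<le>n. v j \<in> ?V) \<and> (\<forall>c. (\<exists>j\<le>n. c j \<noteq> 0) \<longrightarrow> (\<Sum>j\<le>n. c j *\<^sub>R v j) \<noteq> 0)" for n :: nat
    using cos_family_in_sobolev01 cos_family_combination_nonzero
    by (intro exI [of _ "\<lambda>l. L2_class (cos_family (Suc l) 0)"]) fastforce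
  then have "compact_form ?V ?ip inner"
    using compact_form_sobolev01 [OF k, of "\<lambda>x. x" 1] by simp
  then obtain e l where "eigen_form ?V ?ip inner e l"
    using compact_form.eigen_form_exists by blast
  then interpret E: eigen_form ?V ?ip inner e l .
  have \<sigma>: "\<sigma> n = sqrt (l n)" for n unfolding \<sigma>_def by (rule E.singular_value_eq) (simp add: emb)
  \<comment> \<open>The quantitative bound for Chebyshev combinations already shows that nonzero
    ones have nonzero moments.\<close>
  have rank: "\<exists>v. (\<forall>j\<le>n. v j \<in> ?V) \<and> (\<forall>c. (\<exists>j\<le>n. c j \<noteq> 0) \<longrightarrow> hausdorff_moment (\<Sum>j\<le>n. c j *\<^sub>R v j) \<noteq> 0)" for n :: nat
  proof (intro exI conjI allI impI)
    show "L2_class (poly (chebyshev01 j)) \<in> ?V" for j by (rule poly_in_sobolev01)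
    fix c :: "nat \<Rightarrow> real" assume c: "\<exists>j\<le>n. c j \<noteq> 0"
    define x where "x = (\<Sum>j\<le>n. c j *\<^sub>R L2_class (poly (chebyshev01 j)))"
    have "0 < (norm x)\<^sup>2"
      using chebyshev01_combination_nonzero [OF c x_def] by (simp add: power2_norm_eq_inner)
    also have "\<dots> \<le> ?ip x x" by (rule norm_le_sobolev01_inner)
    also have "\<dots> \<le> moment_constant k n * inner (hausdorff_moment x) (hausdorff_moment x)"
      by (rule chebyshev01_sobolev01(1) [OF x_def])
    finally show "hausdorff_moment (\<Sum>j\<le>n. c j *\<^sub>R L2_class (poly (chebyshev01 j))) \<noteq> 0"
      unfolding x_def [symmetric] by auto
  qed
  then have "compact_form ?V ?ip (\<lambda>x y. inner (hausdorff_moment x) (hausdorff_moment y))"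
    by (intro compact_form_sobolev01 [OF k, where C = pi] hausdorff_moment_add hausdorff_moment_scale
        norm_hausdorff_moment_le pi_gt_zero)
  then obtain e' l' where "eigen_form ?V ?ip (\<lambda>x y. inner (hausdorff_moment x) (hausdorff_moment y)) e' l'"
    using compact_form.eigen_form_exists by blast
  then interpret B: eigen_form ?V ?ip "\<lambda>x y. inner (hausdorff_moment x) (hausdorff_moment y)" e' l' .
  have \<tau>: "\<tau> n = sqrt (l' n)" for n unfolding \<tau>_def by (rule B.singular_value_eq) (simp add: emb)
  \<comment> \<open>The eigenvectors of the embedding supply the functionals: on their common kernel
    \<open>E.l_max\<close> bounds the \<open>L2\<close> norm, and Hilbert's inequality transfers
    this to the moments.\<close>
  have "l' n \<le> pi * l n"
  proof (rule B.le_of_functionals [where f = "\<lambda>j x. ?ip x (e j)"])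
    fix x assume x: "x \<in> ?V" "\<forall>j<n. ?ip x (e j) = 0"
    have "inner (hausdorff_moment x) (hausdorff_moment x) \<le> pi * inner x x"
      using norm_hausdorff_moment_le [of x] by (simp add: power2_norm_eq_inner)
    also have "\<dots> \<le> pi * (l n * ?ip x x)" using x by (intro mult_left_mono E.l_max) auto
    finally show "inner (hausdorff_moment x) (hausdorff_moment x) \<le> pi * l n * ?ip x x" by simp
  qed (use E.e_V in \<open>auto simp: E.ip.add_left E.ip.scale_left\<close>)
  then show "\<tau> n \<le> sqrt pi * \<sigma> n" unfolding \<tau> \<sigma> real_sqrt_mult [symmetric] by (rule real_sqrt_le_mono)
  show "\<sigma> n \<le> (1 / real N) ^ k" if N: "N \<ge> 1" "k * N \<le> n"
  proof -
    have "l (k * N) \<le> ((1 / real N)\<^sup>2) ^ k"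
    \<comment> \<open>Pairs of a derivative order \<open>j\<close> and a cell \<open>m\<close> are
      numbered as \<open>i = j * N + m\<close>.\<close>
    proof (rule E.le_of_functionals [where f = "\<lambda>i x. inner (weak_deriv01 (i div N) x) (cell_class N (i mod N))"])
      fix i x y and c :: real assume i: "i < k * N"
      then have "i div N \<le> k" using N by (simp add: less_mult_imp_div_less less_imp_le)
      then show "x \<in> ?V \<Longrightarrow> y \<in> ?V \<Longrightarrow> inner (weak_deriv01 (i div N) (x + y)) (cell_class N (i mod N)) =
          inner (weak_deriv01 (i div N) x) (cell_class N (i mod N)) + inner (weak_deriv01 (i div N) y) (cell_class N (i mod N))"
        "x \<in> ?V \<Longrightarrow> inner (weak_deriv01 (i div N) (c *\<^sub>R x)) (cell_class N (i mod N)) =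
          c * inner (weak_deriv01 (i div N) x) (cell_class N (i mod N))"
        by (simp_all add: weak_deriv01_add weak_deriv01_scale inner_add_left)
    next
      fix x assume x: "x \<in> ?V" "\<forall>i<k * N. inner (weak_deriv01 (i div N) x) (cell_class N (i mod N)) = 0"
      have "inner (weak_deriv01 j x) (cell_class N m) = 0" if "j < k" "m < N" for j m
      proof -
        have "j * N + m < Suc j * N" using that by simp
        also have "\<dots> \<le> k * N" using that by (intro mult_right_mono) auto
        finally have "j * N + m < k * N" .
        with x(2) that show ?thesis by fastforce
      qed
      then have "(norm x)\<^sup>2 \<le> ((1 / real N)\<^sup>2) ^ k * (norm (weak_deriv01 k x))\<^sup>2"
        by (intro norm_le_weak_deriv01 N x)
      also have "\<dots> \<le> ((1 / real N)\<^sup>2) ^ k * ?ip x x"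
        by (intro mult_left_mono norm_weak_deriv01_le) auto
      finally show "inner x x \<le> ((1 / real N)\<^sup>2) ^ k * ?ip x x" by (simp add: power2_norm_eq_inner)
    qed
    then have "l n \<le> ((1 / real N) ^ k)\<^sup>2"
      using E.l_antimono [OF N(2)] by (simp add: power_mult [symmetric] mult.commute)
    then have "sqrt (l n) \<le> sqrt (((1 / real N) ^ k)\<^sup>2)" by (rule real_sqrt_le_mono)
    then show ?thesis by (simp add: \<sigma>)
  qed
  have "1 / (real (Suc k) * (pi * real (Suc n)) ^ (2 * k)) \<le> l n"
  proof (rule E.ge_of_test_subspace)
    show "L2_class (cos_family (Suc j) 0) \<in> ?V" for j by (rule cos_family_in_sobolev01)
    fix c x assume c: "\<exists>j\<le>n. c j \<noteq> 0" and x: "x = (\<Sum>j\<le>n. c j *\<^sub>R L2_class (cos_family (Suc j) 0))"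
    have "0 < inner x x" by (rule cos_family_combination_nonzero [OF c x])
    moreover have "inner x x \<le> ?ip x x" using norm_le_sobolev01_inner by (simp add: power2_norm_eq_inner [symmetric])
    moreover have "1 / (real (Suc k) * (pi * real (Suc n)) ^ (2 * k)) * ?ip x x \<le> inner x x"
      using cos_family_sobolev01(1) [OF x, of k] by (simp add: divide_le_eq mult.commute)
    ultimately show "?ip x x > 0 \<and> 1 / (real (Suc k) * (pi * real (Suc n)) ^ (2 * k)) * ?ip x x \<le> inner x x" by linarith
  qed
  then have "sqrt (1 / (real (Suc k) * (pi * real (Suc n)) ^ (2 * k))) \<le> \<sigma> n"
    unfolding \<sigma> by (rule real_sqrt_le_mono)
  moreover have "sqrt (1 / (real (Suc k) * (pi * real (Suc n)) ^ (2 * k))) = 1 / (sqrt (real (Suc k)) * (pi * real (Suc n)) ^ k)"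
    by (simp only: power_even_eq real_sqrt_divide real_sqrt_mult [of "real (Suc k)"] real_sqrt_abs real_sqrt_one) simp
  ultimately show "1 / (sqrt (real (Suc k)) * (pi * real (Suc n)) ^ k) \<le> \<sigma> n" by simp
  have "1 / moment_constant k n \<le> l' n"
  proof (rule B.ge_of_test_subspace)
    show "L2_class (poly (chebyshev01 j)) \<in> ?V" for j by (rule poly_in_sobolev01)
    fix c x assume c: "\<exists>j\<le>n. c j \<noteq> 0" and x: "x = (\<Sum>j\<le>n. c j *\<^sub>R L2_class (poly (chebyshev01 j)))"
    have "0 < inner x x" by (rule chebyshev01_combination_nonzero [OF c x])
    moreover have "inner x x \<le> ?ip x x" using norm_le_sobolev01_inner by (simp add: power2_norm_eq_inner [symmetric])
    moreover have "1 / moment_constant k n * ?ip x x \<le> inner (hausdorff_moment x) (hausdorff_moment x)"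
      using chebyshev01_sobolev01(1) [OF x, of k] moment_constant_pos [of k n]
      by (simp add: divide_le_eq mult.commute)
    ultimately show "?ip x x > 0 \<and> 1 / moment_constant k n * ?ip x x \<le> inner (hausdorff_moment x) (hausdorff_moment x)" by linarith
  qed
  then have "sqrt (1 / moment_constant k n) \<le> \<tau> n" unfolding \<tau> by (rule real_sqrt_le_mono)
  then show "1 / sqrt (moment_constant k n) \<le> \<tau> n" by (simp add: real_sqrt_divide)
qed

text \<open>Each factor is estimated by \<open>x \<le> exp x\<close>, and
  \<open>16 * (k + 1) + (2 * k + 8) + 28 = 2 * (9 * k + 26)\<close>. The factor 2 is set apart
  because the singular value involves the square root.\<close>

lemma moment_constant_le_exp:
  "moment_constant k n \<le> exp (2 * (real (9 * k + 26) * real (Suc n)))"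
proof -
  define i where "i = real (Suc n)"
  have i: "i \<ge> 1" "real n \<le> i" by (auto simp: i_def)
  have le: "x \<le> exp x" for x :: real using exp_ge_add_one_self [of x] by linarith
  have "16 * real (Suc k) \<le> exp (16 * real (Suc k))" by (rule le)
  also have "\<dots> \<le> exp (16 * real (Suc k) * i)" using i by simp
  finally have 1: "16 * real (Suc k) \<le> exp (16 * real (Suc k) * i)" .
  have "i ^ (2 * k + 8) \<le> exp i ^ (2 * k + 8)" using i le by (intro power_mono) auto
  also have "\<dots> = exp (real (2 * k + 8) * i)" by (rule exp_of_nat_mult [symmetric])
  finally have 2: "i ^ (2 * k + 8) \<le> exp (real (2 * k + 8) * i)" .
  have "(7::real) ^ (4 * n) \<le> exp 7 ^ (4 * n)" using le [of 7] by (intro power_mono) auto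
  also have "\<dots> = exp (real (4 * n) * 7)" by (rule exp_of_nat_mult [symmetric])
  also have "\<dots> \<le> exp (28 * i)" using i by simp
  finally have 3: "(7::real) ^ (4 * n) \<le> exp (28 * i)" .
  have "moment_constant k n = 16 * real (Suc k) * i ^ (2 * k + 8) * 7 ^ (4 * n)"
    by (simp add: moment_constant_def i_def)
  also have "\<dots> \<le> exp (16 * real (Suc k) * i) * exp (real (2 * k + 8) * i) * exp (28 * i)"
    using i by (intro mult_mono 1 2 3) auto
  also have "\<dots> = exp (2 * (real (9 * k + 26) * i))"
    unfolding exp_add [symmetric] by (simp add: algebra_simps)
  finally show ?thesis by (simp add: i_def)
qed

theorem corollary1:
  fixes k :: nat
  assumes "k \<ge> 1"
  shows "\<exists>C_k C_lower C_upper :: real. C_k > 0 \<and> C_lower > 0 \<and> C_upper > 0 \<and>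
    (\<forall>\<^sub>F i in sequentially.
      exp (- (C_lower * real i))
        \<le> exp (- ((C_k / singular_value (sobolev01 k) (sobolev01_inner k) (sobolev01_embedding k) i)
                    powr (1 / real k))) \<and>
      exp (- ((C_k / singular_value (sobolev01 k) (sobolev01_inner k) (sobolev01_embedding k) i)
                powr (1 / real k)))
        \<le> singular_value (sobolev01 k) (sobolev01_inner k)
            (hausdorff_moment \<circ> sobolev01_embedding k) i \<and>
      singular_value (sobolev01 k) (sobolev01_inner k)
            (hausdorff_moment \<circ> sobolev01_embedding k) i
        \<le> sqrt pi * singular_value (sobolev01 k) (sobolev01_inner k) (sobolev01_embedding k) i \<and>
      sqrt pi * singular_value (sobolev01 k) (sobolev01_inner k) (sobolev01_embedding k) i
        \<le> C_upper / real i ^ k)"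
proof -
  let ?\<sigma> = "singular_value (sobolev01 k) (sobolev01_inner k) (sobolev01_embedding k)"
  let ?\<tau> = "singular_value (sobolev01 k) (sobolev01_inner k) (hausdorff_moment \<circ> sobolev01_embedding k)"
  have k: "real k > 0" using assms by simp
  \<comment> \<open>Comes from \<open>\<sigma> i \<le> (1 / N) ^ k\<close> and
    \<open>1 / N \<le> 2 * k / i\<close>.\<close>
  define A where "A = (2 * real k) ^ k"
  define c where "c = 1 / (sqrt (real (Suc k)) * pi ^ k)"
  define D where "D = real (9 * k + 26)"
  \<comment> \<open>Chosen so that \<open>\<sigma> i \<le> A / i ^ k\<close> becomes
    \<open>D * i \<le> (C / \<sigma> i) powr (1 / k)\<close>.\<close>
  define C where "C = A * D ^ k"
  \<comment> \<open>Chosen so that \<open>c / i ^ k \<le> \<sigma> i\<close> becomes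
    \<open>(C / \<sigma> i) powr (1 / k) \<le> L * i\<close>.\<close>
  define L where "L = (C / c) powr (1 / real k)"
  have pos: "A > 0" "c > 0" "D > 0" "C > 0" "L > 0"
    using k by (auto simp: A_def c_def D_def C_def L_def intro!: mult_pos_pos divide_pos_pos)
  have root: "(x ^ k) powr (1 / real k) = x" if "x > 0" for x :: real
    using that k by (simp add: powr_powr flip: powr_realpow)
  have main: "exp (- (L * real i)) \<le> exp (- ((C / ?\<sigma> i) powr (1 / real k))) \<and>
      exp (- ((C / ?\<sigma> i) powr (1 / real k))) \<le> ?\<tau> i \<and>
      ?\<tau> i \<le> sqrt pi * ?\<sigma> i \<and> sqrt pi * ?\<sigma> i \<le> (sqrt pi * A) / real i ^ k" if i: "i \<ge> k + 1" for i
  proof -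
    define n where "n = i - 1"
    have n: "i = Suc n" using i by (simp add: n_def)
    \<comment> \<open>The largest number of cells whose \<open>k * N\<close> conditions do not
      exceed \<open>n\<close>; \<open>i \<ge> k + 1\<close> makes it positive.\<close>
    define N where "N = n div k"
    have N: "N \<ge> 1" "k * N \<le> n" using i assms by (auto simp: N_def n div_greater_zero_iff Suc_le_eq)
    note sv = sobolev01_singular_values [OF assms, where n = n, folded n]
    have i0: "real i > 0" using n by simp
    have up: "?\<sigma> i \<le> A / real i ^ k"
    proof -
      \<comment> \<open>Rounding \<open>n / k\<close> down and passing from \<open>n\<close> to
        \<open>i\<close> cost at most a factor 2, because \<open>N \<ge> 1\<close>.\<close>
      have "n < k * N + k" using assms unfolding N_def by (metis add.commute div_mult_mod_eq mod_less_divisor mult.commute nat_add_left_cancel_less less_le_trans zero_less_one)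
      then have "i \<le> k * N + k * 1" using n by simp
      also have "\<dots> \<le> k * N + k * N" using N by (intro add_mono mult_left_mono) auto
      finally have "real i \<le> real (2 * k * N)" by (subst of_nat_le_iff) simp
      then have "1 / real N \<le> 2 * real k / real i" using N i0 by (simp add: field_simps)
      then have "(1 / real N) ^ k \<le> (2 * real k / real i) ^ k" by (intro power_mono) auto
      also have "\<dots> = A / real i ^ k" by (simp add: A_def power_divide)
      finally show ?thesis using sv(2) [OF N] by linarith
    qed
    have low: "c / real i ^ k \<le> ?\<sigma> i"
      using sv(3) unfolding n [symmetric] by (simp add: c_def power_mult_distrib mult.assoc)
    have "c / real i ^ k > 0" using pos i0 by simp
    then have \<sigma>0: "?\<sigma> i > 0" using low by linarith
    have "(D * real i) ^ k \<le> C / ?\<sigma> i"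
    proof -
      have "C / (A / real i ^ k) \<le> C / ?\<sigma> i"
        using up \<sigma>0 pos i0 by (intro divide_left_mono) auto
      then show ?thesis using pos by (simp add: C_def power_mult_distrib)
    qed
    then have "((D * real i) ^ k) powr (1 / real k) \<le> (C / ?\<sigma> i) powr (1 / real k)"
      using pos i0 by (intro powr_mono2) auto
    then have Di: "D * real i \<le> (C / ?\<sigma> i) powr (1 / real k)"
      using root [of "D * real i"] pos i0 by simp
    have "C / ?\<sigma> i \<le> C / (c / real i ^ k)"
      using low \<sigma>0 pos i0 by (intro divide_left_mono) auto
    then have "(C / ?\<sigma> i) powr (1 / real k) \<le> (C / c * real i ^ k) powr (1 / real k)"
      using pos \<sigma>0 by (intro powr_mono2) auto
    also have "\<dots> = L * real i"
      unfolding L_def using pos i0 by (subst powr_mult) (simp_all add: root)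
    finally have Li: "(C / ?\<sigma> i) powr (1 / real k) \<le> L * real i" .
    have "exp (- (D * real i)) \<le> ?\<tau> i"
    proof -
      have "sqrt (moment_constant k n) \<le> sqrt ((exp (D * real i))\<^sup>2)"
        using moment_constant_le_exp [of k n]
        by (intro real_sqrt_le_mono) (simp add: D_def n exp_double [symmetric])
      then have "sqrt (moment_constant k n) \<le> exp (D * real i)" by simp
      then have "1 / exp (D * real i) \<le> 1 / sqrt (moment_constant k n)"
        using moment_constant_pos [of k n] by (intro divide_left_mono) auto
      also have "\<dots> \<le> ?\<tau> i" by (rule sv(4))
      finally show ?thesis by (simp add: exp_minus field_simps)
    qed
    then have "exp (- ((C / ?\<sigma> i) powr (1 / real k))) \<le> ?\<tau> i"
      using Di by (meson exp_le_cancel_iff neg_le_iff_le order_trans)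
    moreover have "sqrt pi * ?\<sigma> i \<le> sqrt pi * (A / real i ^ k)"
      using up by (intro mult_left_mono) auto
    ultimately show ?thesis using Li sv(1) by simp
  qed
  have "\<forall>\<^sub>F i in sequentially. exp (- (L * real i)) \<le> exp (- ((C / ?\<sigma> i) powr (1 / real k))) \<and>
      exp (- ((C / ?\<sigma> i) powr (1 / real k))) \<le> ?\<tau> i \<and>
      ?\<tau> i \<le> sqrt pi * ?\<sigma> i \<and> sqrt pi * ?\<sigma> i \<le> (sqrt pi * A) / real i ^ k"
    using eventually_ge_at_top [of "k + 1"] by eventually_elim (rule main)
  moreover have "sqrt pi * A > 0" using pos by simp
  ultimately show ?thesis using pos by blast
qed

end
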